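(* Let $(\Omega,\mathcal F,\nu,T)$ be an invertible probability dynamical system, let $0<\alpha<1$, let $d\ge1$, and let $a:\Omega\to\mathbb{R}^d$ be a $\nu$-centered function belonging to $L^\infty(\Omega,\mathbb{R}^d)$. Let $(X_n)_{n\in\mathbb{Z}}$ be the stationary Markov chain on $(\tilde\Omega,\tilde{\mathcal F},\tilde\nu)$ described in the context. Then there exists a constant $B>0$ such that, for every Lipschitz continuous function $\phi:\mathbb{R}^d\to\mathbb{R}$ and every integer $n\ge1$, $$\left|\mathbb{E}_{\tilde\nu}\left[\phi\left(\frac1{\sqrt n}\sum_{k=0}^{n-1}a(X_k)\right)\right]-\mathbb{E}[\phi(N)]\right|\le\frac{B}{\sqrt n}L_\phi,$$ where $N$ is a $d$-dimensional centered Gaussian random variable with covariance matrix $D(a)=\sum_{k\in\mathbb{Z}}(1-\alpha)^{|k|}\,\mathbb{E}_\nu[a\otimes a\circ T^k]$.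
   Context: An invertible probability dynamical system $(\Omega,\mathcal F,\nu,T)$ is a probability space with an invertible $\nu$-preserving transformation $T$. $L^\infty(\Omega,\mathbb{R}^d)$ is the set of measurable functions $\Omega\to\mathbb{R}^d$ that are $\nu$-almost surely bounded. $|\cdot|_\infty$ is the supremum norm on $\mathbb{R}^d$ and $L_\phi:=\sup_{x\ne y}\frac{|\phi(x)-\phi(y)|}{|x-y|_\infty}$. For $A,B\in\mathbb{R}^d$, $A\otimes B$ is the matrix $(a_ib_j)_{i,j}$; expectations of matrices are entrywise. Gaussian variables with degenerate covariance matrix are allowed. Markov chain: $\tilde\Omega:=\Omega^{\mathbb{Z}}$, $\tilde{\mathcal F}$ is the product $\sigma$-algebra, $X_n((\omega_m)_{m\in\mathbb{Z}}):=\omega_n$, and $\tilde\nu$ is the unique probability measure on $\tilde\Omega$ such that, for all $n\in\mathbb{Z}$ (and bounded measurable $f$), $\mathbb{E}_{\tilde\nu}[f(X_n)]=\int_\Omega f\,d\nu$ and $\mathbb{E}_{\tilde\nu}[f(X_{n+1})\mid X_n,X_{n-1},\dots]=(1-\alpha)f(T(X_n))+\alpha\int_\Omega f\,d\nu$. *)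

theory Defs
  imports "HOL-Probability.Probability"
begin

locale invertible_pds = prob_space M for M :: "'a measure" and T :: "'a \<Rightarrow> 'a" +
  assumes bij_T: "bij_betw T (space M) (space M)"
    and measurable_T: "T \<in> M \<rightarrow>\<^sub>M M"
    and measurable_inv_T: "inv_into (space M) T \<in> M \<rightarrow>\<^sub>M M"
    and distr_T: "distr M M T = M"

definition int_iterate :: "'a measure \<Rightarrow> ('a \<Rightarrow> 'a) \<Rightarrow> int \<Rightarrow> 'a \<Rightarrow> 'a" where
  "int_iterate M T k = (if k \<ge> 0 then T ^^ nat k else inv_into (space M) T ^^ nat (- k))"

definition L_infinity :: "'a measure \<Rightarrow> ('a \<Rightarrow> real ^ 'd::finite) set" where
  "L_infinity M = {a \<in> borel_measurable M. \<exists>C. AE x in M. infnorm (a x) \<le> C}"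

text \<open>The path space is the product \<open>\<Pi>\<^sub>M i\<in>UNIV. M\<close> over the integers, so that paths are functions
  \<open>int \<Rightarrow> 'a\<close> and the process at time \<open>n\<close> is the coordinate \<open>\<omega> n\<close>.\<close>

definition chain_coord :: "int \<Rightarrow> (int \<Rightarrow> 'a) \<Rightarrow> 'a" where
  "chain_coord n \<omega> = \<omega> n"

definition past_algebra :: "'a measure \<Rightarrow> int \<Rightarrow> (int \<Rightarrow> 'a) measure" where
  "past_algebra M n =
     (let \<Omega> = space (\<Pi>\<^sub>M i\<in>(UNIV::int set). M)
      in sigma \<Omega> (\<Union>m\<in>{..n}. {chain_coord m -` A \<inter> \<Omega> | A. A \<in> sets M}))"

definition is_chain_measure ::
    "'a measure \<Rightarrow> ('a \<Rightarrow> 'a) \<Rightarrow> real \<Rightarrow> (int \<Rightarrow> 'a) measure \<Rightarrow> bool" where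
  "is_chain_measure M T \<alpha> P \<longleftrightarrow>
     prob_space P \<and> sets P = sets (\<Pi>\<^sub>M i\<in>(UNIV::int set). M) \<and>
     (\<forall>n. \<forall>f::'a \<Rightarrow> real. f \<in> borel_measurable M \<longrightarrow> (\<exists>C. \<forall>x\<in>space M. \<bar>f x\<bar> \<le> C) \<longrightarrow>
        (\<integral>\<omega>. f (chain_coord n \<omega>) \<partial>P) = (\<integral>x. f x \<partial>M) \<and>
        (AE \<omega> in P. real_cond_exp P (past_algebra M n) (\<lambda>\<omega>. f (chain_coord (n + 1) \<omega>)) \<omega> =
           (1 - \<alpha>) * f (T (chain_coord n \<omega>)) + \<alpha> * (\<integral>x. f x \<partial>M)))"

definition tensor_vec :: "real ^ 'd \<Rightarrow> real ^ 'd \<Rightarrow> real ^ 'd ^ 'd" where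
  "tensor_vec A B = (\<chi> i j. A $ i * B $ j)"

definition matrix_expectation :: "'a measure \<Rightarrow> ('a \<Rightarrow> real ^ 'd ^ 'd) \<Rightarrow> real ^ 'd ^ 'd" where
  "matrix_expectation M F = (\<chi> i j. \<integral>x. F x $ i $ j \<partial>M)"

definition asymptotic_covariance ::
    "'a measure \<Rightarrow> ('a \<Rightarrow> 'a) \<Rightarrow> real \<Rightarrow> ('a \<Rightarrow> real ^ 'd::finite) \<Rightarrow> real ^ 'd ^ 'd" where
  "asymptotic_covariance M T \<alpha> a =
     (\<Sum>\<^sub>\<infinity>k\<in>(UNIV::int set). (1 - \<alpha>) ^ nat \<bar>k\<bar> *\<^sub>R
        matrix_expectation M (\<lambda>x. tensor_vec (a x) (a (int_iterate M T k x))))"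

text \<open>The second parameter is the standard deviation; the value \<open>0\<close> gives the Dirac mass, so that
  Gaussian vectors may have a singular covariance matrix.\<close>

definition normal_law :: "real \<Rightarrow> real \<Rightarrow> real measure" where
  "normal_law \<mu> \<sigma> = (if \<sigma> = 0 then return borel \<mu> else density lborel (normal_density \<mu> \<sigma>))"

definition gaussian_vector :: "'q measure \<Rightarrow> ('q \<Rightarrow> real ^ 'd::finite) \<Rightarrow> bool" where
  "gaussian_vector Q N \<longleftrightarrow> N \<in> borel_measurable Q \<and>
     (\<forall>u. \<exists>\<mu> \<sigma>. \<sigma> \<ge> 0 \<and> distr Q borel (\<lambda>q. u \<bullet> N q) = normal_law \<mu> \<sigma>)"

definition covariance_matrix :: "'q measure \<Rightarrow> ('q \<Rightarrow> real ^ 'd::finite) \<Rightarrow> real ^ 'd ^ 'd" where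
  "covariance_matrix Q N = matrix_expectation Q
     (\<lambda>q. tensor_vec (N q - (\<integral>r. N r \<partial>Q)) (N q - (\<integral>r. N r \<partial>Q)))"

text \<open>Meaningful only for Lipschitz functions: otherwise the supremum is taken of an unbounded set.\<close>

definition lipschitz_const :: "(real ^ 'd::finite \<Rightarrow> real) \<Rightarrow> real" where
  "lipschitz_const \<phi> = Sup {\<bar>\<phi> x - \<phi> y\<bar> / infnorm (x - y) | x y. x \<noteq> y}"

end

theory Submission
  imports Defs
begin

text \<open>The chain jumps from \<open>x\<close> to \<open>T x\<close> with probability \<open>r = 1 - \<alpha>\<close> and is resampled from \<open>M\<close> with
probability \<open>\<alpha>\<close>, so a centred bounded observable \<open>f\<close> of the next state has conditional mean
\<open>r f (T x)\<close>.  The corrector \<open>h = \<Sum>k. r ^ k a \<circ> T ^ k\<close> therefore solves the Poisson equation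
\<open>a = h - r h \<circ> T\<close>, and the partial sums of \<open>a (X k)\<close> are, up to the bounded term
\<open>h (X 0) - h (X n)\<close>, the martingale with increments \<open>h (X (k + 1)) - r h (T (X k))\<close>.  Expanding
\<open>h - r h \<circ> T\<close> shows that \<open>D(a) = (1 - r\<^sup>2) E[h \<otimes> h]\<close> (\<open>correlation_has_sum\<close>).  This identity also
disposes of degenerate covariances: orthonormalising the coordinates of \<open>h\<close> in \<open>L\<^sup>2\<close>
(\<open>gram_schmidt\<close>) gives \<open>h = A e\<close> with \<open>e\<close> orthonormal up to vanishing coordinates, and a test
function \<open>\<phi>\<close> is replaced by \<open>\<phi> \<circ> A\<close>, which ignores those coordinates.  It remains to compare the
martingale with increments built from \<open>e\<close> with a standard Gaussian vector \<open>W\<close>.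

The comparison is a Lindeberg argument.  Let \<open>u s x = E \<psi> (x + sqrt s W)\<close> be the heat flow of the
test function and \<open>S k\<close> the martingale.  The difference of \<open>E \<psi> (S n)\<close> and \<open>E \<psi> (sqrt n W)\<close>
telescopes, up to \<open>O(L)\<close>, into the terms \<open>E u s (S (k + 1)) - E u (s + 1) (S k)\<close> with \<open>s = n - k\<close>.
A derivative of order \<open>p\<close> of \<open>u s\<close> is of size \<open>L s powr (- (p - 1) / 2)\<close> (\<open>heat_jet_bound\<close>).
In a Taylor expansion of one step the first order vanishes and the second order matches the
Gaussian one up to a centred function of the current state, whose contribution costs one more
derivative because the chain mixes (\<open>mixing_lipschitz\<close>).  Stopping there gives errors of order
\<open>1 / s\<close>, whose sum is logarithmic.  To avoid the logarithm the expansion is carried to the fourth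
order (\<open>fourth_order_step\<close>), of size \<open>s powr (- 3 / 2)\<close>, and the remaining third-order terms are
means \<open>E D\<^sup>3 u s (S j)\<close>.  These are bounded by running the crude comparison on \<open>D\<^sup>3 u s\<close> itself
(\<open>third_derivative_bound\<close>): they are at most \<open>1 / (s + j)\<close> plus the sum of \<open>t powr (- 5 / 2)\<close> over
\<open>t \<ge> s\<close>, up to a factor \<open>L\<close>.  All these errors have a bounded sum, so the unnormalised distance is
\<open>O(L)\<close> (\<open>martingale_bound\<close>), and rescaling by \<open>sqrt n\<close> gives the rate.

The law of \<open>N\<close> is known only through its one-dimensional projections.  It is identified with the
law of \<open>A W\<close> by equality of characteristic functions, which determine the integrals of bounded
Lipschitz functions (\<open>char_eq_imp_integral_eq\<close>).\<close>

section \<open>The standard Gaussian measure\<close>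

text \<open>The standard Gaussian measure on \<open>real ^ 'd\<close>, given by its density.\<close>

definition std_gauss :: "(real ^ 'd::finite) measure" where
  "std_gauss = density lborel (\<lambda>w. ennreal (\<Prod>i\<in>UNIV. std_normal_density (w $ i)))"

lemma sets_std_gauss [simp, measurable_cong]: "sets std_gauss = sets borel"
  by (simp add: std_gauss_def)

lemma space_std_gauss [simp]: "space std_gauss = UNIV"
  by (simp add: std_gauss_def)

lemma distr_std_gauss_PiM:
  "distr std_gauss (\<Pi>\<^sub>M i\<in>(UNIV::'d::finite set). std_normal_distribution) (\<lambda>w i. w $ i)
     = (\<Pi>\<^sub>M i\<in>UNIV. std_normal_distribution)"
proof -
  interpret prob_space std_normal_distribution
    by (rule prob_space_normal_density) simp
  interpret product_sigma_finite "\<lambda>i::'d. std_normal_distribution" by standard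
  let ?P = "\<Pi>\<^sub>M i\<in>(UNIV::'d set). std_normal_distribution"
  have meas: "(\<lambda>w i. w $ i) \<in> std_gauss \<rightarrow>\<^sub>M ?P"
    by (rule measurable_PiM_single') (auto simp: PiE_def)
  show ?thesis
  proof (rule PiM_eqI)
    fix A :: "'d \<Rightarrow> real set"
    assume A: "\<And>i. i \<in> UNIV \<Longrightarrow> A i \<in> sets std_normal_distribution"
    then have A' [measurable]: "A i \<in> sets borel" for i by auto
    have PA: "Pi\<^sub>E UNIV A \<in> sets ?P"
      using A by (intro sets_PiM_I_finite) auto
    let ?g = "\<lambda>b::real^'d. \<lambda>t::real. std_normal_density t * indicator (A (THE i. b = axis i 1)) t"
    have the: "(THE i. axis j (1::real) = axis i 1) = j" for j :: 'd
      by (rule the_equality) (auto simp: axis_eq_axis)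
    have prodB: "(\<Prod>b\<in>Basis. F b) = (\<Prod>i\<in>UNIV. F (axis i (1::real)))"
      for F :: "real^'d \<Rightarrow> 'e::comm_monoid_mult"
    proof -
      have "Basis = range (\<lambda>i::'d. axis i (1::real))" by (auto simp: Basis_vec_def)
      moreover have "inj (\<lambda>i::'d. axis i (1::real))" by (auto simp: inj_on_def axis_eq_axis)
      ultimately show ?thesis using prod.reindex[of "\<lambda>i::'d. axis i (1::real)" UNIV F] by (simp add: o_def)
    qed
    have pr: "ennreal (\<Prod>i\<in>UNIV. std_normal_density (w $ i)) * indicator {w. \<forall>i. w $ i \<in> A i} w
        = (\<Prod>b\<in>Basis. ennreal (?g b (w \<bullet> b)))" for w :: "real^'d"
    proof -
      have "(\<Prod>b\<in>Basis. ennreal (?g b (w \<bullet> b)))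
          = (\<Prod>i\<in>UNIV. ennreal (std_normal_density (w$i) * indicator (A i) (w$i)))"
        by (simp add: prodB the inner_axis)
      also have "\<dots> = ennreal (\<Prod>i\<in>UNIV. std_normal_density (w$i) * indicator (A i) (w$i))"
        by (rule prod_ennreal) (simp add: indicator_def)
      also have "(\<Prod>i\<in>UNIV. std_normal_density (w$i) * indicator (A i) (w$i))
          = (\<Prod>i\<in>UNIV. std_normal_density (w $ i)) * indicator {w. \<forall>i. w $ i \<in> A i} w"
      proof (cases "\<forall>i. w $ i \<in> A i")
        case True then show ?thesis by simp
      next
        case False
        then obtain i where "w $ i \<notin> A i" by auto
        then have "(\<Prod>i\<in>UNIV. std_normal_density (w$i) * indicator (A i) (w$i)) = 0"
          by (intro prod_zero bexI[of _ i]) auto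
        with False show ?thesis by simp
      qed
      finally show ?thesis by (auto simp: indicator_def)
    qed
    have vim: "(\<lambda>w i. w $ i) -` Pi\<^sub>E UNIV A \<inter> space std_gauss = {w. \<forall>i. w $ i \<in> A i}"
      by (auto simp: PiE_def Pi_def)
    have ms: "{w::real^'d. \<forall>i. w $ i \<in> A i} \<in> sets borel"
      by measurable
    have "emeasure (distr std_gauss ?P (\<lambda>w i. w $ i)) (Pi\<^sub>E UNIV A)
        = emeasure std_gauss {w. \<forall>i. w $ i \<in> A i}"
      by (subst emeasure_distr[OF meas PA]) (simp only: vim)
    also have "\<dots> = (\<integral>\<^sup>+w. (\<Prod>b\<in>Basis. ennreal (?g b (w \<bullet> b))) \<partial>lborel)"
      unfolding std_gauss_def using ms by (subst emeasure_density) (auto simp: pr[symmetric])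
    also have "\<dots> = (\<Prod>b\<in>Basis. \<integral>\<^sup>+t. ennreal (?g b t) \<partial>lborel)"
    proof (rule nn_integral_lborel_prod)
      fix b :: "real^'d" assume "b \<in> Basis"
      show "(\<lambda>x. ennreal (?g b x)) \<in> borel_measurable borel" by measurable
    qed auto
    also have "\<dots> = (\<Prod>i\<in>UNIV. \<integral>\<^sup>+t. ennreal (std_normal_density t * indicator (A i) t) \<partial>lborel)"
      by (simp add: prodB the)
    also have "\<dots> = (\<Prod>i\<in>UNIV. emeasure std_normal_distribution (A i))"
      by (intro prod.cong refl, subst emeasure_density)
         (auto intro!: nn_integral_cong simp: indicator_def)
    finally show "emeasure (distr std_gauss ?P (\<lambda>w i. w $ i)) (Pi\<^sub>E UNIV A)
        = (\<Prod>i\<in>UNIV. emeasure std_normal_distribution (A i))" .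
  qed auto
qed

lemma std_gauss_prod:
  fixes f :: "'d::finite \<Rightarrow> real \<Rightarrow> 'b::{real_normed_field,banach,second_countable_topology}"
  assumes "\<And>i. integrable std_normal_distribution (f i)"
  shows "integrable std_gauss (\<lambda>w. \<Prod>i\<in>UNIV. f i (w $ i))"
    and "(\<integral>w. (\<Prod>i\<in>UNIV. f i (w $ i)) \<partial>std_gauss) = (\<Prod>i\<in>UNIV. \<integral>t. f i t \<partial>std_normal_distribution)"
proof -
  interpret prob_space std_normal_distribution
    by (rule prob_space_normal_density) simp
  interpret product_sigma_finite "\<lambda>i::'d. std_normal_distribution" by standard
  let ?P = "\<Pi>\<^sub>M i\<in>(UNIV::'d set). std_normal_distribution"
  have meas: "(\<lambda>w i. w $ i) \<in> std_gauss \<rightarrow>\<^sub>M ?P"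
    by (rule measurable_PiM_single') (auto simp: PiE_def)
  have i: "integrable ?P (\<lambda>x. \<Prod>i\<in>UNIV. f i (x i))"
    by (rule product_integrable_prod) (use assms in auto)
  then have i': "integrable (distr std_gauss ?P (\<lambda>w i. w $ i)) (\<lambda>x. \<Prod>i\<in>UNIV. f i (x i))"
    by (simp add: distr_std_gauss_PiM)
  then show "integrable std_gauss (\<lambda>w. \<Prod>i\<in>UNIV. f i (w $ i))"
    by (rule integrable_distr[OF meas])
  have "(\<integral>w. (\<Prod>i\<in>UNIV. f i (w $ i)) \<partial>std_gauss)
      = (\<integral>x. (\<Prod>i\<in>UNIV. f i (x i)) \<partial>distr std_gauss ?P (\<lambda>w i. w $ i))"
    using i' by (subst integral_distr[OF meas]) (auto dest: borel_measurable_integrable)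
  also have "\<dots> = (\<Prod>i\<in>UNIV. \<integral>t. f i t \<partial>std_normal_distribution)"
    unfolding distr_std_gauss_PiM by (rule product_integral_prod) (use assms in auto)
  finally show "(\<integral>w. (\<Prod>i\<in>UNIV. f i (w $ i)) \<partial>std_gauss) = (\<Prod>i\<in>UNIV. \<integral>t. f i t \<partial>std_normal_distribution)" .
qed

interpretation std_gauss: prob_space "std_gauss :: (real ^ 'd::finite) measure"
proof -
  let ?P = "\<Pi>\<^sub>M i\<in>(UNIV::'d set). std_normal_distribution"
  have meas: "(\<lambda>w i. w $ i) \<in> std_gauss \<rightarrow>\<^sub>M ?P"
    by (rule measurable_PiM_single') (auto simp: PiE_def)
  have "prob_space ?P"
    by (rule prob_space_PiM) (auto intro: prob_space_normal_density)
  then show "prob_space (std_gauss :: (real ^ 'd) measure)"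
    using prob_space_distrD[OF meas] by (simp add: distr_std_gauss_PiM)
qed

lemma std_normal_1:
  "integrable std_normal_distribution (\<lambda>x. x)" "(\<integral>x. x \<partial>std_normal_distribution) = 0"
  "integrable std_normal_distribution (\<lambda>x. x\<^sup>2)" "(\<integral>x. x\<^sup>2 \<partial>std_normal_distribution) = 1"
  using integrable_std_normal_distribution_moment[of 1] integral_std_normal_distribution_moment_odd[of 1]
    integrable_std_normal_distribution_moment[of 2] std_normal_distribution_even_moments(1)[of 1]
  by simp_all

lemma norm_power2_cart: "(norm u)\<^sup>2 = (\<Sum>i\<in>UNIV. (u $ i)\<^sup>2)" for u :: "real ^ 'd::finite"
  by (simp only: power2_norm_eq_inner inner_vec_def) (simp add: power2_eq_square)

text \<open>The characteristic function of the standard Gaussian measure.\<close>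

lemma integral_exp_std_gauss:
  "(\<integral>w. iexp (u \<bullet> w) \<partial>std_gauss) = exp (- (norm u)\<^sup>2 / 2)" for u :: "real ^ 'd::finite"
proof -
  interpret N: prob_space std_normal_distribution by (rule prob_space_normal_density) simp
  have "(\<lambda>w. iexp (u \<bullet> w)) = (\<lambda>w. \<Prod>i\<in>UNIV. (\<lambda>i t. iexp (u $ i * t)) i (w $ i))"
    by (simp add: inner_vec_def exp_sum[symmetric] sum_distrib_left)
  then have "(\<integral>w. iexp (u \<bullet> w) \<partial>std_gauss)
      = (\<integral>w. (\<Prod>i\<in>UNIV. (\<lambda>i t. iexp (u $ i * t)) i (w $ i)) \<partial>std_gauss)" by simp
  also have "\<dots> = (\<Prod>i\<in>UNIV. \<integral>t. (\<lambda>i t. iexp (u $ i * t)) i t \<partial>std_normal_distribution)"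
    by (rule std_gauss_prod) (auto intro!: N.integrable_const_bound[where B=1])
  also have "\<dots> = (\<Prod>i\<in>UNIV. char std_normal_distribution (u $ i))"
    by (simp add: char_def)
  also have "\<dots> = complex_of_real (\<Prod>i\<in>UNIV. exp (- (u $ i)\<^sup>2 / 2))"
    by (simp add: char_std_normal_distribution)
  also have "(\<Prod>i\<in>UNIV. exp (- (u $ i)\<^sup>2 / 2)) = exp (- (norm u)\<^sup>2 / 2)"
    by (simp add: exp_sum[symmetric] norm_power2_cart sum_negf sum_divide_distrib)
  finally show ?thesis .
qed

lemma std_gauss_coord:
  fixes f :: "real \<Rightarrow> real"
  assumes "integrable std_normal_distribution f"
  shows "integrable std_gauss (\<lambda>w::real^'d::finite. f (w $ i))"
    and "(\<integral>w. f ((w::real^'d) $ i) \<partial>std_gauss) = (\<integral>t. f t \<partial>std_normal_distribution)"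
proof -
  interpret N: prob_space std_normal_distribution by (rule prob_space_normal_density) simp
  let ?f = "\<lambda>j t. if j = i then f t else 1"
  have eq: "(\<Prod>j\<in>UNIV. ?f j (w $ j)) = f (w $ i)" for w :: "real^'d"
    by (subst prod.delta) auto
  have I: "integrable std_normal_distribution (?f j)" for j
    using assms by (cases "j = i") auto
  show "integrable std_gauss (\<lambda>w::real^'d. f (w $ i))"
    using std_gauss_prod(1)[of ?f, OF I] by (simp only: eq)
  have "(\<integral>w. f ((w::real^'d) $ i) \<partial>std_gauss) = (\<Prod>j\<in>(UNIV::'d set). \<integral>t. ?f j t \<partial>std_normal_distribution)"
    using std_gauss_prod(2)[of ?f, OF I] by (simp only: eq)
  also have "\<dots> = (\<Prod>j\<in>(UNIV::'d set). if j = i then \<integral>t. f t \<partial>std_normal_distribution else 1)"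
    using N.prob_space by (intro prod.cong) auto
  finally show "(\<integral>w. f ((w::real^'d) $ i) \<partial>std_gauss) = (\<integral>t. f t \<partial>std_normal_distribution)"
    by simp
qed

lemma std_gauss_moment2:
  "integrable std_gauss (\<lambda>w::real^'d::finite. w $ i * w $ j)"
  "(\<integral>w. (w::real^'d) $ i * w $ j \<partial>std_gauss) = (if i = j then 1 else 0)"
proof -
  interpret N: prob_space std_normal_distribution by (rule prob_space_normal_density) simp
  have "integrable std_gauss (\<lambda>w::real^'d. w $ i * w $ j) \<and>
    (\<integral>w. (w::real^'d) $ i * w $ j \<partial>std_gauss) = (if i = j then 1 else 0)"
  proof (cases "i = j")
    case True
    then show ?thesis
      using std_gauss_coord[of "\<lambda>x. x\<^sup>2" i] std_normal_1 by (simp add: power2_eq_square)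
  next
    case False
    let ?f = "\<lambda>k t. if k = i \<or> k = j then t else (1::real)"
    have eq: "(\<Prod>k\<in>UNIV. ?f k (w $ k)) = w $ i * w $ j" for w :: "real^'d"
    proof -
      have "(\<Prod>k\<in>UNIV. ?f k (w $ k)) = (\<Prod>k\<in>{i,j}. w $ k)"
        by (rule prod.mono_neutral_cong_right) auto
      then show ?thesis using False by simp
    qed
    have I: "integrable std_normal_distribution (?f k)" for k
      using std_normal_1 by (cases "k = i \<or> k = j") auto
    have "(\<Prod>k\<in>(UNIV::'d set). \<integral>t. ?f k t \<partial>std_normal_distribution) = 0"
      by (rule prod_zero) (auto intro!: exI[of _ i] simp: std_normal_1)
    with std_gauss_prod[of ?f, OF I] False show ?thesis by (simp only: eq) auto
  qed
  then show "integrable std_gauss (\<lambda>w::real^'d. w $ i * w $ j)"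
    "(\<integral>w. (w::real^'d) $ i * w $ j \<partial>std_gauss) = (if i = j then 1 else 0)" by auto
qed

lemma std_gauss_integrable_sum_power:
  "integrable std_gauss (\<lambda>w::real^'d::finite. (\<Sum>i\<in>UNIV. \<bar>w $ i\<bar>) ^ n)"
proof (rule Bochner_Integration.integrable_bound)
  let ?d = "real CARD('d)"
  show "integrable std_gauss (\<lambda>w::real^'d. ?d ^ n * (\<Sum>i\<in>UNIV. \<bar>(w $ i) ^ n\<bar>))"
    by (intro integrable_mult_right Bochner_Integration.integrable_sum integrable_abs
        std_gauss_coord(1)[of "\<lambda>x. x ^ n"] integrable_std_normal_distribution_moment)
  show "(\<lambda>w::real^'d. (\<Sum>i\<in>UNIV. \<bar>w $ i\<bar>) ^ n) \<in> borel_measurable std_gauss" by measurable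
  have "(\<Sum>i\<in>UNIV. \<bar>w $ i\<bar>) ^ n \<le> ?d ^ n * (\<Sum>i\<in>UNIV. \<bar>(w $ i) ^ n\<bar>)" for w :: "real^'d"
  proof -
    obtain k where k: "\<And>i. \<bar>w $ i\<bar> \<le> \<bar>w $ k\<bar>"
    proof -
      have "Max (range (\<lambda>i. \<bar>w $ i\<bar>)) \<in> range (\<lambda>i. \<bar>w $ i\<bar>)" by (rule Max_in) auto
      then obtain k where "Max (range (\<lambda>i. \<bar>w $ i\<bar>)) = \<bar>w $ k\<bar>" by (rule imageE)
      then have "\<bar>w $ i\<bar> \<le> \<bar>w $ k\<bar>" for i
        using Max_ge[of "range (\<lambda>i. \<bar>w $ i\<bar>)" "\<bar>w $ i\<bar>"] by auto
      then show ?thesis by (rule that)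
    qed
    have "(\<Sum>i\<in>UNIV. \<bar>w $ i\<bar>) \<le> ?d * \<bar>w $ k\<bar>"
      using sum_bounded_above[of UNIV "\<lambda>i. \<bar>w $ i\<bar>" "\<bar>w $ k\<bar>"] k by simp
    then have "(\<Sum>i\<in>UNIV. \<bar>w $ i\<bar>) ^ n \<le> (?d * \<bar>w $ k\<bar>) ^ n"
      by (intro power_mono sum_nonneg) auto
    also have "\<dots> = ?d ^ n * \<bar>(w $ k) ^ n\<bar>" by (simp add: power_mult_distrib power_abs)
    also have "\<dots> \<le> ?d ^ n * (\<Sum>i\<in>UNIV. \<bar>(w $ i) ^ n\<bar>)"
      by (intro mult_left_mono member_le_sum) auto
    finally show ?thesis .
  qed
  then show "AE w in std_gauss. norm ((\<Sum>i\<in>UNIV. \<bar>(w::real^'d) $ i\<bar>) ^ n)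
      \<le> norm (?d ^ n * (\<Sum>i\<in>UNIV. \<bar>(w $ i) ^ n\<bar>))"
    by (intro AE_I2) (auto simp: sum_nonneg abs_of_nonneg)
qed

lemma std_gauss_integrable_norm: "integrable std_gauss (\<lambda>w::real^'d::finite. norm w)"
proof (rule Bochner_Integration.integrable_bound[OF std_gauss_integrable_sum_power[of 1]])
  show "AE w in std_gauss. norm (norm (w::real^'d)) \<le> norm ((\<Sum>i\<in>UNIV. \<bar>w $ i\<bar>) ^ 1)"
    using norm_le_l1_cart by (intro AE_I2) (auto simp: sum_nonneg intro: order_trans)
qed auto

lemma std_gauss_uminus:
  fixes f :: "real^'d::finite \<Rightarrow> real"
  assumes [measurable]: "f \<in> borel_measurable borel"
  shows "(\<integral>w. f (- w) \<partial>std_gauss) = (\<integral>w. f w \<partial>std_gauss)"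
proof -
  have "distr lborel borel (\<lambda>x::real^'d. - x) = lborel"
    using lborel_affine[of "-1" "0::real^'d"] by (simp add: density_1)
  then have "(\<integral>w. (\<Prod>i\<in>UNIV. std_normal_density (w $ i)) * f w \<partial>lborel)
     = (\<integral>w. (\<Prod>i\<in>UNIV. std_normal_density (w $ i)) * f w \<partial>distr lborel borel (\<lambda>x::real^'d. - x))"
    by simp
  also have "\<dots> = (\<integral>w. (\<Prod>i\<in>UNIV. std_normal_density (w $ i)) * f (- w) \<partial>lborel)"
    by (subst integral_distr) (auto simp: std_normal_density_def)
  finally show ?thesis unfolding std_gauss_def
    by (subst (1 2) integral_density) (auto intro!: prod_nonneg)
qed

text \<open>The Cameron--Martin formula for the standard Gaussian measure.\<close>

lemma std_gauss_shift:
  fixes f :: "real^'d::finite \<Rightarrow> real"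
  assumes [measurable]: "f \<in> borel_measurable borel"
  shows "integrable std_gauss (\<lambda>w. f (w + y)) \<longleftrightarrow> integrable std_gauss (\<lambda>w. f w * exp (y \<bullet> w - (norm y)\<^sup>2 / 2))"
    and "(\<integral>w. f (w + y) \<partial>std_gauss) = (\<integral>w. f w * exp (y \<bullet> w - (norm y)\<^sup>2 / 2) \<partial>std_gauss)"
proof -
  let ?p = "\<lambda>w::real^'d. \<Prod>i\<in>UNIV. std_normal_density (w $ i)"
  have p: "(\<Prod>i\<in>UNIV. std_normal_density (w $ i - y $ i)) = ?p w * exp (y \<bullet> w - (norm y)\<^sup>2 / 2)" for w
  proof -
    have "std_normal_density (w $ i - y $ i) = std_normal_density (w $ i) * exp (y $ i * w $ i - (y $ i)\<^sup>2 / 2)" for i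
      by (simp add: std_normal_density_def exp_add[symmetric] power2_eq_square field_simps)
    then have "(\<Prod>i\<in>UNIV. std_normal_density (w $ i - y $ i)) = ?p w * (\<Prod>i\<in>UNIV. exp (y $ i * w $ i - (y $ i)\<^sup>2 / 2))"
      by (simp add: prod.distrib)
    also have "(\<Prod>i\<in>UNIV. exp (y $ i * w $ i - (y $ i)\<^sup>2 / 2)) = exp (y \<bullet> w - (norm y)\<^sup>2 / 2)"
      by (simp add: exp_sum[symmetric] norm_power2_cart inner_vec_def
        sum_subtractf sum_divide_distrib)
    finally show ?thesis .
  qed
  have [measurable]: "?p \<in> borel_measurable borel" by measurable
  have nn: "?p w \<ge> 0" for w by (intro prod_nonneg) auto
  have d: "distr lborel borel ((+) y) = lborel" by (rule lborel_distr_plus)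
  have "(\<integral>w. ?p (w - y) * f w \<partial>lborel) = (\<integral>w. ?p (w - y) * f w \<partial>distr lborel borel ((+) y))"
    by (simp add: d)
  also have "\<dots> = (\<integral>w. ?p w * f (w + y) \<partial>lborel)"
    by (subst integral_distr) (auto simp: add.commute)
  finally show "(\<integral>w. f (w + y) \<partial>std_gauss) = (\<integral>w. f w * exp (y \<bullet> w - (norm y)\<^sup>2 / 2) \<partial>std_gauss)"
    unfolding std_gauss_def by (subst (1 2) integral_density) (auto simp: nn p mult_ac)
  have "integrable lborel (\<lambda>w. ?p (w - y) * f w) \<longleftrightarrow> integrable (distr lborel borel ((+) y)) (\<lambda>w. ?p (w - y) * f w)"
    by (simp add: d)
  also have "\<dots> \<longleftrightarrow> integrable lborel (\<lambda>w. ?p w * f (w + y))"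
    by (subst integrable_distr_eq) (auto simp: add.commute)
  finally show "integrable std_gauss (\<lambda>w. f (w + y)) \<longleftrightarrow> integrable std_gauss (\<lambda>w. f w * exp (y \<bullet> w - (norm y)\<^sup>2 / 2))"
    unfolding std_gauss_def by (subst (1 2) integrable_density) (auto simp: nn p mult_ac)
qed

lemma std_gauss_exp:
  fixes y :: "real^'d::finite"
  shows "integrable std_gauss (\<lambda>w. exp (y \<bullet> w - (norm y)\<^sup>2 / 2))"
    and "(\<integral>w. exp (y \<bullet> w - (norm y)\<^sup>2 / 2) \<partial>std_gauss) = 1"
  using std_gauss_shift[of "\<lambda>_. 1" y] std_gauss.prob_space[where 'd='d] by simp_all

lemma std_gauss_inner:
  fixes y :: "real^'d::finite"
  shows "integrable std_gauss (\<lambda>w. y \<bullet> w)" "(\<integral>w. y \<bullet> w \<partial>std_gauss) = 0"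
    "integrable std_gauss (\<lambda>w. (y \<bullet> w)\<^sup>2)" "(\<integral>w. (y \<bullet> w)\<^sup>2 \<partial>std_gauss) = (norm y)\<^sup>2"
proof -
  have c: "integrable std_gauss (\<lambda>w::real^'d. w $ i)" "(\<integral>w. (w::real^'d) $ i \<partial>std_gauss) = 0" for i
    using std_gauss_coord[of "\<lambda>x. x" i] std_normal_1 by auto
  show "integrable std_gauss (\<lambda>w. y \<bullet> w)" "(\<integral>w. y \<bullet> w \<partial>std_gauss) = 0"
    using c by (auto simp: inner_vec_def)
  have sq: "(y \<bullet> w)\<^sup>2 = (\<Sum>i\<in>UNIV. \<Sum>j\<in>UNIV. y $ i * y $ j * (w $ i * w $ j))" for w :: "real^'d"
    by (simp add: inner_vec_def power2_eq_square sum_product mult_ac)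
  show "integrable std_gauss (\<lambda>w. (y \<bullet> w)\<^sup>2)" unfolding sq
    by (intro Bochner_Integration.integrable_sum integrable_mult_right std_gauss_moment2)
  have "(\<integral>w. (y \<bullet> w)\<^sup>2 \<partial>std_gauss) = (\<Sum>i\<in>UNIV. \<Sum>j\<in>UNIV. y $ i * y $ j * (if i = j then 1 else 0))"
    unfolding sq by (subst Bochner_Integration.integral_sum; (intro Bochner_Integration.integrable_sum integrable_mult_right std_gauss_moment2)?)
      (simp add: std_gauss_moment2)
  also have "\<dots> = (\<Sum>i\<in>UNIV. y $ i * y $ i)"
    by (simp add: if_distrib cong: if_cong)
  finally show "(\<integral>w. (y \<bullet> w)\<^sup>2 \<partial>std_gauss) = (norm y)\<^sup>2"
    by (simp add: power2_norm_eq_inner inner_vec_def)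
qed

section \<open>Characteristic functions determine integrals\<close>

text \<open>The Gaussian kernel is its own Fourier transform, so its mean under \<open>\<mu>\<close> depends only on the
characteristic function of \<open>\<mu>\<close>.\<close>

lemma gauss_kernel_mean:
  fixes \<mu> :: "(real^'d::finite) measure" and y :: "real^'d"
  assumes "prob_space \<mu>" and [measurable_cong]: "sets \<mu> = sets borel"
  shows "complex_of_real (\<integral>x. exp (- (norm (x - y))\<^sup>2 / 2) \<partial>\<mu>)
    = (\<integral>w. iexp (- (y \<bullet> w)) * (\<integral>x. iexp (w \<bullet> x) \<partial>\<mu>) \<partial>std_gauss)"
proof -
  interpret \<mu>: prob_space \<mu> by fact
  interpret P: pair_prob_space \<mu> "std_gauss :: (real^'d) measure" ..
  have "complex_of_real (\<integral>x. exp (- (norm (x - y))\<^sup>2 / 2) \<partial>\<mu>)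
      = (\<integral>x. complex_of_real (exp (- (norm (x - y))\<^sup>2 / 2)) \<partial>\<mu>)"
    by simp
  also have "\<dots> = (\<integral>x. (\<integral>w. iexp ((x - y) \<bullet> w) \<partial>std_gauss) \<partial>\<mu>)"
    by (simp only: integral_exp_std_gauss)
  also have "\<dots> = (\<integral>w. (\<integral>x. iexp ((x - y) \<bullet> w) \<partial>\<mu>) \<partial>std_gauss)"
    by (rule P.Fubini_integral[symmetric])
       (auto intro!: P.integrable_const_bound[where B=1])
  also have "\<dots> = (\<integral>w. iexp (- (y \<bullet> w)) * (\<integral>x. iexp (w \<bullet> x) \<partial>\<mu>) \<partial>std_gauss)"
  proof (rule Bochner_Integration.integral_cong[OF refl])
    fix w :: "real^'d"
    have "(\<integral>x. iexp ((x - y) \<bullet> w) \<partial>\<mu>) = (\<integral>x. iexp (- (y \<bullet> w)) * iexp (w \<bullet> x) \<partial>\<mu>)"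
      by (intro Bochner_Integration.integral_cong refl)
         (simp add: exp_add[symmetric] inner_diff_left inner_commute algebra_simps)
    then show "(\<integral>x. iexp ((x - y) \<bullet> w) \<partial>\<mu>) = iexp (- (y \<bullet> w)) * (\<integral>x. iexp (w \<bullet> x) \<partial>\<mu>)"
      by simp
  qed
  finally show ?thesis .
qed

text \<open>By the Cameron--Martin formula the mean of \<open>f\<close> under the law \<open>\<mu>\<close> smoothed by an independent
Gaussian involves \<open>\<mu>\<close> only through means of Gaussian kernels.\<close>

lemma gauss_smoothing_mean:
  fixes \<mu> :: "(real^'d::finite) measure" and f :: "real^'d \<Rightarrow> real"
  assumes "prob_space \<mu>" and [measurable_cong]: "sets \<mu> = sets borel"
    and [measurable]: "f \<in> borel_measurable borel" and B: "\<And>x. \<bar>f x\<bar> \<le> B"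
  shows "(\<integral>x. (\<integral>w. f (x + w) \<partial>std_gauss) \<partial>\<mu>)
    = (\<integral>w. f w * exp ((norm w)\<^sup>2 / 2) * (\<integral>x. exp (- (norm (x - w))\<^sup>2 / 2) \<partial>\<mu>) \<partial>std_gauss)"
proof -
  interpret \<mu>: prob_space \<mu> by fact
  interpret P: pair_prob_space \<mu> "std_gauss :: (real^'d) measure" ..
  have B0: "0 \<le> B" using B[of 0] by linarith
  have int: "integrable std_gauss (\<lambda>w. f w * exp (x \<bullet> w - (norm x)\<^sup>2 / 2))" for x
    by (rule std_gauss_shift(1)[THEN iffD1])
       (use B in \<open>auto intro!: std_gauss.integrable_const_bound[where B=B]\<close>)
  have "(\<integral>x. (\<integral>w. f (x + w) \<partial>std_gauss) \<partial>\<mu>)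
      = (\<integral>x. (\<integral>w. f w * exp (x \<bullet> w - (norm x)\<^sup>2 / 2) \<partial>std_gauss) \<partial>\<mu>)"
    by (simp add: std_gauss_shift(2)[symmetric] add.commute)
  also have "\<dots> = (\<integral>w. (\<integral>x. f w * exp (x \<bullet> w - (norm x)\<^sup>2 / 2) \<partial>\<mu>) \<partial>std_gauss)"
  proof (rule P.Fubini_integral[symmetric], rule P.Fubini_integrable)
    show "AE x in \<mu>. integrable std_gauss (\<lambda>y. case (x, y) of (x, w) \<Rightarrow> f w * exp (x \<bullet> w - (norm x)\<^sup>2 / 2))"
      using int by simp
    have "\<bar>\<integral>w. norm (f w * exp (x \<bullet> w - (norm x)\<^sup>2 / 2)) \<partial>std_gauss\<bar> \<le> B" for x
    proof -
      have "(\<integral>w. norm (f w * exp (x \<bullet> w - (norm x)\<^sup>2 / 2)) \<partial>std_gauss)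
          \<le> (\<integral>w. B * exp (x \<bullet> w - (norm x)\<^sup>2 / 2) \<partial>std_gauss)"
        using integrable_abs[OF int] B std_gauss_exp
        by (intro integral_mono) (auto simp: abs_mult intro!: mult_right_mono)
      also have "\<dots> = B" using std_gauss_exp(2)[of x] by simp
      finally show ?thesis by (subst abs_of_nonneg) auto
    qed
    then show "integrable \<mu> (\<lambda>x. \<integral>w. norm (case (x, w) of (x, w) \<Rightarrow> f w * exp (x \<bullet> w - (norm x)\<^sup>2 / 2)) \<partial>std_gauss)"
      by (auto intro!: \<mu>.integrable_const_bound[where B=B] simp: case_prod_beta)
  qed measurable
  also have "\<dots> = (\<integral>w. (\<integral>x. f w * exp ((norm w)\<^sup>2 / 2) * exp (- (norm (x - w))\<^sup>2 / 2) \<partial>\<mu>) \<partial>std_gauss)"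
  proof (intro Bochner_Integration.integral_cong refl)
    fix w x :: "real^'d"
    have "x \<bullet> w - (norm x)\<^sup>2 / 2 = (norm w)\<^sup>2 / 2 + - (norm (x - w))\<^sup>2 / 2"
      by (simp add: power2_norm_eq_inner inner_diff_left inner_diff_right inner_commute field_simps)
    then show "f w * exp (x \<bullet> w - (norm x)\<^sup>2 / 2) = f w * exp ((norm w)\<^sup>2 / 2) * exp (- (norm (x - w))\<^sup>2 / 2)"
      by (simp only: exp_add mult.assoc)
  qed
  also have "\<dots> = (\<integral>w. f w * exp ((norm w)\<^sup>2 / 2) * (\<integral>x. exp (- (norm (x - w))\<^sup>2 / 2) \<partial>\<mu>) \<partial>std_gauss)"
    by simp
  finally show ?thesis .
qed

text \<open>Bounded functions with Euclidean Lipschitz constant at most \<open>L\<close>.\<close>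

definition bdd_lipschitz :: "real \<Rightarrow> (real^'d::finite \<Rightarrow> real) \<Rightarrow> bool" where
  "bdd_lipschitz L f \<longleftrightarrow> (\<exists>B. \<forall>x. \<bar>f x\<bar> \<le> B) \<and> (\<forall>x y. \<bar>f x - f y\<bar> \<le> L * norm (x - y))"

lemma bdd_lipschitz_measurable: 
  assumes "bdd_lipschitz L f" shows "f \<in> borel_measurable borel"
proof -
  have L: "\<bar>f x - f y\<bar> \<le> L * norm (x - y)" for x y using assms by (auto simp: bdd_lipschitz_def)
  have "continuous_on UNIV f"
  proof (rule continuous_at_imp_continuous_on, rule ballI)
    fix x
    have "((\<lambda>y. f y - f x) \<longlongrightarrow> 0) (at x)"
    proof (rule Lim_null_comparison)
      show "eventually (\<lambda>y. norm (f y - f x) \<le> L * norm (y - x)) (at x)" using L by auto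
      show "((\<lambda>y. L * norm (y - x)) \<longlongrightarrow> 0) (at x)"
        by (auto intro!: tendsto_eq_intros)
    qed
    then show "isCont f x" unfolding isCont_def by (simp add: LIM_zero_iff)
  qed
  then show ?thesis by (rule borel_measurable_continuous_onI)
qed

lemma char_eq_imp_integral_eq:
  fixes \<mu> \<nu> :: "(real^'d::finite) measure" and f :: "real^'d \<Rightarrow> real"
  assumes \<mu>: "prob_space \<mu>" "sets \<mu> = sets borel" and \<nu>: "prob_space \<nu>" "sets \<nu> = sets borel"
    and char: "\<And>u. (\<integral>x. iexp (u \<bullet> x) \<partial>\<mu>) = (\<integral>x. iexp (u \<bullet> x) \<partial>\<nu>)"
    and f: "bdd_lipschitz L f"
  shows "(\<integral>x. f x \<partial>\<mu>) = (\<integral>x. f x \<partial>\<nu>)"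
proof -
  note [measurable_cong] = \<mu>(2) \<nu>(2)
  interpret \<mu>: prob_space \<mu> by fact
  interpret \<nu>: prob_space \<nu> by fact
  obtain B where B: "\<And>x. \<bar>f x\<bar> \<le> B" using f by (auto simp: bdd_lipschitz_def)
  have L: "\<bar>f x - f y\<bar> \<le> L * norm (x - y)" for x y using f by (auto simp: bdd_lipschitz_def)
  have fm [measurable]: "f \<in> borel_measurable borel" using f by (rule bdd_lipschitz_measurable)
  define m where "m = (\<integral>w. norm (w::real^'d) \<partial>std_gauss)"
  \<comment> \<open>Both integrals are perturbed by an independent Gaussian of size \<open>\<epsilon>\<close>; the perturbed ones coincide.\<close>
  have sm: "\<bar>(\<integral>x. (\<integral>w. f (x + \<epsilon> *\<^sub>R w) \<partial>std_gauss) \<partial>\<rho>) - (\<integral>x. f x \<partial>\<rho>)\<bar> \<le> L * \<epsilon> * m"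
    if \<rho>: "prob_space \<rho>" "sets \<rho> = sets borel" and "\<epsilon> > 0" for \<epsilon> and \<rho> :: "(real^'d) measure"
  proof -
    note [measurable_cong] = \<rho>(2)
    interpret \<rho>: prob_space \<rho> by fact
    have i1: "integrable std_gauss (\<lambda>w. f (x + \<epsilon> *\<^sub>R w))" for x
      using B by (auto intro!: std_gauss.integrable_const_bound[where B=B])
    have b: "\<bar>(\<integral>w. f (x + \<epsilon> *\<^sub>R w) \<partial>std_gauss) - f x\<bar> \<le> L * \<epsilon> * m" for x
    proof -
      have "(\<integral>w. f (x + \<epsilon> *\<^sub>R w) \<partial>std_gauss) - f x = (\<integral>w. f (x + \<epsilon> *\<^sub>R w) - f x \<partial>std_gauss)"
        using i1 std_gauss.prob_space[where 'd='d] by simp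
      also have "\<bar>\<dots>\<bar> \<le> (\<integral>w. \<bar>f (x + \<epsilon> *\<^sub>R w) - f x\<bar> \<partial>std_gauss)"
        by (rule integral_abs_bound)
      also have "\<dots> \<le> (\<integral>w. L * \<epsilon> * norm (w::real^'d) \<partial>std_gauss)"
        using i1 std_gauss_integrable_norm L[of "x + \<epsilon> *\<^sub>R w" x for w] \<open>\<epsilon> > 0\<close>
        by (intro integral_mono) (auto simp: mult_ac)
      finally show ?thesis by (simp add: m_def)
    qed
    have bb: "\<bar>\<integral>w. f (x + \<epsilon> *\<^sub>R w) \<partial>std_gauss\<bar> \<le> B" for x
    proof -
      have "\<bar>\<integral>w. f (x + \<epsilon> *\<^sub>R w) \<partial>std_gauss\<bar> \<le> (\<integral>w. \<bar>f (x + \<epsilon> *\<^sub>R w)\<bar> \<partial>std_gauss)"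
        by (rule integral_abs_bound)
      also have "\<dots> \<le> B"
        using i1 B by (intro std_gauss.integral_le_const) auto
      finally show ?thesis .
    qed
    have i2: "integrable \<rho> (\<lambda>x. \<integral>w. f (x + \<epsilon> *\<^sub>R w) \<partial>std_gauss)"
      using bb by (intro \<rho>.integrable_const_bound[where B=B]) auto
    have i3: "integrable \<rho> f" using B by (intro \<rho>.integrable_const_bound[where B=B]) auto
    have "(\<integral>x. (\<integral>w. f (x + \<epsilon> *\<^sub>R w) \<partial>std_gauss) \<partial>\<rho>) - (\<integral>x. f x \<partial>\<rho>)
       = (\<integral>x. (\<integral>w. f (x + \<epsilon> *\<^sub>R w) \<partial>std_gauss) - f x \<partial>\<rho>)"
      using i2 i3 by simp
    also have "\<bar>\<dots>\<bar> \<le> (\<integral>x. \<bar>(\<integral>w. f (x + \<epsilon> *\<^sub>R w) \<partial>std_gauss) - f x\<bar> \<partial>\<rho>)"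
      by (rule integral_abs_bound)
    also have "\<dots> \<le> L * \<epsilon> * m"
      using i2 i3 b by (intro \<rho>.integral_le_const) auto
    finally show ?thesis .
  qed
  have scaled: "(\<integral>x. (\<integral>w. f (x + \<epsilon> *\<^sub>R w) \<partial>std_gauss) \<partial>\<rho>)
     = (\<integral>w. f (\<epsilon> *\<^sub>R w) * exp ((norm w)\<^sup>2 / 2) * Re (\<integral>v. iexp (- (w \<bullet> v)) * (\<integral>x. iexp ((1/\<epsilon>) *\<^sub>R v \<bullet> x) \<partial>\<rho>) \<partial>std_gauss) \<partial>std_gauss)"
    if \<rho>: "prob_space \<rho>" "sets \<rho> = sets borel" and "\<epsilon> > 0" for \<epsilon> and \<rho> :: "(real^'d) measure"
  proof -
    note [measurable_cong] = \<rho>(2)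
    interpret \<rho>: prob_space \<rho> by fact
    let ?\<rho> = "distr \<rho> borel (\<lambda>x. (1/\<epsilon>) *\<^sub>R x)"
    have P: "prob_space ?\<rho>" by (rule \<rho>.prob_space_distr) simp
    have S: "sets ?\<rho> = sets borel" by simp
    have "(\<integral>x. (\<integral>w. f (x + \<epsilon> *\<^sub>R w) \<partial>std_gauss) \<partial>\<rho>)
       = (\<integral>x. (\<integral>w. f (\<epsilon> *\<^sub>R (x + w)) \<partial>std_gauss) \<partial>?\<rho>)"
      using \<open>\<epsilon> > 0\<close> by (subst integral_distr) (auto simp: scaleR_add_right)
    also have "\<dots> = (\<integral>w. f (\<epsilon> *\<^sub>R w) * exp ((norm w)\<^sup>2 / 2) * (\<integral>x. exp (- (norm (x - w))\<^sup>2 / 2) \<partial>?\<rho>) \<partial>std_gauss)"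
      by (rule gauss_smoothing_mean[OF P S, of "\<lambda>x. f (\<epsilon> *\<^sub>R x)" B]) (use B in auto)
    also have "\<dots> = (\<integral>w. f (\<epsilon> *\<^sub>R w) * exp ((norm w)\<^sup>2 / 2) * Re (\<integral>v. iexp (- (w \<bullet> v)) * (\<integral>x. iexp (v \<bullet> x) \<partial>?\<rho>) \<partial>std_gauss) \<partial>std_gauss)"
      by (simp only: gauss_kernel_mean[OF P S, symmetric] Re_complex_of_real)
    also have "(\<lambda>v. \<integral>x. iexp (v \<bullet> x) \<partial>?\<rho>) = (\<lambda>v. \<integral>x. iexp ((1/\<epsilon>) *\<^sub>R v \<bullet> x) \<partial>\<rho>)"
      by (subst integral_distr) auto
    finally show ?thesis .
  qed
  have eq: "(\<integral>x. (\<integral>w. f (x + \<epsilon> *\<^sub>R w) \<partial>std_gauss) \<partial>\<mu>) = (\<integral>x. (\<integral>w. f (x + \<epsilon> *\<^sub>R w) \<partial>std_gauss) \<partial>\<nu>)"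
    if "\<epsilon> > 0" for \<epsilon>
    using scaled[OF \<mu> that] scaled[OF \<nu> that] by (simp only: char)
  have bnd: "\<bar>(\<integral>x. f x \<partial>\<mu>) - (\<integral>x. f x \<partial>\<nu>)\<bar> \<le> (2 * L * m) * \<epsilon>" if "\<epsilon> > 0" for \<epsilon>
    using sm[OF \<mu> that] sm[OF \<nu> that] eq[OF that] by (auto simp: algebra_simps)
  have "((\<lambda>\<epsilon>. (2 * L * m) * \<epsilon>) \<longlongrightarrow> 0) (at_right 0)"
    by (auto intro!: tendsto_eq_intros)
  then have "\<bar>(\<integral>x. f x \<partial>\<mu>) - (\<integral>x. f x \<partial>\<nu>)\<bar> \<le> 0"
    by (rule tendsto_lowerbound) (use bnd in \<open>auto simp: eventually_at_filter\<close>)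
  then show ?thesis by simp
qed

section \<open>The heat semigroup\<close>

lemma borel_measurable_vec_nth_comp [measurable (raw)]:
  fixes f :: "'a \<Rightarrow> real^'d::finite"
  assumes [measurable]: "f \<in> borel_measurable M"
  shows "(\<lambda>x. f x $ i) \<in> borel_measurable M"
proof -
  have "(\<lambda>x. f x \<bullet> axis i 1) \<in> borel_measurable M" by measurable
  then show ?thesis by (simp add: inner_axis)
qed

text \<open>The heat semigroup with generator half the Laplacian, as a Gaussian average.\<close>

definition heat :: "real \<Rightarrow> (real^'d::finite \<Rightarrow> real) \<Rightarrow> real^'d \<Rightarrow> real" where
  "heat t f x = (\<integral>w. f (x + sqrt t *\<^sub>R w) \<partial>std_gauss)"

text \<open>The partial derivative in direction \<open>i\<close> of \<open>heat t f\<close>, with the derivative moved onto the Gaussian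
density, so that \<open>f\<close> need not be differentiable; meaningful for \<open>t > 0\<close>.\<close>

definition dheat :: "'d \<Rightarrow> real \<Rightarrow> (real^'d::finite \<Rightarrow> real) \<Rightarrow> real^'d \<Rightarrow> real" where
  "dheat i t f x = (\<integral>w. w $ i * f (x + sqrt t *\<^sub>R w) \<partial>std_gauss) / sqrt t"

text \<open>Measurable functions that are bounded everywhere on the space.\<close>

definition bdd_meas :: "'a measure \<Rightarrow> ('a \<Rightarrow> real) \<Rightarrow> bool" where
  "bdd_meas N f \<longleftrightarrow> f \<in> borel_measurable N \<and> (\<exists>B. \<forall>x\<in>space N. \<bar>f x\<bar> \<le> B)"

lemma bdd_meas_mult: "bdd_meas N f \<Longrightarrow> bdd_meas N g \<Longrightarrow> bdd_meas N (\<lambda>x. f x * g x)"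
proof -
  assume "bdd_meas N f" "bdd_meas N g"
  then obtain B C where "f \<in> borel_measurable N" "g \<in> borel_measurable N"
    and B: "\<And>x. x \<in> space N \<Longrightarrow> \<bar>f x\<bar> \<le> B" and C: "\<And>x. x \<in> space N \<Longrightarrow> \<bar>g x\<bar> \<le> C"
    by (auto simp: bdd_meas_def)
  moreover have "\<bar>f x * g x\<bar> \<le> \<bar>B\<bar> * \<bar>C\<bar>" if "x \<in> space N" for x
    unfolding abs_mult using B[OF that] C[OF that] by (intro mult_mono) auto
  ultimately show ?thesis by (auto simp: bdd_meas_def intro!: exI[of _ "\<bar>B\<bar> * \<bar>C\<bar>"])
qed

lemma bdd_meas_add: "bdd_meas N f \<Longrightarrow> bdd_meas N g \<Longrightarrow> bdd_meas N (\<lambda>x. f x + g x)"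
proof -
  assume "bdd_meas N f" "bdd_meas N g"
  then obtain B C where "f \<in> borel_measurable N" "g \<in> borel_measurable N"
    and B: "\<And>x. x \<in> space N \<Longrightarrow> \<bar>f x\<bar> \<le> B" and C: "\<And>x. x \<in> space N \<Longrightarrow> \<bar>g x\<bar> \<le> C"
    by (auto simp: bdd_meas_def)
  moreover have "\<bar>f x + g x\<bar> \<le> B + C" if "x \<in> space N" for x
    using B[OF that] C[OF that] by linarith
  ultimately show ?thesis by (auto simp: bdd_meas_def intro!: exI[of _ "B + C"])
qed

lemma bdd_meas_const: "bdd_meas N (\<lambda>x. c)"
  by (auto simp: bdd_meas_def)

lemma bdd_meas_diff: "bdd_meas N f \<Longrightarrow> bdd_meas N g \<Longrightarrow> bdd_meas N (\<lambda>x. f x - g x)"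
  using bdd_meas_add[of N f "\<lambda>x. - 1 * g x"] bdd_meas_mult[OF bdd_meas_const[of N "-1"], of g] by simp

lemma bdd_meas_sum: "(\<And>i. i \<in> I \<Longrightarrow> bdd_meas N (f i)) \<Longrightarrow> bdd_meas N (\<lambda>x. \<Sum>i\<in>I. f i x)"
  by (induction I rule: infinite_finite_induct) (auto intro: bdd_meas_const bdd_meas_add)

lemma bdd_meas_compose:
  assumes "bdd_meas N f" and t: "t \<in> N' \<rightarrow>\<^sub>M N"
  shows "bdd_meas N' (\<lambda>x. f (t x))"
proof -
  have "f \<in> borel_measurable N" using assms by (simp add: bdd_meas_def)
  then have "(\<lambda>x. f (t x)) \<in> borel_measurable N'" using t by (rule measurable_compose_rev)
  then show ?thesis using assms measurable_space[OF t] by (fastforce simp: bdd_meas_def)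
qed

lemma (in finite_measure) bdd_meas_integrable: "bdd_meas M f \<Longrightarrow> integrable M f"
  by (auto simp: bdd_meas_def intro!: integrable_const_bound AE_I2)

abbreviation bdd_borel :: "(real^'d::finite \<Rightarrow> real) \<Rightarrow> bool" where
  "bdd_borel \<equiv> bdd_meas borel"

lemma bdd_lipschitz_bdd_borel: "bdd_lipschitz L f \<Longrightarrow> bdd_borel f"
  using bdd_lipschitz_measurable[of L f] by (auto simp: bdd_meas_def bdd_lipschitz_def)

text \<open>The moments of the \<open>\<ell>\<^sup>1\<close> norm of a standard Gaussian vector.\<close>

definition gauss_moment :: "'d::finite itself \<Rightarrow> nat \<Rightarrow> real" where
  "gauss_moment _ n = (\<integral>w. (\<Sum>i\<in>UNIV. \<bar>(w::real^'d) $ i\<bar>) ^ n \<partial>std_gauss)"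

lemma gauss_moment_nonneg: "0 \<le> gauss_moment TYPE('d::finite) n"
  unfolding gauss_moment_def by (rule Bochner_Integration.integral_nonneg) (simp add: sum_nonneg)

lemma coord_le_l1: "\<bar>w $ i\<bar> \<le> (\<Sum>i\<in>UNIV. \<bar>w $ i\<bar>)" for w :: "real^'d::finite"
  by (rule member_le_sum) auto

lemma std_gauss_integrable_coord: "integrable std_gauss (\<lambda>w::real^'d::finite. w $ i)"
  by (rule std_gauss_coord(1)[of "\<lambda>x. x"]) (rule std_normal_1)

lemma dheat_integrable:
  fixes f :: "real^'d::finite \<Rightarrow> real"
  assumes "f \<in> borel_measurable borel" "\<And>x. \<bar>f x\<bar> \<le> B"
  shows "integrable std_gauss (\<lambda>w. w $ i * f (x + t *\<^sub>R w))"
proof (rule Bochner_Integration.integrable_bound)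
  show "integrable std_gauss (\<lambda>w::real^'d. B * w $ i)"
    by (intro integrable_mult_right std_gauss_integrable_coord)
  have [measurable]: "f \<in> borel_measurable borel" by fact
  show "(\<lambda>w. w $ i * f (x + t *\<^sub>R w)) \<in> borel_measurable std_gauss" by measurable
  have "0 \<le> B" using assms(2)[of 0] by linarith
  then show "AE w in std_gauss. norm (w $ i * f (x + t *\<^sub>R w)) \<le> norm (B * w $ i)"
    using assms(2) by (auto simp: abs_mult mult.commute[of B] intro!: mult_left_mono)
qed

lemma heat_integrable:
  fixes f :: "real^'d::finite \<Rightarrow> real"
  assumes "f \<in> borel_measurable borel" "\<And>x. \<bar>f x\<bar> \<le> B"
  shows "integrable std_gauss (\<lambda>w. f (x + t *\<^sub>R w))"
  using assms by (auto intro!: std_gauss.integrable_const_bound[where B=B])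

lemma heat_bound:
  fixes f :: "real^'d::finite \<Rightarrow> real"
  assumes "f \<in> borel_measurable borel" "\<And>x. \<bar>f x\<bar> \<le> B"
  shows "\<bar>heat t f x\<bar> \<le> B"
proof -
  have "\<bar>heat t f x\<bar> \<le> (\<integral>w. \<bar>f (x + sqrt t *\<^sub>R w)\<bar> \<partial>std_gauss)"
    unfolding heat_def by (rule integral_abs_bound)
  also have "\<dots> \<le> B"
    using heat_integrable[OF assms] assms(2) by (intro std_gauss.integral_le_const) auto
  finally show ?thesis .
qed

lemma dheat_bound:
  fixes f :: "real^'d::finite \<Rightarrow> real"
  assumes "f \<in> borel_measurable borel" "\<And>x. \<bar>f x\<bar> \<le> B" "0 < t"
  shows "\<bar>dheat i t f x\<bar> \<le> B * gauss_moment TYPE('d) 1 / sqrt t"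
proof -
  have B0: "0 \<le> B" using assms(2)[of 0] by linarith
  have "\<bar>\<integral>w. w $ i * f (x + sqrt t *\<^sub>R w) \<partial>std_gauss\<bar> \<le> (\<integral>w. \<bar>w $ i * f (x + sqrt t *\<^sub>R w)\<bar> \<partial>std_gauss)"
    by (rule integral_abs_bound)
  also have "\<dots> \<le> (\<integral>w. B * (\<Sum>i\<in>UNIV. \<bar>(w::real^'d) $ i\<bar>) ^ 1 \<partial>std_gauss)"
  proof (rule integral_mono)
    show "integrable std_gauss (\<lambda>w. \<bar>w $ i * f (x + sqrt t *\<^sub>R w)\<bar>)"
      by (rule integrable_abs[OF dheat_integrable[OF assms(1,2)]])
    show "integrable std_gauss (\<lambda>w. B * (\<Sum>i\<in>UNIV. \<bar>(w::real^'d) $ i\<bar>) ^ 1)"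
      by (rule integrable_mult_right[OF std_gauss_integrable_sum_power])
    show "\<bar>w $ i * f (x + sqrt t *\<^sub>R w)\<bar> \<le> B * (\<Sum>i\<in>UNIV. \<bar>w $ i\<bar>) ^ 1" for w
      unfolding abs_mult mult.commute[of "\<bar>w $ i\<bar>"] power_one_right
      by (rule mult_mono) (use assms(2) coord_le_l1 B0 in auto)
  qed
  also have "\<dots> = B * gauss_moment TYPE('d) 1" by (simp add: gauss_moment_def)
  finally show ?thesis using assms(3)
    by (simp add: dheat_def abs_divide divide_right_mono)
qed

lemma dheat_lipschitz_bound:
  fixes f :: "real^'d::finite \<Rightarrow> real"
  assumes "bdd_borel f" and lip: "\<And>x y. \<bar>f x - f y\<bar> \<le> L * norm (x - y)" and "0 < t"
  shows "\<bar>dheat i t f x\<bar> \<le> L * gauss_moment TYPE('d) 2"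
proof -
  obtain B where B: "f \<in> borel_measurable borel" "\<And>x. \<bar>f x\<bar> \<le> B"
    using assms(1) by (auto simp: bdd_meas_def)
  have L0: "0 \<le> L"
    using order_trans[OF abs_ge_zero lip[of "axis i 1" 0]] by (simp add: norm_axis_1)
  have [measurable]: "f \<in> borel_measurable borel" by fact
  have z: "(\<integral>w. (w::real^'d) $ i \<partial>std_gauss) = 0"
    using std_gauss_coord(2)[of "\<lambda>x. x" i] std_normal_1 by simp
  have i1: "integrable std_gauss (\<lambda>w. w $ i * f (x + sqrt t *\<^sub>R w))"
    by (rule dheat_integrable[OF B])
  have i2: "integrable std_gauss (\<lambda>w::real^'d. w $ i * f x)"
    by (intro integrable_mult_left std_gauss_integrable_coord)
  have "(\<integral>w. w $ i * f (x + sqrt t *\<^sub>R w) \<partial>std_gauss)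
      = (\<integral>w. w $ i * f (x + sqrt t *\<^sub>R w) - w $ i * f x \<partial>std_gauss)"
    using i1 i2 z by simp
  also have "\<bar>\<dots>\<bar> \<le> (\<integral>w. \<bar>w $ i * f (x + sqrt t *\<^sub>R w) - w $ i * f x\<bar> \<partial>std_gauss)"
    by (rule integral_abs_bound)
  also have "\<dots> \<le> (\<integral>w. L * sqrt t * (\<Sum>i\<in>UNIV. \<bar>(w::real^'d) $ i\<bar>) ^ 2 \<partial>std_gauss)"
  proof (rule integral_mono)
    show "integrable std_gauss (\<lambda>w. \<bar>w $ i * f (x + sqrt t *\<^sub>R w) - w $ i * f x\<bar>)"
      using i1 i2 by auto
    show "integrable std_gauss (\<lambda>w. L * sqrt t * (\<Sum>i\<in>UNIV. \<bar>(w::real^'d) $ i\<bar>) ^ 2)"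
      by (rule integrable_mult_right[OF std_gauss_integrable_sum_power])
    fix w :: "real^'d"
    have "\<bar>w $ i * f (x + sqrt t *\<^sub>R w) - w $ i * f x\<bar> = \<bar>w $ i\<bar> * \<bar>f (x + sqrt t *\<^sub>R w) - f x\<bar>"
      by (simp only: right_diff_distrib[symmetric] abs_mult)
    also have "\<dots> \<le> \<bar>w $ i\<bar> * (L * (sqrt t * norm w))"
      using lip[of "x + sqrt t *\<^sub>R w" x] \<open>0 < t\<close> by (intro mult_left_mono) auto
    also have "\<dots> = (L * sqrt t) * (\<bar>w $ i\<bar> * norm w)" by (simp add: mult_ac)
    also have "\<dots> \<le> (L * sqrt t) * ((\<Sum>i\<in>UNIV. \<bar>w $ i\<bar>) * (\<Sum>i\<in>UNIV. \<bar>w $ i\<bar>))"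
      using L0 \<open>0 < t\<close> coord_le_l1[of w i] norm_le_l1_cart[of w]
      by (intro mult_left_mono mult_mono) (auto simp: sum_nonneg)
    finally show "\<bar>w $ i * f (x + sqrt t *\<^sub>R w) - w $ i * f x\<bar> \<le> L * sqrt t * (\<Sum>i\<in>UNIV. \<bar>w $ i\<bar>) ^ 2"
      by (simp add: power2_eq_square)
  qed
  also have "\<dots> = L * sqrt t * gauss_moment TYPE('d) 2" by (simp add: gauss_moment_def)
  finally show ?thesis using \<open>0 < t\<close>
    by (simp add: dheat_def abs_divide field_simps)
qed

lemma bdd_borel_heat:
  fixes f :: "real^'d::finite \<Rightarrow> real"
  assumes "bdd_borel f" shows "bdd_borel (heat t f)"
proof -
  obtain B where B: "f \<in> borel_measurable borel" "\<And>x. \<bar>f x\<bar> \<le> B"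
    using assms by (auto simp: bdd_meas_def)
  have [measurable]: "f \<in> borel_measurable borel" by fact
  have "heat t f \<in> borel_measurable borel" unfolding heat_def[abs_def] by measurable
  then show ?thesis using heat_bound[OF B] by (auto simp: bdd_meas_def)
qed

lemma bdd_borel_dheat:
  fixes f :: "real^'d::finite \<Rightarrow> real"
  assumes "bdd_borel f" "0 < t" shows "bdd_borel (dheat i t f)"
proof -
  obtain B where B: "f \<in> borel_measurable borel" "\<And>x. \<bar>f x\<bar> \<le> B"
    using assms(1) by (auto simp: bdd_meas_def)
  have [measurable]: "f \<in> borel_measurable borel" by fact
  have "dheat i t f \<in> borel_measurable borel" unfolding dheat_def[abs_def] by measurable
  then show ?thesis using dheat_bound[OF B assms(2)] by (auto simp: bdd_meas_def)
qed

lemma heat_lipschitz: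
  fixes f :: "real^'d::finite \<Rightarrow> real"
  assumes f: "bdd_borel f" and lip: "\<And>x y. \<bar>f x - f y\<bar> \<le> L * norm (x - y)"
  shows "\<bar>heat t f x - heat t f y\<bar> \<le> L * norm (x - y)"
proof -
  obtain B where B: "f \<in> borel_measurable borel" "\<And>x. \<bar>f x\<bar> \<le> B"
    using f by (auto simp: bdd_meas_def)
  note i = heat_integrable[OF B]
  have "heat t f x - heat t f y = (\<integral>w. f (x + sqrt t *\<^sub>R w) - f (y + sqrt t *\<^sub>R w) \<partial>std_gauss)"
    using i by (simp add: heat_def)
  also have "\<bar>\<dots>\<bar> \<le> (\<integral>w. \<bar>f (x + sqrt t *\<^sub>R w) - f (y + sqrt t *\<^sub>R w)\<bar> \<partial>std_gauss)"
    by (rule integral_abs_bound)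
  also have "\<dots> \<le> L * norm (x - y)"
    using i lip[of "x + sqrt t *\<^sub>R w" "y + sqrt t *\<^sub>R w" for w]
    by (intro std_gauss.integral_le_const) auto
  finally show ?thesis .
qed

text \<open>The semigroup property, from the characteristic function of a sum of independent Gaussians.\<close>

lemma heat_heat:
  fixes f :: "real^'d::finite \<Rightarrow> real"
  assumes f: "bdd_lipschitz L f" and st: "0 \<le> s" "0 \<le> t"
  shows "heat s (heat t f) x = heat (s + t) f x"
proof -
  let ?G = "std_gauss :: (real^'d) measure"
  interpret P: pair_prob_space ?G ?G ..
  have [measurable]: "f \<in> borel_measurable borel" using f by (rule bdd_lipschitz_measurable)
  let ?h = "\<lambda>z. sqrt s *\<^sub>R fst z + sqrt t *\<^sub>R (snd z :: real^'d)"
  let ?\<mu> = "distr (?G \<Otimes>\<^sub>M ?G) borel ?h"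
  let ?\<nu> = "distr ?G borel (\<lambda>w. sqrt (s + t) *\<^sub>R w)"
  obtain B where B: "\<And>x. \<bar>f x\<bar> \<le> B" using f by (auto simp: bdd_lipschitz_def)
  have f': "bdd_lipschitz L (\<lambda>y. f (x + y))"
    using f unfolding bdd_lipschitz_def by (metis add_diff_cancel_left)
  have char: "(\<integral>x. iexp (u \<bullet> x) \<partial>?\<mu>) = (\<integral>x. iexp (u \<bullet> x) \<partial>?\<nu>)" for u
  proof -
    have "(\<integral>x. iexp (u \<bullet> x) \<partial>?\<mu>) = (\<integral>z. (\<lambda>(v, w). iexp ((sqrt s *\<^sub>R u) \<bullet> v) * iexp ((sqrt t *\<^sub>R u) \<bullet> w)) z \<partial>(?G \<Otimes>\<^sub>M ?G))"
      by (subst integral_distr)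
         (auto intro!: Bochner_Integration.integral_cong simp: exp_add[symmetric] inner_add_right algebra_simps)
    also have "\<dots> = (\<integral>v. (\<integral>w. iexp ((sqrt s *\<^sub>R u) \<bullet> v) * iexp ((sqrt t *\<^sub>R u) \<bullet> w) \<partial>?G) \<partial>?G)"
      by (subst P.integral_fst'[symmetric])
         (auto intro!: P.integrable_const_bound[where B=1] simp: norm_mult)
    also have "\<dots> = (\<integral>v. iexp ((sqrt s *\<^sub>R u) \<bullet> v) \<partial>?G) * (\<integral>w. iexp ((sqrt t *\<^sub>R u) \<bullet> w) \<partial>?G)"
      by simp
    also have "\<dots> = exp (- (norm (sqrt s *\<^sub>R u))\<^sup>2 / 2) * exp (- (norm (sqrt t *\<^sub>R u))\<^sup>2 / 2)"
      by (simp only: integral_exp_std_gauss of_real_mult)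
    also have "\<dots> = exp (- (norm (sqrt (s + t) *\<^sub>R u))\<^sup>2 / 2)"
      using st by (simp add: exp_add[symmetric] power_mult_distrib algebra_simps add_divide_distrib)
    also have "\<dots> = (\<integral>w. iexp ((sqrt (s + t) *\<^sub>R u) \<bullet> w) \<partial>?G)"
      by (simp only: integral_exp_std_gauss)
    also have "\<dots> = (\<integral>x. iexp (u \<bullet> x) \<partial>?\<nu>)"
      by (subst integral_distr) auto
    finally show ?thesis .
  qed
  have "heat s (heat t f) x = (\<integral>v. (\<integral>w. (\<lambda>z. f (x + ?h z)) (v, w) \<partial>?G) \<partial>?G)"
    by (simp add: heat_def add.assoc)
  also have "\<dots> = (\<integral>z. f (x + ?h z) \<partial>(?G \<Otimes>\<^sub>M ?G))"
    by (subst P.integral_fst') (auto intro!: P.integrable_const_bound[where B=B] simp: B)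
  also have "\<dots> = (\<integral>y. f (x + y) \<partial>?\<mu>)"
    by (subst integral_distr) auto
  also have "\<dots> = (\<integral>y. f (x + y) \<partial>?\<nu>)"
    by (rule char_eq_imp_integral_eq[OF _ _ _ _ char f'])
       (auto intro!: P.prob_space_distr std_gauss.prob_space_distr)
  also have "\<dots> = heat (s + t) f x"
    by (subst integral_distr) (auto simp: heat_def)
  finally show ?thesis .
qed

lemma heat_dheat:
  fixes f :: "real^'d::finite \<Rightarrow> real"
  assumes "bdd_borel f" and t: "0 < t"
  shows "heat s (dheat i t f) x = dheat i t (heat s f) x"
proof -
  let ?G = "std_gauss :: (real^'d) measure"
  interpret P: pair_prob_space ?G ?G ..
  obtain B where B': "f \<in> borel_measurable borel" "\<And>x. \<bar>f x\<bar> \<le> B"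
    using assms(1) by (auto simp: bdd_meas_def)
  moreover have "0 \<le> B" using B'(2)[of 0] by linarith
  ultimately have B: "f \<in> borel_measurable borel" "\<And>x. \<bar>f x\<bar> \<le> B" "0 \<le> B" by auto
  have [measurable]: "f \<in> borel_measurable borel" by fact
  have I: "integrable (?G \<Otimes>\<^sub>M ?G) (\<lambda>(v, w). w $ i * f (x + sqrt s *\<^sub>R v + sqrt t *\<^sub>R w))"
  proof (rule P.Fubini_integrable)
    show "(\<lambda>(v, w). w $ i * f (x + sqrt s *\<^sub>R v + sqrt t *\<^sub>R w)) \<in> borel_measurable (?G \<Otimes>\<^sub>M ?G)"
      by measurable
    show "AE v in std_gauss. integrable std_gauss (\<lambda>y. case (v, y) of (v, w) \<Rightarrow> w $ i * f (x + sqrt s *\<^sub>R v + sqrt t *\<^sub>R w))"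
      using dheat_integrable[OF B(1,2)] by simp
    have "\<bar>\<integral>w. \<bar>w $ i * f (x + sqrt s *\<^sub>R v + sqrt t *\<^sub>R w)\<bar> \<partial>?G\<bar> \<le> B * gauss_moment TYPE('d) 1" for v
    proof -
      have "(\<integral>w. \<bar>w $ i * f (x + sqrt s *\<^sub>R v + sqrt t *\<^sub>R w)\<bar> \<partial>?G)
         \<le> (\<integral>w. B * (\<Sum>i\<in>UNIV. \<bar>(w::real^'d) $ i\<bar>) ^ 1 \<partial>std_gauss)"
      proof (rule integral_mono)
        show "integrable std_gauss (\<lambda>w. \<bar>w $ i * f (x + sqrt s *\<^sub>R v + sqrt t *\<^sub>R w)\<bar>)"
          by (rule integrable_abs[OF dheat_integrable[OF B(1,2)]])
        show "integrable std_gauss (\<lambda>w. B * (\<Sum>i\<in>UNIV. \<bar>(w::real^'d) $ i\<bar>) ^ 1)"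
          by (rule integrable_mult_right[OF std_gauss_integrable_sum_power])
        show "\<bar>w $ i * f (x + sqrt s *\<^sub>R v + sqrt t *\<^sub>R w)\<bar> \<le> B * (\<Sum>i\<in>UNIV. \<bar>w $ i\<bar>) ^ 1" for w
          unfolding abs_mult mult.commute[of "\<bar>w $ i\<bar>"] power_one_right
          by (rule mult_mono) (use B coord_le_l1 in auto)
      qed
      also have "\<dots> = B * gauss_moment TYPE('d) 1" by (simp add: gauss_moment_def)
      finally show ?thesis by (subst abs_of_nonneg) auto
    qed
    then show "integrable ?G (\<lambda>v. \<integral>w. norm (case (v, w) of (v, w) \<Rightarrow> w $ i * f (x + sqrt s *\<^sub>R v + sqrt t *\<^sub>R w)) \<partial>?G)"
      by (auto intro!: std_gauss.integrable_const_bound[where B="B * gauss_moment TYPE('d) 1"])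
  qed
  have "heat s (dheat i t f) x = (\<integral>v. (\<integral>w. w $ i * f (x + sqrt s *\<^sub>R v + sqrt t *\<^sub>R w) \<partial>?G) \<partial>?G) / sqrt t"
    by (simp add: heat_def dheat_def)
  also have "(\<integral>v. (\<integral>w. w $ i * f (x + sqrt s *\<^sub>R v + sqrt t *\<^sub>R w) \<partial>?G) \<partial>?G)
     = (\<integral>w. (\<integral>v. w $ i * f (x + sqrt s *\<^sub>R v + sqrt t *\<^sub>R w) \<partial>?G) \<partial>?G)"
    by (rule P.Fubini_integral[symmetric, OF I])
  also have "\<dots> / sqrt t = dheat i t (heat s f) x"
    by (simp add: heat_def dheat_def add_ac)
  finally show ?thesis .
qed

lemma has_real_derivative_quadratic:
  fixes \<phi> :: "real \<Rightarrow> real"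
  assumes "0 < \<delta>" and "\<And>\<theta>. \<bar>\<theta>\<bar> < \<delta> \<Longrightarrow> \<bar>\<phi> \<theta> - \<phi> 0 - \<theta> * D\<bar> \<le> K * \<theta>\<^sup>2"
  shows "(\<phi> has_real_derivative D) (at 0)"
  unfolding has_field_derivative_iff
proof -
  have "((\<lambda>\<theta>. (\<phi> (0 + \<theta>) - \<phi> 0) / \<theta> - D) \<longlongrightarrow> 0) (at 0)"
  proof (rule Lim_null_comparison)
    show "((\<lambda>\<theta>. K * \<bar>\<theta>\<bar>) \<longlongrightarrow> 0) (at 0)"
      by (auto intro!: tendsto_eq_intros)
    show "\<forall>\<^sub>F \<theta> in at 0. norm ((\<phi> (0 + \<theta>) - \<phi> 0) / \<theta> - D) \<le> K * \<bar>\<theta>\<bar>"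
      unfolding eventually_at
    proof (intro exI[of _ \<delta>] conjI ballI impI)
      fix \<theta> :: real assume "\<theta> \<noteq> 0 \<and> dist \<theta> 0 < \<delta>"
      then have \<theta>: "\<theta> \<noteq> 0" "\<bar>\<theta>\<bar> < \<delta>" by auto
      have "(\<phi> (0 + \<theta>) - \<phi> 0) / \<theta> - D = (\<phi> \<theta> - \<phi> 0 - \<theta> * D) / \<theta>"
        using \<theta>(1) by (simp add: diff_divide_distrib)
      then have "norm ((\<phi> (0 + \<theta>) - \<phi> 0) / \<theta> - D) = \<bar>\<phi> \<theta> - \<phi> 0 - \<theta> * D\<bar> / \<bar>\<theta>\<bar>"
        by (simp only: real_norm_def abs_divide)
      also have "\<dots> \<le> K * \<theta>\<^sup>2 / \<bar>\<theta>\<bar>"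
        using assms(2)[OF \<theta>(2)] by (intro divide_right_mono) auto
      also have "\<theta>\<^sup>2 = \<bar>\<theta>\<bar> * \<bar>\<theta>\<bar>"
        by (simp add: power2_eq_square)
      also have "K * (\<bar>\<theta>\<bar> * \<bar>\<theta>\<bar>) / \<bar>\<theta>\<bar> = K * \<bar>\<theta>\<bar>"
        using \<theta>(1) by (simp del: abs_mult_self_eq)
      finally show "norm ((\<phi> (0 + \<theta>) - \<phi> 0) / \<theta> - D) \<le> K * \<bar>\<theta>\<bar>" .
    qed (use assms in auto)
  qed
  then show "((\<lambda>y. (\<phi> y - \<phi> 0) / (y - 0)) \<longlongrightarrow> D) (at 0)"
    by (simp add: LIM_zero_iff)
qed

text \<open>The linearised Cameron--Martin density: its error in \<open>L\<^sup>1\<close> is quadratic.\<close>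

lemma cameron_martin_linearisation:
  fixes y :: "real^'d::finite"
  assumes "norm y \<le> 1"
  shows "integrable std_gauss (\<lambda>w. exp (y \<bullet> w - (norm y)\<^sup>2 / 2) - 1 - y \<bullet> w)"
    and "(\<integral>w. \<bar>exp (y \<bullet> w - (norm y)\<^sup>2 / 2) - 1 - y \<bullet> w\<bar> \<partial>std_gauss) \<le> (norm y)\<^sup>2"
proof -
  let ?E = "\<lambda>w. exp (y \<bullet> w - (norm y)\<^sup>2 / 2)"
  let ?R = "\<lambda>w. ?E w - 1 - y \<bullet> w"
  note E = std_gauss_exp[of y] and I = std_gauss_inner[of y]
  have one: "(\<integral>w. 1 \<partial>(std_gauss::(real^'d) measure)) = (1::real)"
    using std_gauss.prob_space[where 'd='d] by simp
  show int: "integrable std_gauss ?R" using E I by auto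
  have E2: "(?E w)\<^sup>2 = exp ((norm y)\<^sup>2) * exp ((2 *\<^sub>R y) \<bullet> w - (norm (2 *\<^sub>R y))\<^sup>2 / 2)" for w
    by (simp add: exp_add[symmetric] exp_double[symmetric] power_mult_distrib algebra_simps)
  have iE2: "integrable std_gauss (\<lambda>w. (?E w)\<^sup>2)" "(\<integral>w. (?E w)\<^sup>2 \<partial>std_gauss) = exp ((norm y)\<^sup>2)"
    unfolding E2 using std_gauss_exp[of "2 *\<^sub>R y"] by auto
  have sh: "integrable std_gauss (\<lambda>w. y \<bullet> (w + y))" "(\<integral>w. y \<bullet> (w + y) \<partial>std_gauss) = (norm y)\<^sup>2"
    using I one by (auto simp: inner_add_right power2_norm_eq_inner)
  have iyE: "integrable std_gauss (\<lambda>w. (y \<bullet> w) * ?E w)" "(\<integral>w. (y \<bullet> w) * ?E w \<partial>std_gauss) = (norm y)\<^sup>2"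
    using std_gauss_shift[of "\<lambda>w. y \<bullet> w" y] sh by auto
  have R2: "(?R w)\<^sup>2 = (?E w)\<^sup>2 + 1 + (y \<bullet> w)\<^sup>2 - 2 * ?E w - 2 * ((y \<bullet> w) * ?E w) + 2 * (y \<bullet> w)" for w
    by (simp add: power2_eq_square algebra_simps)
  have iR2: "integrable std_gauss (\<lambda>w. (?R w)\<^sup>2)"
    unfolding R2 using iE2 E I iyE by auto
  have vR2: "(\<integral>w. (?R w)\<^sup>2 \<partial>std_gauss) = exp ((norm y)\<^sup>2) - 1 - (norm y)\<^sup>2"
    unfolding R2 using iE2 E I iyE one by simp
  have "0 \<le> std_gauss.variance (\<lambda>w. \<bar>?R w\<bar>)"
    by (rule std_gauss.variance_positive)
  also have "\<dots> = (\<integral>w. (?R w)\<^sup>2 \<partial>std_gauss) - (\<integral>w. \<bar>?R w\<bar> \<partial>std_gauss)\<^sup>2"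
    by (subst std_gauss.variance_eq) (use int iR2 in auto)
  finally have "(\<integral>w. \<bar>?R w\<bar> \<partial>std_gauss)\<^sup>2 \<le> exp ((norm y)\<^sup>2) - 1 - (norm y)\<^sup>2"
    by (simp add: vR2)
  also have "\<dots> \<le> ((norm y)\<^sup>2)\<^sup>2"
    using exp_bound[of "(norm y)\<^sup>2"] assms by (auto simp: power_le_one)
  finally show "(\<integral>w. \<bar>?R w\<bar> \<partial>std_gauss) \<le> (norm y)\<^sup>2"
    by (rule power2_le_imp_le) simp
qed

lemma heat_has_derivative:
  fixes f :: "real^'d::finite \<Rightarrow> real"
  assumes "bdd_borel f" and t: "0 < t"
  shows "((\<lambda>\<theta>. heat t f (x + \<theta> *\<^sub>R y)) has_real_derivative (\<Sum>i\<in>UNIV. y $ i * dheat i t f x)) (at 0)"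
proof -
  obtain B where B': "f \<in> borel_measurable borel" "\<And>x. \<bar>f x\<bar> \<le> B"
    using assms(1) by (auto simp: bdd_meas_def)
  moreover have "0 \<le> B" using B'(2)[of 0] by linarith
  ultimately have B: "f \<in> borel_measurable borel" "\<And>x. \<bar>f x\<bar> \<le> B" "0 \<le> B" by auto
  have [measurable]: "f \<in> borel_measurable borel" by fact
  define v where "v = (1 / sqrt t) *\<^sub>R y"
  define F where "F w = f (x + sqrt t *\<^sub>R w)" for w
  have [measurable]: "F \<in> borel_measurable borel" unfolding F_def by measurable
  have FB: "\<bar>F w\<bar> \<le> B" for w using B by (simp add: F_def)
  have iF: "integrable std_gauss F"
    using FB by (intro std_gauss.integrable_const_bound[where B=B]) auto
  have iFv: "integrable std_gauss (\<lambda>w. F w * (v \<bullet> w))"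
    by (rule Bochner_Integration.integrable_bound[OF integrable_mult_right[OF std_gauss_inner(1), of B v]])
       (use FB B in \<open>auto simp: abs_mult intro!: mult_right_mono\<close>)
  let ?E = "\<lambda>\<theta> w. exp ((\<theta> *\<^sub>R v) \<bullet> w - (norm (\<theta> *\<^sub>R v))\<^sup>2 / 2)"
  have sh: "F (w + \<theta> *\<^sub>R v) = f (x + \<theta> *\<^sub>R y + sqrt t *\<^sub>R w)" for w \<theta>
    using t by (simp add: F_def v_def algebra_simps)
  have h: "heat t f (x + \<theta> *\<^sub>R y) = (\<integral>w. F w * ?E \<theta> w \<partial>std_gauss)"
     "integrable std_gauss (\<lambda>w. F w * ?E \<theta> w)" for \<theta>
  proof -
    have "integrable std_gauss (\<lambda>w. F (w + \<theta> *\<^sub>R v))"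
      using FB by (intro std_gauss.integrable_const_bound[where B=B]) auto
    then show "integrable std_gauss (\<lambda>w. F w * ?E \<theta> w)"
      by (subst std_gauss_shift(1)[symmetric]) auto
    show "heat t f (x + \<theta> *\<^sub>R y) = (\<integral>w. F w * ?E \<theta> w \<partial>std_gauss)"
      by (subst std_gauss_shift(2)[symmetric]) (auto simp: heat_def sh)
  qed
  have D: "(\<integral>w. F w * (v \<bullet> w) \<partial>std_gauss) = (\<Sum>i\<in>UNIV. y $ i * dheat i t f x)"
  proof -
    have "(\<integral>w. F w * (v \<bullet> w) \<partial>std_gauss) = (\<integral>w. (\<Sum>i\<in>UNIV. (y $ i / sqrt t) * (w $ i * F w)) \<partial>std_gauss)"
      by (simp add: v_def inner_vec_def sum_distrib_left mult_ac)
    also have "\<dots> = (\<Sum>i\<in>UNIV. (y $ i / sqrt t) * (\<integral>w. w $ i * F w \<partial>std_gauss))"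
      unfolding F_def using dheat_integrable[OF B(1,2)]
      by (subst Bochner_Integration.integral_sum) auto
    finally show ?thesis by (simp add: dheat_def F_def)
  qed
  show ?thesis
  proof (rule has_real_derivative_quadratic)
    show "0 < 1 / (1 + norm v)" by (simp add: add_pos_nonneg)
    fix \<theta> :: real assume "\<bar>\<theta>\<bar> < 1 / (1 + norm v)"
    then have "\<bar>\<theta>\<bar> * (1 + norm v) < 1" by (simp add: field_simps add_pos_nonneg)
    then have n: "norm (\<theta> *\<^sub>R v) \<le> 1" using abs_ge_zero[of \<theta>] by (simp add: algebra_simps)
    let ?R = "\<lambda>w. ?E \<theta> w - 1 - (\<theta> *\<^sub>R v) \<bullet> w"
    have "heat t f (x + \<theta> *\<^sub>R y) - heat t f (x + 0 *\<^sub>R y) - \<theta> * (\<Sum>i\<in>UNIV. y $ i * dheat i t f x)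
       = (\<integral>w. F w * ?R w \<partial>std_gauss)"
    proof -
      have "F w * ?R w = F w * ?E \<theta> w - F w - \<theta> * (F w * (v \<bullet> w))" for w by (simp add: algebra_simps)
      then have "(\<integral>w. F w * ?R w \<partial>std_gauss) = (\<integral>w. F w * ?E \<theta> w - F w - \<theta> * (F w * (v \<bullet> w)) \<partial>std_gauss)"
        by (simp only:)
      also have "\<dots> = (\<integral>w. F w * ?E \<theta> w \<partial>std_gauss) - (\<integral>w. F w \<partial>std_gauss) - \<theta> * (\<integral>w. F w * (v \<bullet> w) \<partial>std_gauss)"
        using h(2)[of \<theta>] iF iFv by simp
      finally show ?thesis unfolding D h(1)[of \<theta>] by (simp add: heat_def F_def)
    qed
    also have "\<bar>\<dots>\<bar> \<le> (\<integral>w. \<bar>F w * ?R w\<bar> \<partial>std_gauss)" by (rule integral_abs_bound)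
    also have "\<dots> \<le> (\<integral>w. B * \<bar>?R w\<bar> \<partial>std_gauss)"
    proof (rule integral_mono)
      have i: "integrable std_gauss (\<lambda>w. B * \<bar>?R w\<bar>)"
        by (intro integrable_mult_right integrable_abs cameron_martin_linearisation(1)[OF n])
      then show "integrable std_gauss (\<lambda>w. B * \<bar>?R w\<bar>)" .
      show "integrable std_gauss (\<lambda>w. \<bar>F w * ?R w\<bar>)"
        by (rule Bochner_Integration.integrable_bound[OF i])
           (use FB B in \<open>auto simp: abs_mult intro!: mult_right_mono\<close>)
    qed (use FB in \<open>auto simp: abs_mult intro!: mult_right_mono\<close>)
    also have "\<dots> = B * (\<integral>w. \<bar>?R w\<bar> \<partial>std_gauss)" by simp
    also have "\<dots> \<le> B * (norm (\<theta> *\<^sub>R v))\<^sup>2"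
      using B cameron_martin_linearisation(2)[OF n] by (intro mult_left_mono) auto
    also have "\<dots> = (B * (norm v)\<^sup>2) * \<theta>\<^sup>2" by (simp add: power_mult_distrib)
    finally show "\<bar>heat t f (x + \<theta> *\<^sub>R y) - heat t f (x + 0 *\<^sub>R y) - \<theta> * (\<Sum>i\<in>UNIV. y $ i * dheat i t f x)\<bar>
       \<le> (B * (norm v)\<^sup>2) * \<theta>\<^sup>2" .
  qed
qed

section \<open>Jets and Taylor expansion\<close>

text \<open>A family indexed by lists of coordinates that behaves like the iterated partial derivatives of
\<open>G []\<close>: all members are bounded and measurable, and the directional derivatives of \<open>G l\<close> are the
corresponding combinations of the functions \<open>G (i # l)\<close>.\<close>

definition jet :: "('d::finite list \<Rightarrow> real^'d \<Rightarrow> real) \<Rightarrow> bool" where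
  "jet G \<longleftrightarrow> (\<forall>l. bdd_borel (G l)) \<and>
     (\<forall>l x y. ((\<lambda>\<theta>. G l (x + \<theta> *\<^sub>R y)) has_real_derivative (\<Sum>i\<in>UNIV. y $ i * G (i # l) x)) (at 0))"

lemma jet_append: "jet G \<Longrightarrow> jet (\<lambda>l. G (l @ m))"
  unfolding jet_def by simp

text \<open>The \<open>p\<close>-th derivative of \<open>G l\<close> in direction \<open>y\<close>.\<close>

primrec jdir :: "('d::finite list \<Rightarrow> real^'d \<Rightarrow> real) \<Rightarrow> real^'d \<Rightarrow> nat \<Rightarrow> 'd list \<Rightarrow> real^'d \<Rightarrow> real" where
  "jdir G y 0 l x = G l x"
| "jdir G y (Suc p) l x = (\<Sum>i\<in>UNIV. y $ i * jdir G y p (i # l) x)"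

lemma jdir_has_derivative:
  assumes "jet G"
  shows "((\<lambda>\<theta>. jdir G y p l (x + \<theta> *\<^sub>R y)) has_real_derivative jdir G y (Suc p) l (x + \<theta> *\<^sub>R y)) (at \<theta>)"
proof (induction p arbitrary: l)
  case 0
  have "((\<lambda>\<eta>. G l ((x + \<theta> *\<^sub>R y) + \<eta> *\<^sub>R y)) has_real_derivative (\<Sum>i\<in>UNIV. y $ i * G (i # l) (x + \<theta> *\<^sub>R y))) (at (\<theta> - \<theta>))"
    using assms by (simp add: jet_def)
  then have "((\<lambda>\<eta>. G l ((x + \<theta> *\<^sub>R y) + (\<eta> - \<theta>) *\<^sub>R y)) has_real_derivative (\<Sum>i\<in>UNIV. y $ i * G (i # l) (x + \<theta> *\<^sub>R y)) * 1) (at \<theta>)"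
    by (rule DERIV_chain2) (auto intro!: derivative_eq_intros)
  then show ?case by (simp add: algebra_simps)
next
  case (Suc p)
  show ?case unfolding jdir.simps(2)[of G y p]  jdir.simps(2)[of G y "Suc p"]
    by (intro DERIV_sum DERIV_cmult Suc.IH[unfolded jdir.simps(2)[of G y p]])
qed

lemma jdir_bound:
  assumes "\<And>l' x. length l' = length l + p \<Longrightarrow> \<bar>G l' x\<bar> \<le> b" and "0 \<le> b"
  shows "\<bar>jdir G y p l x\<bar> \<le> (\<Sum>i\<in>UNIV. \<bar>y $ i\<bar>) ^ p * b"
  using assms(1)
proof (induction p arbitrary: l)
  case (Suc p)
  have "\<bar>jdir G y (Suc p) l x\<bar> \<le> (\<Sum>i\<in>UNIV. \<bar>y $ i\<bar> * ((\<Sum>i\<in>UNIV. \<bar>y $ i\<bar>) ^ p * b))"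
    unfolding jdir.simps(2)
    by (rule order_trans[OF sum_abs])
       (auto simp: abs_mult intro!: sum_mono mult_left_mono Suc)
  then show ?case by (simp add: sum_distrib_right mult.assoc)
qed simp

lemma jdir_uminus: "jdir G (- y) p l x = (- 1) ^ p * jdir G y p l x"
  by (induction p arbitrary: l) (simp_all add: sum_distrib_left algebra_simps)

lemma jet_taylor:
  assumes "jet G" "0 < p" and b: "\<And>l' x. length l' = length l + p \<Longrightarrow> \<bar>G l' x\<bar> \<le> b" and "0 \<le> b"
  shows "\<bar>G l (x + y) - (\<Sum>m<p. jdir G y m l x / fact m)\<bar> \<le> (\<Sum>i\<in>UNIV. \<bar>y $ i\<bar>) ^ p * b / fact p"
proof -
  have "\<exists>t>0. t < 1 \<and> jdir G y 0 l (x + 1 *\<^sub>R y) =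
      (\<Sum>m<p. jdir G y m l (x + 0 *\<^sub>R y) / fact m * 1 ^ m) + jdir G y p l (x + t *\<^sub>R y) / fact p * 1 ^ p"
    by (rule Maclaurin[of 1 p "\<lambda>m \<theta>. jdir G y m l (x + \<theta> *\<^sub>R y)"])
       (use assms(1,2) jdir_has_derivative in auto)
  then obtain t where "G l (x + y) - (\<Sum>m<p. jdir G y m l x / fact m) = jdir G y p l (x + t *\<^sub>R y) / fact p"
    by auto
  then show ?thesis using jdir_bound[OF b \<open>0 \<le> b\<close>, where l=l and y=y and x="x + t *\<^sub>R y"]
    by (simp add: abs_divide divide_right_mono)
qed

lemma sum_lessThan_4: "(\<Sum>m<(4::nat). f m) = f 0 + f 1 + f 2 + f (3::nat)" for f :: "nat \<Rightarrow> real"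
  by (simp add: eval_nat_numeral)

lemma sum_lessThan_3: "(\<Sum>m<(3::nat). f m) = f 0 + f 1 + f (2::nat)" for f :: "nat \<Rightarrow> real"
  by (simp add: eval_nat_numeral)

lemma jdir_1: "jdir G y 1 l x = (\<Sum>i\<in>UNIV. y $ i * G (i # l) x)"
  by simp

lemma jdir_2: "jdir G y 2 l x = (\<Sum>i\<in>UNIV. \<Sum>j\<in>UNIV. y $ i * y $ j * G (j # i # l) x)"
  by (simp add: eval_nat_numeral sum_distrib_left mult.assoc)

lemma jdir_3: "jdir G y 3 l x = (\<Sum>i\<in>UNIV. \<Sum>j\<in>UNIV. \<Sum>k\<in>UNIV. y $ i * y $ j * y $ k * G (k # j # i # l) x)"
  by (simp add: eval_nat_numeral sum_distrib_left mult.assoc)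

lemma symmetric_combine:
  fixes p q g a b c K :: real
  assumes "\<bar>p - (g + a + b / 2 + c / 6)\<bar> \<le> K" "\<bar>q - (g - a + b / 2 - c / 6)\<bar> \<le> K"
  shows "\<bar>(p + q) / 2 - g - b / 2\<bar> \<le> K"
proof -
  have "(p + q) / 2 - g - b / 2 = ((p - (g + a + b / 2 + c / 6)) + (q - (g - a + b / 2 - c / 6))) / 2"
    by (simp add: field_simps)
  also have "\<bar>\<dots>\<bar> \<le> (\<bar>p - (g + a + b / 2 + c / 6)\<bar> + \<bar>q - (g - a + b / 2 - c / 6)\<bar>) / 2"
    by (simp only: abs_divide) (simp add: abs_triangle_ineq)
  also have "\<dots> \<le> (K + K) / 2"
    using assms by (intro divide_right_mono add_mono) auto
  finally show ?thesis by simp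
qed

lemma jet_symmetric_taylor:
  assumes "jet G" and b: "\<And>l' x. length l' = length l + 4 \<Longrightarrow> \<bar>G l' x\<bar> \<le> b" and "0 \<le> b"
  shows "\<bar>(G l (x + y) + G l (x - y)) / 2 - G l x - jdir G y 2 l x / 2\<bar> \<le> (\<Sum>i\<in>UNIV. \<bar>y $ i\<bar>) ^ 4 * b / 24"
proof -
  have f: "fact 4 = (24::real)" "fact 3 = (6::real)" "fact 2 = (2::real)" by (simp_all add: eval_nat_numeral)
  have 1: "\<bar>G l (x + y) - (\<Sum>m<4. jdir G y m l x / fact m)\<bar> \<le> (\<Sum>i\<in>UNIV. \<bar>y $ i\<bar>) ^ 4 * b / fact 4"
    by (rule jet_taylor) (use assms in auto)
  have 2: "\<bar>G l (x + - y) - (\<Sum>m<4. jdir G (-y) m l x / fact m)\<bar> \<le> (\<Sum>i\<in>UNIV. \<bar>(- y) $ i\<bar>) ^ 4 * b / fact 4"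
    by (rule jet_taylor) (use assms in auto)
  let ?K = "(\<Sum>i\<in>UNIV. \<bar>y $ i\<bar>) ^ 4 * b / 24"
  have "\<bar>G l (x + y) - (G l x + jdir G y 1 l x + jdir G y 2 l x / 2 + jdir G y 3 l x / 6)\<bar> \<le> ?K"
    using 1 unfolding sum_lessThan_4 f by simp
  moreover have "\<bar>G l (x - y) - (G l x - jdir G y 1 l x + jdir G y 2 l x / 2 - jdir G y 3 l x / 6)\<bar> \<le> ?K"
    using 2 unfolding sum_lessThan_4 jdir_uminus f by simp
  ultimately show ?thesis
    by (rule symmetric_combine)
qed

text \<open>One unit of heat flow adds half the Laplacian up to a fourth-order error; the odd orders cancel by
the symmetry of the Gaussian measure.\<close>

lemma heat_step:
  fixes G :: "'d::finite list \<Rightarrow> real^'d \<Rightarrow> real"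
  assumes J: "jet G" and b: "\<And>l' x. length l' = length l + 4 \<Longrightarrow> \<bar>G l' x\<bar> \<le> b" and "0 \<le> b"
  shows "\<bar>heat 1 (G l) x - G l x - (\<Sum>i\<in>UNIV. G (i # i # l) x) / 2\<bar> \<le> gauss_moment TYPE('d) 4 * b / 24"
proof -
  have bd: "bdd_borel (G l)" using J by (simp add: jet_def)
  then obtain B where B: "G l \<in> borel_measurable borel" "\<And>x. \<bar>G l x\<bar> \<le> B"
    by (auto simp: bdd_meas_def)
  have [measurable]: "G l \<in> borel_measurable borel" by fact
  have i1: "integrable std_gauss (\<lambda>w. G l (x + w))" "integrable std_gauss (\<lambda>w. G l (x - w))"
    using B(2) by (auto intro!: std_gauss.integrable_const_bound[where B=B])
  have h: "heat 1 (G l) x = (\<integral>w. (G l (x + w) + G l (x - w)) / 2 \<partial>std_gauss)"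
    using i1 std_gauss_uminus[of "\<lambda>w. G l (x + w)"] by (simp add: heat_def)
  have i2: "integrable std_gauss (\<lambda>w. jdir G w 2 l x)"
    unfolding jdir_2 by (intro Bochner_Integration.integrable_sum integrable_mult_left std_gauss_moment2)
  have v2: "(\<integral>w. jdir G w 2 l x \<partial>std_gauss) = (\<Sum>i\<in>UNIV. G (i # i # l) x)"
    unfolding jdir_2
    by (simp add: Bochner_Integration.integral_sum Bochner_Integration.integrable_sum std_gauss_moment2 if_distrib[of "\<lambda>c. c * _"] cong: if_cong)
  let ?D = "\<lambda>w. (G l (x + w) + G l (x - w)) / 2 - G l x - jdir G w 2 l x / 2"
  have iD: "integrable std_gauss ?D" using i1 i2 by auto
  have "heat 1 (G l) x - G l x - (\<Sum>i\<in>UNIV. G (i # i # l) x) / 2 = (\<integral>w. ?D w \<partial>std_gauss)"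
    using i1 i2 std_gauss.prob_space[where 'd='d] by (simp add: h v2)
  also have "\<bar>\<dots>\<bar> \<le> (\<integral>w. \<bar>?D w\<bar> \<partial>std_gauss)" by (rule integral_abs_bound)
  also have "\<dots> \<le> (\<integral>w. (\<Sum>i\<in>UNIV. \<bar>(w::real^'d) $ i\<bar>) ^ 4 * (b / 24) \<partial>std_gauss)"
  proof (rule integral_mono)
    show "integrable std_gauss (\<lambda>w. (\<Sum>i\<in>UNIV. \<bar>(w::real^'d) $ i\<bar>) ^ 4 * (b / 24))"
      by (rule integrable_mult_left[OF std_gauss_integrable_sum_power])
  qed (use integrable_abs[OF iD] jet_symmetric_taylor[OF J b \<open>0 \<le> b\<close>] in auto)
  also have "\<dots> = gauss_moment TYPE('d) 4 * b / 24"
    by (simp add: gauss_moment_def)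
  finally show ?thesis .
qed

section \<open>Derivatives of the heat flow\<close>

text \<open>The iterated partial derivatives of the heat flow of \<open>\<psi>\<close> at time \<open>s\<close>; each derivative uses
half of the remaining time for smoothing.  The semigroup property shows that the way in which the
time is divided does not matter.\<close>

primrec heat_jet :: "(real^'d::finite \<Rightarrow> real) \<Rightarrow> 'd list \<Rightarrow> real \<Rightarrow> real^'d \<Rightarrow> real" where
  "heat_jet \<psi> [] = (\<lambda>s. heat s \<psi>)"
| "heat_jet \<psi> (i # l) = (\<lambda>s. dheat i (s / 2) (heat_jet \<psi> l (s / 2)))"

lemma heat_jet_bdd_borel:
  assumes "bdd_lipschitz L \<psi>" "0 < s" shows "bdd_borel (heat_jet \<psi> l s)"
  using assms(2) by (induction l arbitrary: s)
    (auto intro!: bdd_borel_heat bdd_borel_dheat bdd_lipschitz_bdd_borel[OF assms(1)])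

lemma heat_jet_semigroup_derivative:
  assumes \<psi>: "bdd_lipschitz L \<psi>"
  shows "0 < s \<Longrightarrow> 0 < t \<Longrightarrow> heat t (heat_jet \<psi> l s) x = heat_jet \<psi> l (s + t) x"
proof (induction l arbitrary: s t x)
  case Nil
  then show ?case using heat_heat[OF \<psi>, of t s] by (simp add: add.commute)
next
  case (Cons i l)
  note bd = heat_jet_bdd_borel[OF \<psi>]
  have D: "((\<lambda>\<theta>. heat_jet \<psi> l (s + t) (x + \<theta> *\<^sub>R axis i 1)) has_real_derivative
      dheat i \<tau> (heat_jet \<psi> l (s + t - \<tau>)) x) (at 0)" if "0 < \<tau>" "\<tau> < s + t" for \<tau>
  proof -
    have "(\<lambda>\<theta>. heat_jet \<psi> l (s + t) (x + \<theta> *\<^sub>R axis i 1)) = (\<lambda>\<theta>. heat \<tau> (heat_jet \<psi> l (s + t - \<tau>)) (x + \<theta> *\<^sub>R axis i 1))"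
      using Cons.IH[of "s + t - \<tau>" \<tau>] that by simp
    moreover have "(\<Sum>j\<in>UNIV. axis i 1 $ j * dheat j \<tau> (heat_jet \<psi> l (s + t - \<tau>)) x) = dheat i \<tau> (heat_jet \<psi> l (s + t - \<tau>)) x"
      by (simp add: axis_def if_distrib[of "\<lambda>c. c * _"] cong: if_cong)
    ultimately show ?thesis
      using heat_has_derivative[OF bd, of "s + t - \<tau>" \<tau> l x "axis i 1"] that by simp
  qed
  have "heat t (heat_jet \<psi> (i # l) s) x = dheat i (s / 2) (heat t (heat_jet \<psi> l (s / 2))) x"
    using heat_dheat[OF bd] Cons.prems by simp
  also have "heat t (heat_jet \<psi> l (s / 2)) = heat_jet \<psi> l (s + t - s / 2)"
    using Cons.IH[of "s / 2" t] Cons.prems by (auto simp: fun_eq_iff algebra_simps)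
  also have "dheat i (s / 2) (heat_jet \<psi> l (s + t - s / 2)) x = dheat i ((s + t) / 2) (heat_jet \<psi> l (s + t - (s + t) / 2)) x"
    by (rule DERIV_unique[OF D D]) (use Cons.prems in auto)
  also have "s + t - (s + t) / 2 = (s + t) / 2" by (simp add: field_simps)
  finally show ?case by simp
qed

lemma jet_heat_jet:
  assumes \<psi>: "bdd_lipschitz L \<psi>" and s: "0 < s"
  shows "jet (\<lambda>l. heat_jet \<psi> l s)"
  unfolding jet_def
proof (intro conjI allI)
  fix l x y
  show "bdd_borel (heat_jet \<psi> l s)" using heat_jet_bdd_borel[OF \<psi> s] .
  have "heat_jet \<psi> l s = heat (s / 2) (heat_jet \<psi> l (s / 2))"
    using heat_jet_semigroup_derivative[OF \<psi>, of "s / 2" "s / 2" l] s by (auto simp: fun_eq_iff)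
  then show "((\<lambda>\<theta>. heat_jet \<psi> l s (x + \<theta> *\<^sub>R y)) has_real_derivative (\<Sum>i\<in>UNIV. y $ i * heat_jet \<psi> (i # l) s x)) (at 0)"
    using heat_has_derivative[OF heat_jet_bdd_borel[OF \<psi>], of "s / 2" "s / 2" l x y] s by simp
qed

lemma divide_powr_half: "a / 2 powr (- m / 2) = a * 2 powr (m / 2)" for a m :: real
proof -
  have "2 powr (- m / 2) = inverse ((2::real) powr (m / 2))"
    using powr_minus[of "2::real" "m / 2"] by simp
  moreover have "a / inverse b = a * b" for b :: real by (simp add: divide_inverse)
  ultimately show ?thesis by (simp only:)
qed

text \<open>Up to constants, the first derivative is bounded by the Lipschitz constant, and each further one
costs a factor of order \<open>s powr (- 1 / 2)\<close>.\<close>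

lemma heat_jet_bound:
  "\<exists>C\<ge>0. \<forall>L \<psi> l s x. bdd_lipschitz L \<psi> \<longrightarrow> length l = Suc n \<longrightarrow> 0 < s \<longrightarrow>
     \<bar>heat_jet (\<psi> :: real^'d::finite \<Rightarrow> real) l s x\<bar> \<le> C * L * s powr (- real n / 2)"
proof (induction n)
  case 0
  show ?case
  proof (intro exI[of _ "gauss_moment TYPE('d) 2"] conjI allI impI gauss_moment_nonneg)
    fix L s and \<psi> :: "real^'d \<Rightarrow> real" and l :: "'d list" and x
    assume \<psi>: "bdd_lipschitz L \<psi>" and l: "length l = Suc 0" and s: "0 < (s::real)"
    from l obtain i where i: "l = [i]" by (auto simp: length_Suc_conv)
    have "\<bar>heat (s / 2) \<psi> x - heat (s / 2) \<psi> y\<bar> \<le> L * norm (x - y)" for x y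
      by (rule heat_lipschitz) (use \<psi> bdd_lipschitz_bdd_borel in \<open>auto simp: bdd_lipschitz_def\<close>)
    then show "\<bar>heat_jet \<psi> l s x\<bar> \<le> gauss_moment TYPE('d) 2 * L * s powr (- real 0 / 2)"
      using dheat_lipschitz_bound[OF bdd_borel_heat[OF bdd_lipschitz_bdd_borel[OF \<psi>]], of "s / 2" L "s / 2" i x] s i
      by (simp add: mult.commute)
  qed
next
  case (Suc n)
  then obtain C where C: "0 \<le> C" "\<And>L \<psi> l s x. bdd_lipschitz L \<psi> \<Longrightarrow> length l = Suc n \<Longrightarrow> 0 < s \<Longrightarrow>
     \<bar>heat_jet (\<psi> :: real^'d \<Rightarrow> real) l s x\<bar> \<le> C * L * s powr (- real n / 2)" by blast
  let ?C = "C * gauss_moment TYPE('d) 1 * 2 powr (real (Suc n) / 2)"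
  show ?case
  proof (intro exI[of _ ?C] conjI allI impI)
    show "0 \<le> ?C" using C(1) gauss_moment_nonneg[where 'd='d] by simp
    fix L s and \<psi> :: "real^'d \<Rightarrow> real" and l :: "'d list" and x
    assume \<psi>: "bdd_lipschitz L \<psi>" and l: "length l = Suc (Suc n)" and s: "0 < (s::real)"
    from l obtain i l' where i: "l = i # l'" "length l' = Suc n" by (auto simp: length_Suc_conv)
    have "\<bar>heat_jet \<psi> l s x\<bar> \<le> (C * L * (s / 2) powr (- real n / 2)) * gauss_moment TYPE('d) 1 / sqrt (s / 2)"
      unfolding i(1) heat_jet.simps
    proof (rule dheat_bound)
      show "heat_jet \<psi> l' (s / 2) \<in> borel_measurable borel"
        using heat_jet_bdd_borel[OF \<psi>, of "s / 2" l'] s by (auto simp: bdd_meas_def)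
    qed (use C(2)[OF \<psi> i(2), of "s / 2"] s in auto)
    also have "sqrt (s / 2) = (s / 2) powr (1 / 2)"
      using s by (simp add: powr_half_sqrt)
    also have "(C * L * (s / 2) powr (- real n / 2)) * gauss_moment TYPE('d) 1 / (s / 2) powr (1 / 2)
        = C * L * gauss_moment TYPE('d) 1 * (s / 2) powr (- real n / 2 - 1 / 2)"
      by (simp add: powr_diff)
    also have "- real n / 2 - 1 / 2 = - real (Suc n) / 2"
      by simp
    also have "(s / 2) powr (- real (Suc n) / 2) = s powr (- real (Suc n) / 2) / 2 powr (- real (Suc n) / 2)"
      by (rule powr_divide)
    also have "\<dots> = s powr (- real (Suc n) / 2) * 2 powr (real (Suc n) / 2)"
      by (simp only: divide_powr_half)
    finally show "\<bar>heat_jet \<psi> l s x\<bar> \<le> ?C * L * s powr (- real (Suc n) / 2)"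
      by (simp add: mult_ac)
  qed
qed

section \<open>The chain and its Markov property\<close>

text \<open>A probability-preserving invertible map together with a law \<open>P\<close> of the two-sided chain that is
resampled with probability \<open>\<alpha>\<close>.\<close>

locale resampling_chain = invertible_pds M T for M :: "'a measure" and T +
  fixes \<alpha> :: real and P :: "(int \<Rightarrow> 'a) measure"
  assumes \<alpha>: "0 < \<alpha>" "\<alpha> < 1" and chain: "is_chain_measure M T \<alpha> P"
begin

sublocale P: prob_space P
  using chain by (simp add: is_chain_measure_def)

lemma sets_P [measurable_cong]: "sets P = sets (\<Pi>\<^sub>M i\<in>(UNIV::int set). M)"
  using chain by (simp add: is_chain_measure_def)

lemma space_P: "space P = (\<Pi>\<^sub>E i\<in>UNIV. space M)"
  using sets_eq_imp_space_eq[OF sets_P] by (simp add: space_PiM)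

lemma coord_space: "\<omega> \<in> space P \<Longrightarrow> \<omega> k \<in> space M"
  by (auto simp: space_P)

lemma T_space: "x \<in> space M \<Longrightarrow> T x \<in> space M"
  using measurable_space[OF measurable_T] .

lemma coord_measurable [measurable]: "(\<lambda>\<omega>. \<omega> k) \<in> P \<rightarrow>\<^sub>M M"
  by measurable

declare measurable_T [measurable]

lemma bdd_meas_T: "bdd_meas M f \<Longrightarrow> bdd_meas M (\<lambda>x. f (T x))"
  by (rule bdd_meas_compose[OF _ measurable_T])

lemma bdd_meas_coord: "bdd_meas M f \<Longrightarrow> bdd_meas P (\<lambda>\<omega>. f (\<omega> k))"
  by (rule bdd_meas_compose[OF _ coord_measurable])

lemmas bdd_meas_intros = bdd_meas_mult bdd_meas_add bdd_meas_diff bdd_meas_const bdd_meas_sum bdd_meas_T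
  bdd_meas_coord

lemma integral_T:
  fixes f :: "'a \<Rightarrow> real"
  assumes "f \<in> borel_measurable M" shows "(\<integral>x. f (T x) \<partial>M) = (\<integral>x. f x \<partial>M)"
proof -
  have "(\<integral>x. f x \<partial>M) = (\<integral>x. f x \<partial>distr M M T)" by (simp add: distr_T)
  also have "\<dots> = (\<integral>x. f (T x) \<partial>M)" by (rule integral_distr[OF measurable_T assms])
  finally show ?thesis by simp
qed

lemma AE_T: "AE x in M. Q x \<Longrightarrow> AE x in M. Q (T x)"
  by (rule AE_distrD[OF measurable_T]) (simp only: distr_T)

lemma integral_coord:
  assumes "bdd_meas M f" shows "(\<integral>\<omega>. f (\<omega> k) \<partial>P) = (\<integral>x. f x \<partial>M)"
  using chain assms by (simp add: is_chain_measure_def bdd_meas_def chain_coord_def)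

lemma distr_coord: "distr P M (\<lambda>\<omega>. \<omega> k) = M"
proof (rule measure_eqI)
  fix A assume "A \<in> sets (distr P M (\<lambda>\<omega>. \<omega> k))"
  then have A [measurable]: "A \<in> sets M" by simp
  have "bdd_meas M (indicator A)" by (auto simp: bdd_meas_def indicator_def)
  from integral_coord[OF this, of k]
  have "(\<integral>\<omega>. indicator A (\<omega> k) \<partial>P) = measure M A"
    by simp
  moreover have "(\<integral>\<omega>. indicator A (\<omega> k) \<partial>P) = (\<integral>x. (indicator A x :: real) \<partial>distr P M (\<lambda>\<omega>. \<omega> k))"
    by (subst integral_distr) auto
  moreover have "prob_space (distr P M (\<lambda>\<omega>. \<omega> k))" by (rule P.prob_space_distr) simp
  then interpret D: prob_space "distr P M (\<lambda>\<omega>. \<omega> k)" .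
  have "(\<integral>x. (indicator A x :: real) \<partial>distr P M (\<lambda>\<omega>. \<omega> k)) = measure (distr P M (\<lambda>\<omega>. \<omega> k)) A"
    by simp
  ultimately show "emeasure (distr P M (\<lambda>\<omega>. \<omega> k)) A = emeasure M A"
    by (simp add: D.emeasure_eq_measure emeasure_eq_measure)
qed simp

lemma AE_coord: "AE x in M. Q x \<Longrightarrow> AE \<omega> in P. Q (\<omega> k)"
  by (rule AE_distrD[OF coord_measurable]) (simp only: distr_coord)

lemma space_past: "space (past_algebra M n) = space P"
  unfolding past_algebra_def Let_def
  by (subst space_measure_of) (auto simp: space_P space_PiM)

lemma past_generators:
  "(\<Union>m\<in>{..n}. {chain_coord m -` A \<inter> space (\<Pi>\<^sub>M i\<in>(UNIV::int set). M) | A. A \<in> sets M}) \<subseteq> sets P"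
proof -
  have "chain_coord m -` A \<inter> space (\<Pi>\<^sub>M i\<in>(UNIV::int set). M) \<in> sets P" if "A \<in> sets M" for m A
  proof -
    have "(\<lambda>\<omega>. \<omega> m) -` A \<inter> space P \<in> sets P" using that by (rule measurable_sets[OF coord_measurable])
    moreover have "chain_coord m = (\<lambda>\<omega>. (\<omega>::int \<Rightarrow> 'a) m)" by (simp add: fun_eq_iff chain_coord_def)
    ultimately show ?thesis by (simp add: space_P space_PiM)
  qed
  then show ?thesis by auto
qed

lemma sets_past:
  "sets (past_algebra M n) = sigma_sets (space P)
     (\<Union>m\<in>{..n}. {chain_coord m -` A \<inter> space (\<Pi>\<^sub>M i\<in>(UNIV::int set). M) | A. A \<in> sets M})"
  unfolding past_algebra_def Let_def
  by (subst sets_measure_of) (auto simp: space_P space_PiM)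

lemma past_subalgebra: "subalgebra P (past_algebra M n)"
  unfolding subalgebra_def space_past sets_past
  by (intro conjI refl sets.sigma_sets_subset past_generators)

lemma coord_past: "m \<le> n \<Longrightarrow> (\<lambda>\<omega>. \<omega> m) \<in> past_algebra M n \<rightarrow>\<^sub>M M"
proof (rule measurableI)
  fix A assume "m \<le> n" and A: "A \<in> sets M"
  have "(\<lambda>\<omega>. \<omega> m) -` A \<inter> space (past_algebra M n) = chain_coord m -` A \<inter> space (\<Pi>\<^sub>M i\<in>(UNIV::int set). M)"
    by (auto simp: space_past space_P space_PiM chain_coord_def)
  moreover have "\<dots> \<in> sets (past_algebra M n)"
    unfolding sets_past using \<open>m \<le> n\<close> A by (intro sigma_sets.Basic) auto
  ultimately show "(\<lambda>\<omega>. \<omega> m) -` A \<inter> space (past_algebra M n) \<in> sets (past_algebra M n)" by simp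
qed (auto simp: space_past coord_space)

lemma integrable_bounded_P:
  fixes F :: "(int \<Rightarrow> 'a) \<Rightarrow> real"
  assumes "F \<in> borel_measurable P" "\<And>\<omega>. \<omega> \<in> space P \<Longrightarrow> \<bar>F \<omega>\<bar> \<le> B"
  shows "integrable P F"
  using assms by (intro P.integrable_const_bound[where B=B] AE_I2) auto

lemma expectation_bound_P:
  fixes F :: "(int \<Rightarrow> 'a) \<Rightarrow> real"
  assumes "F \<in> borel_measurable P" "\<And>\<omega>. \<omega> \<in> space P \<Longrightarrow> \<bar>F \<omega>\<bar> \<le> B"
  shows "\<bar>\<integral>\<omega>. F \<omega> \<partial>P\<bar> \<le> B"
proof -
  have "\<bar>\<integral>\<omega>. F \<omega> \<partial>P\<bar> \<le> (\<integral>\<omega>. \<bar>F \<omega>\<bar> \<partial>P)" by (rule integral_abs_bound)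
  also have "\<dots> \<le> B"
    using integrable_bounded_P[OF assms] assms(2) by (intro P.integral_le_const AE_I2) auto
  finally show ?thesis .
qed

text \<open>The Markov property, tested against a bounded function of the past.\<close>

lemma markov_property:
  assumes g: "g \<in> borel_measurable (past_algebra M k)" "\<And>\<omega>. \<omega> \<in> space P \<Longrightarrow> \<bar>g \<omega>\<bar> \<le> B"
    and f: "bdd_meas M f"
  shows "(\<integral>\<omega>. g \<omega> * f (\<omega> (k + 1)) \<partial>P)
    = (\<integral>\<omega>. g \<omega> * ((1 - \<alpha>) * f (T (\<omega> k)) + \<alpha> * (\<integral>x. f x \<partial>M)) \<partial>P)"
proof -
  interpret F: finite_measure_subalgebra P "past_algebra M k"
    by standard (rule past_subalgebra)
  obtain C where fm [measurable]: "f \<in> borel_measurable M" and C: "\<And>x. x \<in> space M \<Longrightarrow> \<bar>f x\<bar> \<le> C"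
    using f by (auto simp: bdd_meas_def)
  have gP [measurable]: "g \<in> borel_measurable P"
    by (rule measurable_from_subalg[OF past_subalgebra g(1)])
  have int: "integrable P (\<lambda>\<omega>. g \<omega> * f (\<omega> (k + 1)))"
  proof (rule integrable_bounded_P[where B="\<bar>B\<bar> * \<bar>C\<bar>"])
    fix \<omega> assume \<omega>: "\<omega> \<in> space P"
    then show "\<bar>g \<omega> * f (\<omega> (k + 1))\<bar> \<le> \<bar>B\<bar> * \<bar>C\<bar>"
      unfolding abs_mult using g(2)[OF \<omega>] C[OF coord_space[OF \<omega>], of "k + 1"] by (intro mult_mono) auto
  qed measurable
  have "AE \<omega> in P. real_cond_exp P (past_algebra M k) (\<lambda>\<omega>. f (\<omega> (k + 1))) \<omega>
      = (1 - \<alpha>) * f (T (\<omega> k)) + \<alpha> * (\<integral>x. f x \<partial>M)"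
    using chain f by (simp add: is_chain_measure_def bdd_meas_def chain_coord_def)
  then have "(\<integral>\<omega>. g \<omega> * real_cond_exp P (past_algebra M k) (\<lambda>\<omega>. f (\<omega> (k + 1))) \<omega> \<partial>P)
      = (\<integral>\<omega>. g \<omega> * ((1 - \<alpha>) * f (T (\<omega> k)) + \<alpha> * (\<integral>x. f x \<partial>M)) \<partial>P)"
    by (intro integral_cong_AE) auto
  then show ?thesis
    using F.real_cond_exp_intg(2)[OF int g(1)] by simp
qed

end

section \<open>Martingale increments and mixing\<close>

lemma borel_measurable_vec_lambda [measurable]:
  fixes f :: "'d::finite \<Rightarrow> 'a \<Rightarrow> real"
  assumes "\<And>i. f i \<in> borel_measurable N"
  shows "(\<lambda>x. \<chi> i. f i x) \<in> borel_measurable N"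
proof (subst borel_measurable_euclidean_space, rule ballI)
  fix b :: "real^'d" assume "b \<in> Basis"
  then obtain i where "b = axis i 1" by (auto simp: Basis_vec_def)
  then have "(\<lambda>x. (\<chi> i. f i x) \<bullet> b) = f i" by (auto simp: inner_axis)
  then show "(\<lambda>x. (\<chi> i. f i x) \<bullet> b) \<in> borel_measurable N" using assms by simp
qed

text \<open>A bounded centred observable \<open>e\<close> whose martingale increments have the identity covariance on the
coordinates in \<open>J\<close> and vanishing variance on the others.\<close>

locale observed_chain = resampling_chain M T \<alpha> P
  for M :: "'a measure" and T \<alpha> P +
  fixes e :: "'d::finite \<Rightarrow> 'a \<Rightarrow> real" and J :: "'d set" and C :: real
  assumes e_meas [measurable]: "\<And>i. e i \<in> borel_measurable M"
    and e_bound: "\<And>i x. x \<in> space M \<Longrightarrow> \<bar>e i x\<bar> \<le> C"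
    and e_centred: "\<And>i. (\<integral>x. e i x \<partial>M) = 0"
    and e_cov: "\<And>i j. (1 - (1 - \<alpha>)\<^sup>2) * (\<integral>x. e i x * e j x \<partial>M) = (if i = j \<and> i \<in> J then 1 else 0)"
begin

text \<open>The coordinates of the increments \<open>e (X (k + 1)) - E[e (X (k + 1)) | X k]\<close>; as \<open>e\<close> is centred, the
conditional mean is \<open>(1 - \<alpha>) e (T (X k))\<close>.\<close>

definition xi :: "nat \<Rightarrow> 'd \<Rightarrow> (int \<Rightarrow> 'a) \<Rightarrow> real" where
  "xi k i \<omega> = e i (\<omega> (int k + 1)) - (1 - \<alpha>) * e i (T (\<omega> (int k)))"

text \<open>The martingale: the sum of the first \<open>k\<close> increments.\<close>

definition S :: "nat \<Rightarrow> (int \<Rightarrow> 'a) \<Rightarrow> real^'d" where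
  "S k \<omega> = (\<chi> i. \<Sum>j<k. xi j i \<omega>)"

text \<open>A bound for the \<open>\<ell>\<^sup>1\<close> norm of an increment.\<close>

definition R :: real where "R = real CARD('d) * (2 * C)"

lemma e_bdd: "bdd_meas M (e i)"
  using e_bound by (auto simp: bdd_meas_def)

lemma C_nonneg: "0 \<le> C"
proof -
  obtain x where "x \<in> space M" using not_empty by auto
  from e_bound[OF this, of undefined] show ?thesis by linarith
qed

lemma R_nonneg: "0 \<le> R"
  using C_nonneg by (simp add: R_def)

lemma xi_measurable [measurable]: "xi k i \<in> borel_measurable P"
  unfolding xi_def[abs_def] by measurable

lemma xi_bound:
  assumes "\<omega> \<in> space P" shows "\<bar>xi k i \<omega>\<bar> \<le> 2 * C"
proof -
  have "\<bar>xi k i \<omega>\<bar> \<le> \<bar>e i (\<omega> (int k + 1))\<bar> + (1 - \<alpha>) * \<bar>e i (T (\<omega> (int k)))\<bar>"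
    using \<alpha> unfolding xi_def by (intro order_trans[OF abs_triangle_ineq4]) (simp add: abs_mult)
  also have "\<dots> \<le> C + 1 * C"
    using \<alpha> e_bound coord_space[OF assms] T_space C_nonneg
    by (intro add_mono mult_mono) auto
  finally show ?thesis by simp
qed

lemma xi_l1: "\<omega> \<in> space P \<Longrightarrow> (\<Sum>i\<in>UNIV. \<bar>xi k i \<omega>\<bar>) \<le> R"
  using sum_bounded_above[of UNIV "\<lambda>i. \<bar>xi k i \<omega>\<bar>" "2 * C"] xi_bound by (simp add: R_def)

lemma xi_bdd: "bdd_meas P (xi k i)"
  using xi_bound by (auto simp: bdd_meas_def)

lemma S_0 [simp]: "S 0 \<omega> = 0"
  by (simp add: S_def vec_eq_iff)

lemma S_Suc: "S (Suc k) \<omega> = S k \<omega> + (\<chi> i. xi k i \<omega>)"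
  by (simp add: S_def vec_eq_iff)

lemma S_past: "S k \<in> borel_measurable (past_algebra M (int k))"
  unfolding S_def[abs_def]
proof (intro borel_measurable_vec_lambda borel_measurable_sum)
  fix i j assume "j \<in> {..<k}"
  then have [measurable]: "(\<lambda>\<omega>. \<omega> (int j)) \<in> past_algebra M (int k) \<rightarrow>\<^sub>M M"
     "(\<lambda>\<omega>. \<omega> (int j + 1)) \<in> past_algebra M (int k) \<rightarrow>\<^sub>M M"
    by (auto intro!: coord_past)
  show "xi j i \<in> borel_measurable (past_algebra M (int k))"
    unfolding xi_def[abs_def] by measurable
qed

lemma S_measurable [measurable]: "S k \<in> borel_measurable P"
  by (rule measurable_from_subalg[OF past_subalgebra S_past])

lemma bdd_meas_S: "bdd_borel g \<Longrightarrow> bdd_meas P (\<lambda>\<omega>. g (S k \<omega>))"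
  by (rule bdd_meas_compose[OF _ S_measurable])

lemma bdd_meas_prod_xi: "bdd_meas P (\<lambda>\<omega>. \<Prod>i\<leftarrow>l. xi k i \<omega>)"
  by (induction l) (auto intro!: bdd_meas_const bdd_meas_mult xi_bdd)

text \<open>Conditioning on the past turns a product of increments into a function \<open>w\<close> of the current
state, the same for all times \<open>k\<close> and all test functions \<open>g\<close>.\<close>

lemma condition_increments:
  assumes "f1 \<in> borel_measurable M" "f2 \<in> borel_measurable M"
    "\<And>x. x \<in> space M \<Longrightarrow> \<bar>f1 x\<bar> \<le> B1" "\<And>x. x \<in> space M \<Longrightarrow> \<bar>f2 x\<bar> \<le> B2" "0 \<le> B1" "0 \<le> B2"
  shows "\<exists>w\<in>borel_measurable M. (\<forall>x\<in>space M. \<bar>w x\<bar> \<le> (2 * C) ^ length l * (B1 * B2)) \<and>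
    (\<forall>k g. bdd_borel g \<longrightarrow>
       (\<integral>\<omega>. g (S k \<omega>) * (\<Prod>i\<leftarrow>l. xi k i \<omega>) * f1 (\<omega> (int k)) * f2 (\<omega> (int k + 1)) \<partial>P)
         = (\<integral>\<omega>. g (S k \<omega>) * w (\<omega> (int k)) \<partial>P))"
  using assms
proof (induction l arbitrary: f1 f2 B1 B2)
  case Nil
  note [measurable] = Nil(1,2)
  have b2: "bdd_meas M f2" and b1: "bdd_meas M f1" using Nil by (auto simp: bdd_meas_def)
  let ?w = "\<lambda>x. f1 x * ((1 - \<alpha>) * f2 (T x) + \<alpha> * (\<integral>x. f2 x \<partial>M))"
  have I: "\<bar>\<integral>x. f2 x \<partial>M\<bar> \<le> B2"
  proof -
    have "\<bar>\<integral>x. f2 x \<partial>M\<bar> \<le> (\<integral>x. \<bar>f2 x\<bar> \<partial>M)" by (rule integral_abs_bound)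
    also have "\<dots> \<le> B2"
      using bdd_meas_integrable[OF b2] Nil(4) by (intro integral_le_const AE_I2) auto
    finally show ?thesis .
  qed
  show ?case
  proof (intro bexI[of _ ?w] conjI ballI allI impI)
    fix x assume x: "x \<in> space M"
    have "\<bar>(1 - \<alpha>) * f2 (T x) + \<alpha> * (\<integral>x. f2 x \<partial>M)\<bar> \<le> (1 - \<alpha>) * \<bar>f2 (T x)\<bar> + \<alpha> * \<bar>\<integral>x. f2 x \<partial>M\<bar>"
      using \<alpha> by (intro order_trans[OF abs_triangle_ineq]) (simp add: abs_mult)
    also have "\<dots> \<le> (1 - \<alpha>) * B2 + \<alpha> * B2"
      using \<alpha> I Nil(4)[OF T_space[OF x]] by (intro add_mono mult_left_mono) auto
    finally have "\<bar>(1 - \<alpha>) * f2 (T x) + \<alpha> * (\<integral>x. f2 x \<partial>M)\<bar> \<le> B2" by (simp add: algebra_simps)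
    then show "\<bar>?w x\<bar> \<le> (2 * C) ^ length [] * (B1 * B2)"
      using Nil(3)[OF x] Nil(5,6) by (simp add: abs_mult mult_mono)
  next
    fix k and g :: "real^'d \<Rightarrow> real" assume g: "bdd_borel g"
    have [measurable]: "g \<in> borel_measurable borel" using g by (simp add: bdd_meas_def)
    have b: "bdd_meas P (\<lambda>\<omega>. g (S k \<omega>) * f1 (\<omega> (int k)))"
      by (intro bdd_meas_mult bdd_meas_S g bdd_meas_coord b1)
    then obtain B where B: "\<And>\<omega>. \<omega> \<in> space P \<Longrightarrow> \<bar>g (S k \<omega>) * f1 (\<omega> (int k))\<bar> \<le> B"
      by (auto simp: bdd_meas_def)
    have [measurable]: "(\<lambda>\<omega>. \<omega> (int k)) \<in> past_algebra M (int k) \<rightarrow>\<^sub>M M" by (rule coord_past) simp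
    note S_past[measurable]
    have "(\<lambda>\<omega>. g (S k \<omega>) * f1 (\<omega> (int k))) \<in> borel_measurable (past_algebra M (int k))"
      by measurable
    from markov_property[OF this B b2]
    show "(\<integral>\<omega>. g (S k \<omega>) * (\<Prod>i\<leftarrow>[]. xi k i \<omega>) * f1 (\<omega> (int k)) * f2 (\<omega> (int k + 1)) \<partial>P)
         = (\<integral>\<omega>. g (S k \<omega>) * ?w (\<omega> (int k)) \<partial>P)"
      by (simp add: mult.assoc)
  qed measurable
next
  case (Cons i l)
  note [measurable] = Cons.prems(1,2)
  have b1: "bdd_meas M f1" and b2: "bdd_meas M f2" using Cons.prems by (auto simp: bdd_meas_def)
  have A: "\<bar>e i x * f2 x\<bar> \<le> C * B2" if "x \<in> space M" for x
    using that e_bound[OF that, of i] Cons.prems(4)[OF that] C_nonneg by (simp add: abs_mult mult_mono)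
  obtain w1 where w1 [measurable]: "w1 \<in> borel_measurable M"
    and w1b: "\<And>x. x \<in> space M \<Longrightarrow> \<bar>w1 x\<bar> \<le> (2 * C) ^ length l * (B1 * (C * B2))"
    and w1e: "\<And>k g. bdd_borel g \<Longrightarrow> 
       (\<integral>\<omega>. g (S k \<omega>) * (\<Prod>i\<leftarrow>l. xi k i \<omega>) * f1 (\<omega> (int k)) * (e i (\<omega> (int k + 1)) * f2 (\<omega> (int k + 1))) \<partial>P)
         = (\<integral>\<omega>. g (S k \<omega>) * w1 (\<omega> (int k)) \<partial>P)"
    using Cons.IH[of f1 "\<lambda>x. e i x * f2 x" B1 "C * B2"] Cons.prems A C_nonneg by auto
  have A': "\<bar>(1 - \<alpha>) * e i (T x) * f1 x\<bar> \<le> C * B1" if "x \<in> space M" for x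
  proof -
    have "\<bar>(1 - \<alpha>) * e i (T x)\<bar> \<le> 1 * C"
      using \<alpha> e_bound[OF T_space[OF that], of i] C_nonneg unfolding abs_mult by (intro mult_mono) auto
    then show ?thesis
      using Cons.prems(3)[OF that] C_nonneg unfolding abs_mult[of _ "f1 x"] by (intro mult_mono) auto
  qed
  obtain w2 where w2 [measurable]: "w2 \<in> borel_measurable M"
    and w2b: "\<And>x. x \<in> space M \<Longrightarrow> \<bar>w2 x\<bar> \<le> (2 * C) ^ length l * ((C * B1) * B2)"
    and w2e: "\<And>k g. bdd_borel g \<Longrightarrow> 
       (\<integral>\<omega>. g (S k \<omega>) * (\<Prod>i\<leftarrow>l. xi k i \<omega>) * ((1 - \<alpha>) * e i (T (\<omega> (int k))) * f1 (\<omega> (int k))) * f2 (\<omega> (int k + 1)) \<partial>P)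
         = (\<integral>\<omega>. g (S k \<omega>) * w2 (\<omega> (int k)) \<partial>P)"
    using Cons.IH[of "\<lambda>x. (1 - \<alpha>) * e i (T x) * f1 x" f2 "C * B1" B2] Cons.prems A' C_nonneg by auto
  have bw: "bdd_meas M w1" "bdd_meas M w2" using w1 w2 w1b w2b by (auto simp: bdd_meas_def)
  show ?case
  proof (intro bexI[of _ "\<lambda>x. w1 x - w2 x"] conjI ballI allI impI)
    fix x assume x: "x \<in> space M"
    show "\<bar>w1 x - w2 x\<bar> \<le> (2 * C) ^ length (i # l) * (B1 * B2)"
      using abs_triangle_ineq4[of "w1 x" "w2 x"] w1b[OF x] w2b[OF x] by (simp add: mult_ac)
  next
    fix k and g :: "real^'d \<Rightarrow> real" assume g: "bdd_borel g"
    let ?A = "\<lambda>\<omega>. g (S k \<omega>) * (\<Prod>i\<leftarrow>l. xi k i \<omega>) * f1 (\<omega> (int k)) * (e i (\<omega> (int k + 1)) * f2 (\<omega> (int k + 1)))"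
    let ?B = "\<lambda>\<omega>. g (S k \<omega>) * (\<Prod>i\<leftarrow>l. xi k i \<omega>) * ((1 - \<alpha>) * e i (T (\<omega> (int k))) * f1 (\<omega> (int k))) * f2 (\<omega> (int k + 1))"
    have iA: "integrable P ?A"
      by (intro P.bdd_meas_integrable bdd_meas_mult bdd_meas_S g bdd_meas_prod_xi bdd_meas_coord b1 b2 e_bdd)
    have iB: "integrable P ?B"
      by (intro P.bdd_meas_integrable bdd_meas_mult bdd_meas_S g bdd_meas_prod_xi bdd_meas_coord[of f1]
          bdd_meas_coord[of f2] b1 b2 bdd_meas_const bdd_meas_coord[of "\<lambda>x. e i (T x)"] bdd_meas_T e_bdd)
    have "(\<integral>\<omega>. g (S k \<omega>) * (\<Prod>i\<leftarrow>i # l. xi k i \<omega>) * f1 (\<omega> (int k)) * f2 (\<omega> (int k + 1)) \<partial>P)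
        = (\<integral>\<omega>. ?A \<omega> - ?B \<omega> \<partial>P)"
      by (intro Bochner_Integration.integral_cong refl) (simp add: xi_def algebra_simps)
    also have "\<dots> = (\<integral>\<omega>. g (S k \<omega>) * w1 (\<omega> (int k)) \<partial>P) - (\<integral>\<omega>. g (S k \<omega>) * w2 (\<omega> (int k)) \<partial>P)"
      using iA iB w1e[OF g] w2e[OF g] by simp
    also have "\<dots> = (\<integral>\<omega>. g (S k \<omega>) * (w1 (\<omega> (int k)) - w2 (\<omega> (int k))) \<partial>P)"
      by (subst Bochner_Integration.integral_diff[symmetric])
         (auto intro!: P.bdd_meas_integrable bdd_meas_mult bdd_meas_S g bdd_meas_coord bw simp: right_diff_distrib)
    finally show "(\<integral>\<omega>. g (S k \<omega>) * (\<Prod>i\<leftarrow>i # l. xi k i \<omega>) * f1 (\<omega> (int k)) * f2 (\<omega> (int k + 1)) \<partial>P)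
        = (\<integral>\<omega>. g (S k \<omega>) * (w1 (\<omega> (int k)) - w2 (\<omega> (int k))) \<partial>P)" .
  qed measurable
qed

lemma condition_next:
  assumes g: "bdd_borel g" and f: "bdd_meas M f"
  shows "(\<integral>\<omega>. g (S k \<omega>) * f (\<omega> (int k + 1)) \<partial>P)
    = (1 - \<alpha>) * (\<integral>\<omega>. g (S k \<omega>) * f (T (\<omega> (int k))) \<partial>P) + \<alpha> * (\<integral>x. f x \<partial>M) * (\<integral>\<omega>. g (S k \<omega>) \<partial>P)"
proof -
  have [measurable]: "g \<in> borel_measurable borel" using g by (simp add: bdd_meas_def)
  obtain B where B: "\<And>\<omega>. \<bar>g (S k \<omega>)\<bar> \<le> B"
    using g by (auto simp: bdd_meas_def)
  note S_past[measurable]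
  have "(\<lambda>\<omega>. g (S k \<omega>)) \<in> borel_measurable (past_algebra M (int k))" by measurable
  from markov_property[OF this B f]
  have "(\<integral>\<omega>. g (S k \<omega>) * f (\<omega> (int k + 1)) \<partial>P)
     = (\<integral>\<omega>. (1 - \<alpha>) * (g (S k \<omega>) * f (T (\<omega> (int k)))) + \<alpha> * (\<integral>x. f x \<partial>M) * g (S k \<omega>) \<partial>P)"
    by (simp add: algebra_simps)
  also have "\<dots> = (1 - \<alpha>) * (\<integral>\<omega>. g (S k \<omega>) * f (T (\<omega> (int k))) \<partial>P) + \<alpha> * (\<integral>x. f x \<partial>M) * (\<integral>\<omega>. g (S k \<omega>) \<partial>P)"
  proof -
    have "integrable P (\<lambda>\<omega>. g (S k \<omega>) * f (T (\<omega> (int k))))"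
      by (intro P.bdd_meas_integrable bdd_meas_mult bdd_meas_S g bdd_meas_coord[of "\<lambda>x. f (T x)"] bdd_meas_T f)
    moreover have "integrable P (\<lambda>\<omega>. g (S k \<omega>))"
      by (intro P.bdd_meas_integrable bdd_meas_S g)
    ultimately show ?thesis by simp
  qed
  finally show ?thesis .
qed

lemma increment_centred:
  assumes g: "bdd_borel g"
  shows "(\<integral>\<omega>. g (S k \<omega>) * xi k i \<omega> \<partial>P) = 0"
proof -
  have "integrable P (\<lambda>\<omega>. g (S k \<omega>) * e i (\<omega> (int k + 1)))"
    by (intro P.bdd_meas_integrable bdd_meas_mult bdd_meas_S g bdd_meas_coord e_bdd)
  moreover have "integrable P (\<lambda>\<omega>. g (S k \<omega>) * e i (T (\<omega> (int k))))"
    by (intro P.bdd_meas_integrable bdd_meas_mult bdd_meas_S g bdd_meas_coord[of "\<lambda>x. e i (T x)"] bdd_meas_T e_bdd)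
  moreover have "g (S k \<omega>) * xi k i \<omega> = g (S k \<omega>) * e i (\<omega> (int k + 1)) - (1 - \<alpha>) * (g (S k \<omega>) * e i (T (\<omega> (int k))))" for \<omega>
    by (simp add: xi_def algebra_simps)
  ultimately show ?thesis
    using condition_next[OF g e_bdd, of k i] by (simp add: e_centred)
qed

text \<open>A centred function of the current state is nearly uncorrelated with a Lipschitz function \<open>g\<close> of
the martingale.  Replacing \<open>S (k + 1)\<close> by \<open>S k\<close> costs \<open>R \<Lambda> B\<close>; conditioning then turns \<open>f\<close> into
\<open>(1 - \<alpha>) f \<circ> T\<close>, and iterating gives a geometric series.\<close>

lemma mixing_lipschitz:
  assumes g: "bdd_borel g" and lip: "\<And>x y. \<bar>g (x + y) - g x\<bar> \<le> (\<Sum>i\<in>UNIV. \<bar>y $ i\<bar>) * \<Lambda>" and "0 \<le> \<Lambda>"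
    and f: "f \<in> borel_measurable M" "\<And>x. x \<in> space M \<Longrightarrow> \<bar>f x\<bar> \<le> B" "(\<integral>x. f x \<partial>M) = 0"
  shows "\<bar>\<integral>\<omega>. g (S k \<omega>) * f (\<omega> (int k)) \<partial>P\<bar> \<le> R * \<Lambda> * B / \<alpha>"
  using f
proof (induction k arbitrary: f)
  case 0
  have "bdd_meas M f" using 0 by (auto simp: bdd_meas_def)
  from integral_coord[OF this, of 0] have "(\<integral>\<omega>. f (\<omega> 0) \<partial>P) = 0" using 0 by simp
  moreover obtain x where "x \<in> space M" using not_empty by auto
  then have "0 \<le> B" using 0(2) by fastforce
  ultimately show ?case using \<open>0 \<le> \<Lambda>\<close> R_nonneg \<alpha> by simp
next
  case (Suc k)
  note [measurable] = Suc.prems(1)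
  have fb: "bdd_meas M f" using Suc.prems by (auto simp: bdd_meas_def)
  have [measurable]: "g \<in> borel_measurable borel" using g by (simp add: bdd_meas_def)
  let ?D = "\<lambda>\<omega>. (g (S (Suc k) \<omega>) - g (S k \<omega>)) * f (\<omega> (int k + 1))"
  have D: "\<bar>\<integral>\<omega>. ?D \<omega> \<partial>P\<bar> \<le> R * \<Lambda> * B"
  proof (rule expectation_bound_P)
    fix \<omega> assume \<omega>: "\<omega> \<in> space P"
    have "\<bar>g (S (Suc k) \<omega>) - g (S k \<omega>)\<bar> \<le> (\<Sum>i\<in>UNIV. \<bar>xi k i \<omega>\<bar>) * \<Lambda>"
      unfolding S_Suc using lip[of "S k \<omega>" "\<chi> i. xi k i \<omega>"] by simp
    also have "\<dots> \<le> R * \<Lambda>" using xi_l1[OF \<omega>] \<open>0 \<le> \<Lambda>\<close> by (intro mult_right_mono) auto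
    finally show "\<bar>?D \<omega>\<bar> \<le> R * \<Lambda> * B"
      unfolding abs_mult using Suc.prems(2)[OF coord_space[OF \<omega>]] \<open>0 \<le> \<Lambda>\<close> R_nonneg
      by (intro mult_mono) auto
  qed measurable
  have "(\<integral>\<omega>. g (S (Suc k) \<omega>) * f (\<omega> (int (Suc k))) \<partial>P) = (\<integral>\<omega>. ?D \<omega> + g (S k \<omega>) * f (\<omega> (int k + 1)) \<partial>P)"
    by (intro Bochner_Integration.integral_cong refl) (simp add: algebra_simps)
  also have "\<dots> = (\<integral>\<omega>. ?D \<omega> \<partial>P) + (\<integral>\<omega>. g (S k \<omega>) * f (\<omega> (int k + 1)) \<partial>P)"
    by (intro Bochner_Integration.integral_add P.bdd_meas_integrable bdd_meas_mult bdd_meas_diff bdd_meas_S g bdd_meas_coord fb)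
  also have "(\<integral>\<omega>. g (S k \<omega>) * f (\<omega> (int k + 1)) \<partial>P) = (1 - \<alpha>) * (\<integral>\<omega>. g (S k \<omega>) * f (T (\<omega> (int k))) \<partial>P)"
    using condition_next[OF g fb] Suc.prems(3) by simp
  also have "\<bar>(\<integral>\<omega>. ?D \<omega> \<partial>P) + (1 - \<alpha>) * (\<integral>\<omega>. g (S k \<omega>) * f (T (\<omega> (int k))) \<partial>P)\<bar>
     \<le> R * \<Lambda> * B + (1 - \<alpha>) * (R * \<Lambda> * B / \<alpha>)"
  proof -
    have "\<bar>\<integral>\<omega>. g (S k \<omega>) * f (T (\<omega> (int k))) \<partial>P\<bar> \<le> R * \<Lambda> * B / \<alpha>"
      by (rule Suc.IH[of "\<lambda>x. f (T x)"])
         (use Suc.prems T_space integral_T[of f] in auto)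
    then have "\<bar>(1 - \<alpha>) * (\<integral>\<omega>. g (S k \<omega>) * f (T (\<omega> (int k))) \<partial>P)\<bar> \<le> (1 - \<alpha>) * (R * \<Lambda> * B / \<alpha>)"
      unfolding abs_mult using \<alpha> by (intro mult_mono) auto
    with D show ?thesis by (intro order_trans[OF abs_triangle_ineq] add_mono)
  qed
  also have "\<dots> = R * \<Lambda> * B / \<alpha>" using \<alpha> by (simp add: field_simps)
  finally show ?case .
qed

lemma jet_lipschitz:
  assumes "jet G" "\<And>l' x. length l' = Suc (length l) \<Longrightarrow> \<bar>G l' x\<bar> \<le> b" "0 \<le> b"
  shows "\<bar>G l (x + y) - G l x\<bar> \<le> (\<Sum>i\<in>UNIV. \<bar>y $ i\<bar>) * b"
  using jet_taylor[OF assms(1), of 1 l b x y] assms(2,3) by simp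

text \<open>A bounded factor depending on the current state may be replaced by its mean.\<close>

lemma decouple:
  assumes J: "jet G" and b: "\<And>l' x. length l' = Suc (length l) \<Longrightarrow> \<bar>G l' x\<bar> \<le> b" "0 \<le> b"
    and w: "w \<in> borel_measurable M" "\<And>x. x \<in> space M \<Longrightarrow> \<bar>w x\<bar> \<le> B"
  shows "\<bar>(\<integral>\<omega>. G l (S k \<omega>) * w (\<omega> (int k)) \<partial>P) - (\<integral>x. w x \<partial>M) * (\<integral>\<omega>. G l (S k \<omega>) \<partial>P)\<bar> \<le> R * b * (2 * B) / \<alpha>"
    and "\<bar>\<integral>x. w x \<partial>M\<bar> \<le> B"
proof -
  have wb: "bdd_meas M w" using w by (auto simp: bdd_meas_def)
  have g: "bdd_borel (G l)" using J by (simp add: jet_def)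
  show I: "\<bar>\<integral>x. w x \<partial>M\<bar> \<le> B"
  proof -
    have "\<bar>\<integral>x. w x \<partial>M\<bar> \<le> (\<integral>x. \<bar>w x\<bar> \<partial>M)" by (rule integral_abs_bound)
    also have "\<dots> \<le> B"
      using bdd_meas_integrable[OF wb] w by (intro integral_le_const AE_I2) auto
    finally show ?thesis .
  qed
  let ?m = "\<integral>x. w x \<partial>M"
  have "\<bar>\<integral>\<omega>. G l (S k \<omega>) * (w (\<omega> (int k)) - ?m) \<partial>P\<bar> \<le> R * b * (2 * B) / \<alpha>"
  proof (rule mixing_lipschitz[OF g jet_lipschitz[OF J b] \<open>0 \<le> b\<close>])
    show "(\<lambda>x. w x - ?m) \<in> borel_measurable M" using w by simp
    show "\<bar>w x - ?m\<bar> \<le> 2 * B" if "x \<in> space M" for x using w(2)[OF that] I by linarith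
    show "(\<integral>x. w x - ?m \<partial>M) = 0" using bdd_meas_integrable[OF wb] prob_space by simp
  qed
  moreover have "(\<integral>\<omega>. G l (S k \<omega>) * (w (\<omega> (int k)) - ?m) \<partial>P) = (\<integral>\<omega>. G l (S k \<omega>) * w (\<omega> (int k)) - ?m * G l (S k \<omega>) \<partial>P)"
    by (simp add: algebra_simps)
  moreover have "\<dots> = (\<integral>\<omega>. G l (S k \<omega>) * w (\<omega> (int k)) \<partial>P) - ?m * (\<integral>\<omega>. G l (S k \<omega>) \<partial>P)"
  proof -
    have "integrable P (\<lambda>\<omega>. G l (S k \<omega>) * w (\<omega> (int k)))"
      by (intro P.bdd_meas_integrable bdd_meas_mult bdd_meas_S g bdd_meas_coord wb)
    moreover have "integrable P (\<lambda>\<omega>. G l (S k \<omega>))"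
      by (intro P.bdd_meas_integrable bdd_meas_S g)
    ultimately show ?thesis by simp
  qed
  ultimately show "\<bar>(\<integral>\<omega>. G l (S k \<omega>) * w (\<omega> (int k)) \<partial>P) - ?m * (\<integral>\<omega>. G l (S k \<omega>) \<partial>P)\<bar> \<le> R * b * (2 * B) / \<alpha>"
    by simp
qed

end

context observed_chain
begin

lemma condition_increments_unit:
  assumes f: "f \<in> borel_measurable M" "\<And>x. x \<in> space M \<Longrightarrow> \<bar>f x\<bar> \<le> B" "0 \<le> B"
  obtains w where "w \<in> borel_measurable M" "\<And>x. x \<in> space M \<Longrightarrow> \<bar>w x\<bar> \<le> (2 * C) ^ length l * B"
    "\<And>k g. bdd_borel g \<Longrightarrow> (\<integral>\<omega>. g (S k \<omega>) * (\<Prod>i\<leftarrow>l. xi k i \<omega>) * f (\<omega> (int k + 1)) \<partial>P)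
         = (\<integral>\<omega>. g (S k \<omega>) * w (\<omega> (int k)) \<partial>P)"
  using condition_increments[of "\<lambda>_. 1" f 1 B l] f by auto

text \<open>The contribution of a product of increments, weighted by a jet, up to the first-order error
  of decoupling.\<close>

lemma increments_bound:
  assumes G: "jet G" and b: "\<And>l' x. length l' = Suc (length l) \<Longrightarrow> \<bar>G l' x\<bar> \<le> b" "0 \<le> b"
    and f: "f \<in> borel_measurable M" "\<And>x. x \<in> space M \<Longrightarrow> \<bar>f x\<bar> \<le> B" "0 \<le> B"
    and m: "\<bar>\<integral>\<omega>. G l (S k \<omega>) \<partial>P\<bar> \<le> m"
  shows "\<bar>\<integral>\<omega>. G l (S k \<omega>) * (\<Prod>i\<leftarrow>l'. xi k i \<omega>) * f (\<omega> (int k + 1)) \<partial>P\<bar>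
    \<le> (2 * C) ^ length l' * B * (m + 2 * R * b / \<alpha>)"
proof -
  let ?K = "(2 * C) ^ length l' * B"
  obtain w where w: "w \<in> borel_measurable M" "\<And>x. x \<in> space M \<Longrightarrow> \<bar>w x\<bar> \<le> ?K"
    and eq: "\<And>k g. bdd_borel g \<Longrightarrow> (\<integral>\<omega>. g (S k \<omega>) * (\<Prod>i\<leftarrow>l'. xi k i \<omega>) * f (\<omega> (int k + 1)) \<partial>P)
         = (\<integral>\<omega>. g (S k \<omega>) * w (\<omega> (int k)) \<partial>P)"
    using condition_increments_unit[OF f, of l'] by blast
  have g: "bdd_borel (G l)" using G by (simp add: jet_def)
  have K0: "0 \<le> ?K" using C_nonneg f(3) by simp
  note d1 = decouple(1)[where l=l and k=k, OF G b w] and d2 = decouple(2)[where l=l, OF G b w]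
  have "\<bar>(\<integral>x. w x \<partial>M) * (\<integral>\<omega>. G l (S k \<omega>) \<partial>P)\<bar> \<le> ?K * m"
    unfolding abs_mult using d2 m K0 by (intro mult_mono) auto
  with d1 have "\<bar>\<integral>\<omega>. G l (S k \<omega>) * w (\<omega> (int k)) \<partial>P\<bar> \<le> R * b * (2 * ?K) / \<alpha> + ?K * m"
    by linarith
  also have "\<dots> = ?K * (m + 2 * R * b / \<alpha>)" by (simp add: algebra_simps)
  finally show ?thesis unfolding eq[OF g] .
qed

lemma geometric_shift:
  fixes m :: "nat \<Rightarrow> real"
  shows "(\<Sum>i<Suc k. (1 - \<alpha>) ^ i * m (Suc k - 1 - i)) = m k + (1 - \<alpha>) * (\<Sum>i<k. (1 - \<alpha>) ^ i * m (k - 1 - i))"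
  by (subst sum.lessThan_Suc_shift) (simp add: sum_distrib_left mult.assoc)

text \<open>The recursion of \<open>mixing_lipschitz\<close> with one more term in the expansion of \<open>G\<close>: the error is now
of second order, up to the means of first derivatives, whose bounds \<open>m j\<close> are kept explicitly.\<close>

lemma mixing_jet:
  "\<exists>K\<ge>0. \<forall>G b m f B k. jet G \<longrightarrow> (\<forall>l x. length l = 2 \<longrightarrow> \<bar>G l x\<bar> \<le> b) \<longrightarrow> 0 \<le> b \<longrightarrow>
     (\<forall>j i. \<bar>\<integral>\<omega>. G [i] (S j \<omega>) \<partial>P\<bar> \<le> m j) \<longrightarrow>
     f \<in> borel_measurable M \<longrightarrow> (\<forall>x\<in>space M. \<bar>f x\<bar> \<le> B) \<longrightarrow> (\<integral>x. f x \<partial>M) = 0 \<longrightarrow>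
     \<bar>\<integral>\<omega>. G [] (S k \<omega>) * f (\<omega> (int k)) \<partial>P\<bar> \<le> K * B * (b + (\<Sum>i<k. (1 - \<alpha>) ^ i * m (k - 1 - i)))"
proof -
  define d where "d = real CARD('d)"
  define \<rho> where "\<rho> = R / \<alpha>"
  define q where "q = R ^ 2 / 2 + d * (2 * C * (2 * \<rho>))"
  define K1 where "K1 = q / \<alpha>"
  define K2 where "K2 = d * (2 * C)"
  have recursion_algebra: "R ^ 2 * b / 2 * B + d * ((2 * C) * B * (x + 2 * R * b / \<alpha>)) + (1 - \<alpha>) * (B * (K1 * b + K2 * s))
      = B * (K1 * b + K2 * (x + (1 - \<alpha>) * s))" for b B x s
  proof -
    have e: "R ^ 2 * b / 2 = R ^ 2 / 2 * b" "2 * R * b / \<alpha> = 2 * \<rho> * b"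
      by (simp_all add: \<rho>_def)
    have q: "q = \<alpha> * K1" using \<alpha> by (simp add: K1_def)
    have "R ^ 2 / 2 * b * B + d * ((2 * C) * B * (x + 2 * \<rho> * b)) = B * (q * b + K2 * x)"
      unfolding q_def K2_def by algebra
    also have "B * (q * b + K2 * x) + (1 - \<alpha>) * (B * (K1 * b + K2 * s)) = B * (K1 * b + K2 * (x + (1 - \<alpha>) * s))"
      unfolding q by algebra
    finally show ?thesis unfolding e .
  qed
  have d0: "0 \<le> d" by (simp add: d_def)
  have q0: "0 \<le> q" using C_nonneg R_nonneg d0 \<alpha> by (auto simp: q_def \<rho>_def)
  then have K10: "0 \<le> K1" using \<alpha> by (simp add: K1_def)
  have K20: "0 \<le> K2" using C_nonneg d0 by (simp add: K2_def)
  show ?thesis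
  proof (intro exI[of _ "K1 + K2"] conjI allI impI)
    show "0 \<le> K1 + K2" using K10 K20 by simp
    fix G b m B k and f :: "'a \<Rightarrow> real"
    assume G: "jet G" and b: "\<forall>l x. length l = 2 \<longrightarrow> \<bar>G l x\<bar> \<le> b" "0 \<le> b"
      and m: "\<forall>j i. \<bar>\<integral>\<omega>. G [i] (S j \<omega>) \<partial>P\<bar> \<le> m j"
      and f: "f \<in> borel_measurable M" "\<forall>x\<in>space M. \<bar>f x\<bar> \<le> B" "(\<integral>x. f x \<partial>M) = 0"
    have m0: "0 \<le> m j" for j using m[rule_format, of undefined j] abs_ge_zero order_trans by blast
    obtain x0 where "x0 \<in> space M" using not_empty by auto
    then have "\<bar>f x0\<bar> \<le> B" using f(2) by auto
    then have B0: "0 \<le> B" by linarith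
    have gl: "bdd_borel (G l)" for l using G by (simp add: jet_def)
    have "\<bar>\<integral>\<omega>. G [] (S k \<omega>) * f (\<omega> (int k)) \<partial>P\<bar> \<le> B * (K1 * b + K2 * (\<Sum>i<k. (1 - \<alpha>) ^ i * m (k - 1 - i)))"
      using f
    proof (induction k arbitrary: f)
      case 0
      have "bdd_meas M f" using 0 by (auto simp: bdd_meas_def)
      from integral_coord[OF this, of 0] have "(\<integral>\<omega>. f (\<omega> 0) \<partial>P) = 0" using 0 by simp
      then show ?case using B0 K10 b(2) by simp
    next
      case (Suc k)
      note [measurable] = Suc.prems(1)
      have fb: "bdd_meas M f" using Suc.prems by (auto simp: bdd_meas_def)
      have [measurable]: "G l \<in> borel_measurable borel" for l using gl by (simp add: bdd_meas_def)
      let ?y = "\<lambda>\<omega>. \<chi> i. xi k i \<omega>"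
      let ?D = "\<lambda>\<omega>. (G [] (S (Suc k) \<omega>) - (G [] (S k \<omega>) + (\<Sum>i\<in>UNIV. xi k i \<omega> * G [i] (S k \<omega>)))) * f (\<omega> (int k + 1))"
      let ?I = "\<lambda>i \<omega>. G [i] (S k \<omega>) * (\<Prod>i\<leftarrow>[i]. xi k i \<omega>) * f (\<omega> (int k + 1))"
      have D: "\<bar>\<integral>\<omega>. ?D \<omega> \<partial>P\<bar> \<le> R ^ 2 * b / 2 * B"
      proof (rule expectation_bound_P)
        fix \<omega> assume \<omega>: "\<omega> \<in> space P"
        have "\<bar>G [] (S k \<omega> + ?y \<omega>) - (\<Sum>p<2. jdir G (?y \<omega>) p [] (S k \<omega>) / fact p)\<bar>
            \<le> (\<Sum>i\<in>UNIV. \<bar>?y \<omega> $ i\<bar>) ^ 2 * b / fact 2"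
          by (rule jet_taylor[OF G]) (use b in auto)
        also have "\<dots> \<le> R ^ 2 * b / fact 2"
          using xi_l1[OF \<omega>] b(2) by (intro divide_right_mono mult_right_mono power_mono) (auto simp: sum_nonneg)
        finally have "\<bar>G [] (S (Suc k) \<omega>) - (G [] (S k \<omega>) + (\<Sum>i\<in>UNIV. xi k i \<omega> * G [i] (S k \<omega>)))\<bar> \<le> R ^ 2 * b / 2"
          by (simp add: S_Suc eval_nat_numeral)
        then show "\<bar>?D \<omega>\<bar> \<le> R ^ 2 * b / 2 * B"
          unfolding abs_mult using Suc.prems(2) coord_space[OF \<omega>] R_nonneg b(2)
          by (intro mult_mono) auto
      qed measurable
      have I: "\<bar>\<integral>\<omega>. ?I i \<omega> \<partial>P\<bar> \<le> (2 * C) * B * (m k + 2 * R * b / \<alpha>)" for i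
        using increments_bound[OF G _ b(2) Suc.prems(1) _ B0, of "[i]" k "m k" "[i]"] b m Suc.prems(2)
        by auto
      have iD: "integrable P ?D"
        by (intro P.bdd_meas_integrable bdd_meas_mult bdd_meas_diff bdd_meas_add bdd_meas_sum xi_bdd bdd_meas_S gl bdd_meas_coord fb)
      have iI: "integrable P (?I i)" for i
        by (intro P.bdd_meas_integrable bdd_meas_mult bdd_meas_prod_xi bdd_meas_S gl bdd_meas_coord fb)
      have i0: "integrable P (\<lambda>\<omega>. G [] (S k \<omega>) * f (\<omega> (int k + 1)))"
        by (intro P.bdd_meas_integrable bdd_meas_mult bdd_meas_S gl bdd_meas_coord fb)
      have IH: "\<bar>\<integral>\<omega>. G [] (S k \<omega>) * f (T (\<omega> (int k))) \<partial>P\<bar>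
          \<le> B * (K1 * b + K2 * (\<Sum>i<k. (1 - \<alpha>) ^ i * m (k - 1 - i)))"
        by (rule Suc.IH[of "\<lambda>x. f (T x)"]) (use Suc.prems T_space integral_T[of f] in auto)
      have "(\<integral>\<omega>. G [] (S (Suc k) \<omega>) * f (\<omega> (int (Suc k))) \<partial>P)
          = (\<integral>\<omega>. ?D \<omega> + (\<Sum>i\<in>UNIV. ?I i \<omega>) + G [] (S k \<omega>) * f (\<omega> (int k + 1)) \<partial>P)"
        by (intro Bochner_Integration.integral_cong refl) (simp add: algebra_simps sum_distrib_left)
      also have "\<dots> = (\<integral>\<omega>. ?D \<omega> \<partial>P) + (\<Sum>i\<in>UNIV. \<integral>\<omega>. ?I i \<omega> \<partial>P) + (\<integral>\<omega>. G [] (S k \<omega>) * f (\<omega> (int k + 1)) \<partial>P)"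
        using iD iI i0 by (simp add: Bochner_Integration.integral_sum)
      also have "(\<integral>\<omega>. G [] (S k \<omega>) * f (\<omega> (int k + 1)) \<partial>P) = (1 - \<alpha>) * (\<integral>\<omega>. G [] (S k \<omega>) * f (T (\<omega> (int k))) \<partial>P)"
        using condition_next[OF gl fb] Suc.prems(3) by simp
      finally have split: "(\<integral>\<omega>. G [] (S (Suc k) \<omega>) * f (\<omega> (int (Suc k))) \<partial>P)
          = (\<integral>\<omega>. ?D \<omega> \<partial>P) + (\<Sum>i\<in>UNIV. \<integral>\<omega>. ?I i \<omega> \<partial>P) + (1 - \<alpha>) * (\<integral>\<omega>. G [] (S k \<omega>) * f (T (\<omega> (int k))) \<partial>P)" .
      have "\<bar>(\<integral>\<omega>. ?D \<omega> \<partial>P) + (\<Sum>i\<in>UNIV. \<integral>\<omega>. ?I i \<omega> \<partial>P) + (1 - \<alpha>) * (\<integral>\<omega>. G [] (S k \<omega>) * f (T (\<omega> (int k))) \<partial>P)\<bar>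
        \<le> R ^ 2 * b / 2 * B + d * ((2 * C) * B * (m k + 2 * R * b / \<alpha>))
          + (1 - \<alpha>) * (B * (K1 * b + K2 * (\<Sum>i<k. (1 - \<alpha>) ^ i * m (k - 1 - i))))"
      proof (intro order_trans[OF abs_triangle_ineq] add_mono D)
        have "\<bar>\<Sum>i\<in>UNIV. \<integral>\<omega>. ?I i \<omega> \<partial>P\<bar> \<le> (\<Sum>i\<in>(UNIV::'d set). (2 * C) * B * (m k + 2 * R * b / \<alpha>))"
          by (rule order_trans[OF sum_abs sum_mono]) (rule I)
        then show "\<bar>\<Sum>i\<in>UNIV. \<integral>\<omega>. ?I i \<omega> \<partial>P\<bar> \<le> d * ((2 * C) * B * (m k + 2 * R * b / \<alpha>))"
          by (simp add: d_def)
        show "\<bar>(1 - \<alpha>) * (\<integral>\<omega>. G [] (S k \<omega>) * f (T (\<omega> (int k))) \<partial>P)\<bar>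
          \<le> (1 - \<alpha>) * (B * (K1 * b + K2 * (\<Sum>i<k. (1 - \<alpha>) ^ i * m (k - 1 - i))))"
          unfolding abs_mult[of "1 - \<alpha>"] using IH \<alpha> by (intro mult_mono) auto
      qed
      then show ?case unfolding split recursion_algebra geometric_shift[of m k] .
    qed
    also have "\<dots> \<le> B * ((K1 + K2) * b + (K1 + K2) * (\<Sum>i<k. (1 - \<alpha>) ^ i * m (k - 1 - i)))"
      using B0 K10 K20 b(2) m0 \<alpha> by (intro mult_left_mono add_mono mult_right_mono) (auto intro!: sum_nonneg)
    also have "\<dots> = (K1 + K2) * B * (b + (\<Sum>i<k. (1 - \<alpha>) ^ i * m (k - 1 - i)))"
      by (simp add: algebra_simps)
    finally show "\<bar>\<integral>\<omega>. G [] (S k \<omega>) * f (\<omega> (int k)) \<partial>P\<bar> \<le> (K1 + K2) * B * (b + (\<Sum>i<k. (1 - \<alpha>) ^ i * m (k - 1 - i)))" .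
  qed
qed

lemma increment_cov: "(\<integral>\<omega>. xi k i \<omega> * xi k j \<omega> \<partial>P) = (if i = j \<and> i \<in> J then 1 else 0)"
proof -
  let ?c = "\<integral>x. e i x * e j x \<partial>M"
  have cross: "(\<integral>\<omega>. e i (T (\<omega> (int k))) * e j (\<omega> (int k + 1)) \<partial>P) = (1 - \<alpha>) * (\<integral>x. e i x * e j x \<partial>M)" for i j
  proof -
    have [measurable]: "(\<lambda>\<omega>. \<omega> (int k)) \<in> past_algebra M (int k) \<rightarrow>\<^sub>M M" by (rule coord_past) simp
    have "(\<lambda>\<omega>. e i (T (\<omega> (int k)))) \<in> borel_measurable (past_algebra M (int k))" by measurable
    then have "(\<integral>\<omega>. e i (T (\<omega> (int k))) * e j (\<omega> (int k + 1)) \<partial>P)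
        = (\<integral>\<omega>. e i (T (\<omega> (int k))) * ((1 - \<alpha>) * e j (T (\<omega> (int k))) + \<alpha> * (\<integral>x. e j x \<partial>M)) \<partial>P)"
      by (rule markov_property[OF _ e_bound[OF T_space[OF coord_space]] e_bdd])
    also have "\<dots> = (1 - \<alpha>) * (\<integral>\<omega>. e i (T (\<omega> (int k))) * e j (T (\<omega> (int k))) \<partial>P)"
      by (simp add: e_centred mult_ac)
    also have "(\<integral>\<omega>. e i (T (\<omega> (int k))) * e j (T (\<omega> (int k))) \<partial>P) = (\<integral>x. e i (T x) * e j (T x) \<partial>M)"
      by (rule integral_coord) (intro bdd_meas_intros e_bdd)
    also have "\<dots> = (\<integral>x. e i x * e j x \<partial>M)"
      by (rule integral_T) measurable
    finally show ?thesis .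
  qed
  have i1: "integrable P (\<lambda>\<omega>. e i (\<omega> (int k + 1)) * e j (\<omega> (int k + 1)))"
    by (intro P.bdd_meas_integrable bdd_meas_mult bdd_meas_coord e_bdd)
  have i2: "integrable P (\<lambda>\<omega>. e i (T (\<omega> (int k))) * e j (\<omega> (int k + 1)))" for i j
    by (intro P.bdd_meas_integrable bdd_meas_mult bdd_meas_coord[of "\<lambda>x. e i (T x)"] bdd_meas_coord[of "e j"] bdd_meas_T e_bdd)
  have i3: "integrable P (\<lambda>\<omega>. e i (T (\<omega> (int k))) * e j (T (\<omega> (int k))))"
    by (intro P.bdd_meas_integrable bdd_meas_mult bdd_meas_coord[of "\<lambda>x. e i (T x)"] bdd_meas_coord[of "\<lambda>x. e j (T x)"] bdd_meas_T e_bdd)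
  have v1: "(\<integral>\<omega>. e i (\<omega> (int k + 1)) * e j (\<omega> (int k + 1)) \<partial>P) = ?c"
    by (rule integral_coord) (intro bdd_meas_intros e_bdd)
  have v3: "(\<integral>\<omega>. e i (T (\<omega> (int k))) * e j (T (\<omega> (int k))) \<partial>P) = ?c"
  proof -
    have "(\<integral>\<omega>. e i (T (\<omega> (int k))) * e j (T (\<omega> (int k))) \<partial>P) = (\<integral>x. e i (T x) * e j (T x) \<partial>M)"
      by (rule integral_coord) (intro bdd_meas_intros e_bdd)
    also have "\<dots> = ?c" by (rule integral_T) measurable
    finally show ?thesis .
  qed
  have "xi k i \<omega> * xi k j \<omega> = e i (\<omega> (int k + 1)) * e j (\<omega> (int k + 1))
     - (1 - \<alpha>) * (e i (T (\<omega> (int k))) * e j (\<omega> (int k + 1)))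
     - (1 - \<alpha>) * (e j (T (\<omega> (int k))) * e i (\<omega> (int k + 1)))
     + (1 - \<alpha>)\<^sup>2 * (e i (T (\<omega> (int k))) * e j (T (\<omega> (int k))))" for \<omega>
    by (simp add: xi_def power2_eq_square algebra_simps)
  then have "(\<integral>\<omega>. xi k i \<omega> * xi k j \<omega> \<partial>P) = ?c - (1 - \<alpha>) * ((1 - \<alpha>) * ?c)
      - (1 - \<alpha>) * ((1 - \<alpha>) * (\<integral>x. e j x * e i x \<partial>M)) + (1 - \<alpha>)\<^sup>2 * ?c"
    using i1 i2 i3 by (simp add: cross v1 v3)
  also have "\<dots> = (1 - (1 - \<alpha>)\<^sup>2) * ?c"
    by (simp add: power2_eq_square algebra_simps mult.commute[of "e j _" "e i _"])
  finally show ?thesis using e_cov by simp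
qed

text \<open>The increment of the martingale as a vector.\<close>

abbreviation increment :: "nat \<Rightarrow> (int \<Rightarrow> 'a) \<Rightarrow> real^'d" where
  "increment k \<omega> \<equiv> (\<chi> i. xi k i \<omega>)"

text \<open>The second-order Taylor polynomial of one martingale step against one step \<open>G'\<close> of heat flow.  The
conditional covariance of the increment differs from its mean by a centred function of the state;
\<open>A\<close> bounds the contribution of such functions.\<close>

lemma second_order_step:
  assumes G: "jet G" and inv: "\<And>i x. i \<notin> J \<Longrightarrow> G [i, i] x = 0"
    and A: "\<And>i j f. f \<in> borel_measurable M \<Longrightarrow> (\<And>x. x \<in> space M \<Longrightarrow> \<bar>f x\<bar> \<le> 2 * (2 * C)\<^sup>2) \<Longrightarrow>
      (\<integral>x. f x \<partial>M) = 0 \<Longrightarrow> \<bar>\<integral>\<omega>. G [j, i] (S k \<omega>) * f (\<omega> (int k)) \<partial>P\<bar> \<le> A"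
    and G': "bdd_borel G'" "\<And>x. \<bar>G' x - G [] x - (\<Sum>i\<in>UNIV. G [i, i] x) / 2\<bar> \<le> c"
  shows "\<bar>(\<integral>\<omega>. G [] (S k \<omega>) + jdir G (increment k \<omega>) 1 [] (S k \<omega>) + jdir G (increment k \<omega>) 2 [] (S k \<omega>) / 2 \<partial>P)
     - (\<integral>\<omega>. G' (S k \<omega>) \<partial>P)\<bar> \<le> (real CARD('d))\<^sup>2 * A / 2 + c"
proof -
  have gl: "bdd_borel (G l)" for l using G by (simp add: jet_def)
  have iG: "integrable P (\<lambda>\<omega>. G l (S k \<omega>))" for l
    by (intro P.bdd_meas_integrable bdd_meas_S gl)
  let ?I1 = "\<lambda>i \<omega>. G [i] (S k \<omega>) * xi k i \<omega>"
  let ?I2 = "\<lambda>i j \<omega>. G [j, i] (S k \<omega>) * (xi k i \<omega> * xi k j \<omega>)"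
  have i1: "integrable P (?I1 i)" for i
    by (intro P.bdd_meas_integrable bdd_meas_mult bdd_meas_S gl xi_bdd)
  have i2: "integrable P (?I2 i j)" for i j
    by (intro P.bdd_meas_integrable bdd_meas_mult bdd_meas_S gl xi_bdd)
  let ?\<delta> = "\<lambda>i j. if i = j \<and> i \<in> J then 1 else (0::real)"
  have v2: "\<bar>(\<integral>\<omega>. ?I2 i j \<omega> \<partial>P) - ?\<delta> i j * (\<integral>\<omega>. G [j, i] (S k \<omega>) \<partial>P)\<bar> \<le> A" for i j
  proof -
    obtain w where w: "w \<in> borel_measurable M" "\<And>x. x \<in> space M \<Longrightarrow> \<bar>w x\<bar> \<le> (2 * C) ^ length [i, j] * 1"
      and eq: "\<And>k g. bdd_borel g \<Longrightarrow> (\<integral>\<omega>. g (S k \<omega>) * (\<Prod>i\<leftarrow>[i, j]. xi k i \<omega>) * 1 \<partial>P)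
         = (\<integral>\<omega>. g (S k \<omega>) * w (\<omega> (int k)) \<partial>P)"
      using condition_increments_unit[of "\<lambda>_. 1" 1 "[i, j]"] by auto
    have w2: "\<bar>w x\<bar> \<le> (2 * C)\<^sup>2" if "x \<in> space M" for x using w(2)[OF that] by (simp add: power2_eq_square)
    have wb: "bdd_meas M w" using w by (auto simp: bdd_meas_def)
    have "(\<integral>\<omega>. w (\<omega> (int k)) \<partial>P) = ?\<delta> i j"
      using eq[OF bdd_meas_const[of _ 1], of k] by (simp add: increment_cov)
    then have mw: "(\<integral>x. w x \<partial>M) = ?\<delta> i j" using integral_coord[OF wb] by simp
    have mw_le: "\<bar>?\<delta> i j\<bar> \<le> (2 * C)\<^sup>2"
    proof -
      have "\<bar>\<integral>x. w x \<partial>M\<bar> \<le> (\<integral>x. \<bar>w x\<bar> \<partial>M)" by (rule integral_abs_bound)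
      also have "\<dots> \<le> (2 * C)\<^sup>2"
        using bdd_meas_integrable[OF wb] w2 by (intro integral_le_const AE_I2) auto
      finally show ?thesis by (simp only: mw)
    qed
    have "\<bar>\<integral>\<omega>. G [j, i] (S k \<omega>) * (w (\<omega> (int k)) - ?\<delta> i j) \<partial>P\<bar> \<le> A"
    proof (rule A)
      show "(\<lambda>x. w x - ?\<delta> i j) \<in> borel_measurable M" using w by simp
      show "\<bar>w x - ?\<delta> i j\<bar> \<le> 2 * (2 * C)\<^sup>2" if "x \<in> space M" for x
        using w2[OF that] mw_le by linarith
      show "(\<integral>x. w x - ?\<delta> i j \<partial>M) = 0" using bdd_meas_integrable[OF wb] prob_space mw by simp
    qed
    moreover have "(\<integral>\<omega>. G [j, i] (S k \<omega>) * (w (\<omega> (int k)) - ?\<delta> i j) \<partial>P)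
        = (\<integral>\<omega>. G [j, i] (S k \<omega>) * w (\<omega> (int k)) - ?\<delta> i j * G [j, i] (S k \<omega>) \<partial>P)"
      by (simp only: right_diff_distrib mult.commute)
    moreover have "\<dots> = (\<integral>\<omega>. G [j, i] (S k \<omega>) * w (\<omega> (int k)) \<partial>P) - ?\<delta> i j * (\<integral>\<omega>. G [j, i] (S k \<omega>) \<partial>P)"
    proof -
      have "integrable P (\<lambda>\<omega>. G [j, i] (S k \<omega>) * w (\<omega> (int k)))"
        by (intro P.bdd_meas_integrable bdd_meas_mult bdd_meas_S gl bdd_meas_coord wb)
      then show ?thesis using iG[of "[j, i]"] by simp
    qed
    ultimately show ?thesis using eq[OF gl, of "[j, i]" k] by (simp add: mult.assoc)
  qed
  have "(\<integral>\<omega>. G [] (S k \<omega>) + jdir G (increment k \<omega>) 1 [] (S k \<omega>) + jdir G (increment k \<omega>) 2 [] (S k \<omega>) / 2 \<partial>P)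
      = (\<integral>\<omega>. G [] (S k \<omega>) + (\<Sum>i\<in>UNIV. ?I1 i \<omega>) + (\<Sum>i\<in>UNIV. \<Sum>j\<in>UNIV. ?I2 i j \<omega>) / 2 \<partial>P)"
    by (simp only: jdir_1 jdir_2 vec_lambda_beta mult.commute)
  also have "\<dots> = (\<integral>\<omega>. G [] (S k \<omega>) \<partial>P) + (\<Sum>i\<in>UNIV. \<integral>\<omega>. ?I1 i \<omega> \<partial>P) + (\<Sum>i\<in>UNIV. \<Sum>j\<in>UNIV. \<integral>\<omega>. ?I2 i j \<omega> \<partial>P) / 2"
    using iG i1 i2 by (simp add: Bochner_Integration.integral_sum Bochner_Integration.integrable_sum)
  finally have lhs: "(\<integral>\<omega>. G [] (S k \<omega>) + jdir G (increment k \<omega>) 1 [] (S k \<omega>) + jdir G (increment k \<omega>) 2 [] (S k \<omega>) / 2 \<partial>P)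
      = (\<integral>\<omega>. G [] (S k \<omega>) \<partial>P) + (\<Sum>i\<in>UNIV. \<Sum>j\<in>UNIV. \<integral>\<omega>. ?I2 i j \<omega> \<partial>P) / 2"
    by (simp add: increment_centred[OF gl])
  have "\<bar>(\<Sum>i\<in>UNIV. \<Sum>j\<in>UNIV. \<integral>\<omega>. ?I2 i j \<omega> \<partial>P) - (\<Sum>i\<in>UNIV. \<Sum>j\<in>UNIV. ?\<delta> i j * (\<integral>\<omega>. G [j, i] (S k \<omega>) \<partial>P))\<bar>
      = \<bar>\<Sum>i\<in>UNIV. \<Sum>j\<in>UNIV. (\<integral>\<omega>. ?I2 i j \<omega> \<partial>P) - ?\<delta> i j * (\<integral>\<omega>. G [j, i] (S k \<omega>) \<partial>P)\<bar>"
    by (simp only: sum_subtractf)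
  also have "\<dots> \<le> (\<Sum>i\<in>(UNIV::'d set). \<Sum>j\<in>(UNIV::'d set). A)"
    by (intro order_trans[OF sum_abs] sum_mono v2)
  also have "\<dots> = (real CARD('d))\<^sup>2 * A" by (simp add: power2_eq_square)
  finally have d2: "\<bar>(\<Sum>i\<in>UNIV. \<Sum>j\<in>UNIV. \<integral>\<omega>. ?I2 i j \<omega> \<partial>P) - (\<Sum>i\<in>UNIV. \<Sum>j\<in>UNIV. ?\<delta> i j * (\<integral>\<omega>. G [j, i] (S k \<omega>) \<partial>P))\<bar>
      \<le> (real CARD('d))\<^sup>2 * A" .
  have diag: "(\<Sum>i\<in>UNIV. \<Sum>j\<in>UNIV. ?\<delta> i j * (\<integral>\<omega>. G [j, i] (S k \<omega>) \<partial>P)) = (\<Sum>i\<in>UNIV. \<integral>\<omega>. G [i, i] (S k \<omega>) \<partial>P)"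
  proof (rule sum.cong[OF refl])
    fix i
    have "(\<Sum>j\<in>UNIV. ?\<delta> i j * (\<integral>\<omega>. G [j, i] (S k \<omega>) \<partial>P)) = (\<Sum>j\<in>UNIV. if i = j then ?\<delta> i i * (\<integral>\<omega>. G [i, i] (S k \<omega>) \<partial>P) else 0)"
      by (rule sum.cong) auto
    also have "\<dots> = (\<integral>\<omega>. G [i, i] (S k \<omega>) \<partial>P)" using inv by (cases "i \<in> J") auto
    finally show "(\<Sum>j\<in>UNIV. ?\<delta> i j * (\<integral>\<omega>. G [j, i] (S k \<omega>) \<partial>P)) = (\<integral>\<omega>. G [i, i] (S k \<omega>) \<partial>P)" .
  qed
  have iG': "integrable P (\<lambda>\<omega>. G' (S k \<omega>))"
    by (intro P.bdd_meas_integrable bdd_meas_S G')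
  have "\<bar>(\<integral>\<omega>. G' (S k \<omega>) - G [] (S k \<omega>) - (\<Sum>i\<in>UNIV. G [i, i] (S k \<omega>)) / 2 \<partial>P)\<bar> \<le> c"
    using iG' iG by (intro expectation_bound_P G'(2)) (auto intro!: borel_measurable_integrable)
  moreover have "(\<integral>\<omega>. G' (S k \<omega>) - G [] (S k \<omega>) - (\<Sum>i\<in>UNIV. G [i, i] (S k \<omega>)) / 2 \<partial>P)
     = (\<integral>\<omega>. G' (S k \<omega>) \<partial>P) - (\<integral>\<omega>. G [] (S k \<omega>) \<partial>P) - (\<Sum>i\<in>UNIV. \<integral>\<omega>. G [i, i] (S k \<omega>) \<partial>P) / 2"
    using iG' iG by (simp add: Bochner_Integration.integral_sum Bochner_Integration.integrable_sum)
  ultimately show ?thesis using d2 unfolding lhs diag by (simp add: abs_le_iff)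
qed

text \<open>One step of the comparison, with an error of third order in the test function.\<close>

lemma third_order_crude_step:
  "\<exists>K\<ge>0. \<forall>G G' b c k. jet G \<longrightarrow> (\<forall>i x. i \<notin> J \<longrightarrow> G [i, i] x = 0) \<longrightarrow>
     (\<forall>l x. length l = 3 \<longrightarrow> \<bar>G l x\<bar> \<le> b) \<longrightarrow> 0 \<le> b \<longrightarrow> bdd_borel G' \<longrightarrow>
     (\<forall>x. \<bar>G' x - G [] x - (\<Sum>i\<in>UNIV. G [i, i] x) / 2\<bar> \<le> c) \<longrightarrow>
     \<bar>(\<integral>\<omega>. G [] (S (Suc k) \<omega>) \<partial>P) - (\<integral>\<omega>. G' (S k \<omega>) \<partial>P)\<bar> \<le> K * b + c"
proof -
  define a where "a = R * (2 * (2 * C)\<^sup>2) / \<alpha>"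
  define K where "K = R ^ 3 / 6 + (real CARD('d))\<^sup>2 * a / 2"
  have a0: "0 \<le> a" using R_nonneg \<alpha> by (simp add: a_def)
  show ?thesis
  proof (intro exI[of _ K] conjI allI impI)
    show "0 \<le> K" using a0 R_nonneg by (simp add: K_def)
    fix G G' b c k
    assume G: "jet G" and inv: "\<forall>i x. i \<notin> J \<longrightarrow> G [i, i] x = 0"
      and b: "\<forall>l x. length l = 3 \<longrightarrow> \<bar>G l x\<bar> \<le> b" "0 \<le> b" and G': "bdd_borel G'"
      "\<forall>x. \<bar>G' x - G [] x - (\<Sum>i\<in>UNIV. G [i, i] x) / 2\<bar> \<le> c"
    have gl: "bdd_borel (G l)" for l using G by (simp add: jet_def)
    let ?Q = "\<lambda>\<omega>. G [] (S k \<omega>) + jdir G (increment k \<omega>) 1 [] (S k \<omega>) + jdir G (increment k \<omega>) 2 [] (S k \<omega>) / 2"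
    have bQ: "bdd_meas P ?Q"
      unfolding jdir_1 jdir_2 vec_lambda_beta divide_inverse
      by (intro bdd_meas_add bdd_meas_sum bdd_meas_mult bdd_meas_const bdd_meas_S gl xi_bdd)
    have bS: "bdd_meas P (\<lambda>\<omega>. G [] (S (Suc k) \<omega>))" by (intro bdd_meas_S gl)
    have "\<bar>\<integral>\<omega>. G [] (S (Suc k) \<omega>) - ?Q \<omega> \<partial>P\<bar> \<le> R ^ 3 * b / 6"
    proof (rule expectation_bound_P)
      show "(\<lambda>\<omega>. G [] (S (Suc k) \<omega>) - ?Q \<omega>) \<in> borel_measurable P"
        using bdd_meas_diff[OF bS bQ] by (simp add: bdd_meas_def)
      fix \<omega> assume \<omega>: "\<omega> \<in> space P"
      have f: "fact 3 = (6::real)" "fact 2 = (2::real)" by (simp_all add: eval_nat_numeral)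
      have "\<bar>G [] (S k \<omega> + increment k \<omega>) - (\<Sum>p<3. jdir G (increment k \<omega>) p [] (S k \<omega>) / fact p)\<bar>
          \<le> (\<Sum>i\<in>UNIV. \<bar>increment k \<omega> $ i\<bar>) ^ 3 * b / fact 3"
        by (rule jet_taylor[OF G]) (use b in auto)
      also have "\<dots> \<le> R ^ 3 * b / fact 3"
        using xi_l1[OF \<omega>] b(2) by (intro divide_right_mono mult_right_mono power_mono) (auto simp: sum_nonneg)
      finally show "\<bar>G [] (S (Suc k) \<omega>) - ?Q \<omega>\<bar> \<le> R ^ 3 * b / 6"
        unfolding sum_lessThan_3 f S_Suc by simp
    qed
    moreover have "(\<integral>\<omega>. G [] (S (Suc k) \<omega>) - ?Q \<omega> \<partial>P) = (\<integral>\<omega>. G [] (S (Suc k) \<omega>) \<partial>P) - (\<integral>\<omega>. ?Q \<omega> \<partial>P)"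
      by (intro Bochner_Integration.integral_diff P.bdd_meas_integrable bS bQ)
    moreover have "\<bar>(\<integral>\<omega>. ?Q \<omega> \<partial>P) - (\<integral>\<omega>. G' (S k \<omega>) \<partial>P)\<bar> \<le> (real CARD('d))\<^sup>2 * (a * b) / 2 + c"
    proof (rule second_order_step[OF G])
      fix i j f assume f: "f \<in> borel_measurable M" "\<And>x. x \<in> space M \<Longrightarrow> \<bar>f x\<bar> \<le> 2 * (2 * C)\<^sup>2" "(\<integral>x. f x \<partial>M) = 0"
      have "\<bar>\<integral>\<omega>. G [j, i] (S k \<omega>) * f (\<omega> (int k)) \<partial>P\<bar> \<le> R * b * (2 * (2 * C)\<^sup>2) / \<alpha>"
        by (rule mixing_lipschitz[OF gl jet_lipschitz[OF G]]) (use b f in auto)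
      then show "\<bar>\<integral>\<omega>. G [j, i] (S k \<omega>) * f (\<omega> (int k)) \<partial>P\<bar> \<le> a * b"
        by (simp add: a_def mult_ac)
    qed (use inv G' in auto)
    moreover have "K * b + c = R ^ 3 * b / 6 + ((real CARD('d))\<^sup>2 * (a * b) / 2 + c)"
      by (simp add: K_def algebra_simps)
    ultimately show "\<bar>(\<integral>\<omega>. G [] (S (Suc k) \<omega>) \<partial>P) - (\<integral>\<omega>. G' (S k \<omega>) \<partial>P)\<bar> \<le> K * b + c"
      by linarith
  qed
qed

text \<open>One step of the comparison with an error of fourth order, the third-order contributions being
expressed by the bounds \<open>m j\<close> for the means of third derivatives at the times \<open>j \<le> k\<close>.\<close>

lemma fourth_order_step:
  "\<exists>K\<ge>0. \<forall>G G' b c m k. jet G \<longrightarrow> (\<forall>i x. i \<notin> J \<longrightarrow> G [i, i] x = 0) \<longrightarrow>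
     (\<forall>l x. length l = 4 \<longrightarrow> \<bar>G l x\<bar> \<le> b) \<longrightarrow> 0 \<le> b \<longrightarrow> bdd_borel G' \<longrightarrow>
     (\<forall>x. \<bar>G' x - G [] x - (\<Sum>i\<in>UNIV. G [i, i] x) / 2\<bar> \<le> c) \<longrightarrow>
     (\<forall>j l. length l = 3 \<longrightarrow> \<bar>\<integral>\<omega>. G l (S j \<omega>) \<partial>P\<bar> \<le> m j) \<longrightarrow>
     \<bar>(\<integral>\<omega>. G [] (S (Suc k) \<omega>) \<partial>P) - (\<integral>\<omega>. G' (S k \<omega>) \<partial>P)\<bar>
       \<le> K * (b + m k + (\<Sum>i<k. (1 - \<alpha>) ^ i * m (k - 1 - i))) + c"
proof -
  obtain K0 where K0: "0 \<le> K0" and mix_all: "\<forall>G b m f B k. jet G \<longrightarrow> (\<forall>l x. length l = 2 \<longrightarrow> \<bar>G l x\<bar> \<le> b) \<longrightarrow> 0 \<le> b \<longrightarrow>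
     (\<forall>j i. \<bar>\<integral>\<omega>. G [i] (S j \<omega>) \<partial>P\<bar> \<le> m j) \<longrightarrow>
     f \<in> borel_measurable M \<longrightarrow> (\<forall>x\<in>space M. \<bar>f x\<bar> \<le> B) \<longrightarrow> (\<integral>x. f x \<partial>M) = 0 \<longrightarrow>
     \<bar>\<integral>\<omega>. G [] (S k \<omega>) * f (\<omega> (int k)) \<partial>P\<bar> \<le> K0 * B * (b + (\<Sum>i<k. (1 - \<alpha>) ^ i * m (k - 1 - i)))"
    using mixing_jet by (elim exE conjE) (rule that)
  note mix = mix_all[rule_format]
  define d where "d = real CARD('d)"
  define a1 where "a1 = K0 * (2 * (2 * C)\<^sup>2)"
  define a2 where "a2 = (2 * C) ^ 3 * (1 + 2 * R / \<alpha>)"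
  define K where "K = R ^ 4 / 24 + d\<^sup>2 * a1 / 2 + d ^ 3 * a2 / 6"
  have nn: "0 \<le> d" "0 \<le> a1" "0 \<le> a2" using K0 R_nonneg C_nonneg \<alpha> by (auto simp: a1_def a2_def d_def)
  show ?thesis
  proof (intro exI[of _ K] conjI allI impI)
    show "0 \<le> K" using nn R_nonneg by (simp add: K_def)
    fix G G' b c m k
    assume G: "jet G" and inv: "\<forall>i x. i \<notin> J \<longrightarrow> G [i, i] x = 0"
      and b: "\<forall>l x. length l = 4 \<longrightarrow> \<bar>G l x\<bar> \<le> b" "0 \<le> b" and G': "bdd_borel G'"
      "\<forall>x. \<bar>G' x - G [] x - (\<Sum>i\<in>UNIV. G [i, i] x) / 2\<bar> \<le> c"
      and m: "\<forall>j l. length l = 3 \<longrightarrow> \<bar>\<integral>\<omega>. G l (S j \<omega>) \<partial>P\<bar> \<le> m j"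
    let ?s = "\<Sum>i<k. (1 - \<alpha>) ^ i * m (k - 1 - i)"
    have m0: "0 \<le> m j" for j
      using m[rule_format, of "[undefined, undefined, undefined]" j] abs_ge_zero order_trans by fastforce
    have s0: "0 \<le> ?s" using m0 \<alpha> by (intro sum_nonneg) auto
    have gl: "bdd_borel (G l)" for l using G by (simp add: jet_def)
    let ?Q = "\<lambda>\<omega>. G [] (S k \<omega>) + jdir G (increment k \<omega>) 1 [] (S k \<omega>) + jdir G (increment k \<omega>) 2 [] (S k \<omega>) / 2"
    let ?I3 = "\<lambda>i j p \<omega>. G [p, j, i] (S k \<omega>) * (\<Prod>i\<leftarrow>[i, j, p]. xi k i \<omega>) * 1"
    let ?H = "\<lambda>\<omega>. jdir G (increment k \<omega>) 3 [] (S k \<omega>)"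
    have bQ: "bdd_meas P ?Q"
      unfolding jdir_1 jdir_2 vec_lambda_beta divide_inverse
      by (intro bdd_meas_add bdd_meas_sum bdd_meas_mult bdd_meas_const bdd_meas_S gl xi_bdd)
    have bI: "bdd_meas P (?I3 i j p)" for i j p
      by (intro bdd_meas_mult bdd_meas_const bdd_meas_S gl bdd_meas_prod_xi)
    have H: "?H \<omega> = (\<Sum>i\<in>UNIV. \<Sum>j\<in>UNIV. \<Sum>p\<in>UNIV. ?I3 i j p \<omega>)" for \<omega>
      by (simp add: jdir_3 mult_ac)
    have bH: "bdd_meas P ?H" unfolding H by (intro bdd_meas_sum bI)
    have bS: "bdd_meas P (\<lambda>\<omega>. G [] (S (Suc k) \<omega>))" by (intro bdd_meas_S gl)
    let ?D = "\<lambda>\<omega>. G [] (S (Suc k) \<omega>) - ?Q \<omega> - (1 / 6) * ?H \<omega>"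
    have bD: "bdd_meas P ?D" by (intro bdd_meas_diff bdd_meas_mult bdd_meas_const bS bQ bH)
    have D: "\<bar>\<integral>\<omega>. ?D \<omega> \<partial>P\<bar> \<le> R ^ 4 * b / 24"
    proof (rule expectation_bound_P)
      show "?D \<in> borel_measurable P" using bD by (simp add: bdd_meas_def)
      fix \<omega> assume \<omega>: "\<omega> \<in> space P"
      have f: "fact 4 = (24::real)" "fact 3 = (6::real)" "fact 2 = (2::real)" by (simp_all add: eval_nat_numeral)
      have "\<bar>G [] (S k \<omega> + increment k \<omega>) - (\<Sum>p<4. jdir G (increment k \<omega>) p [] (S k \<omega>) / fact p)\<bar>
          \<le> (\<Sum>i\<in>UNIV. \<bar>increment k \<omega> $ i\<bar>) ^ 4 * b / fact 4"
        by (rule jet_taylor[OF G]) (use b in auto)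
      also have "\<dots> \<le> R ^ 4 * b / fact 4"
        using xi_l1[OF \<omega>] b(2) by (intro divide_right_mono mult_right_mono power_mono) (auto simp: sum_nonneg)
      finally have "\<bar>G [] (S (Suc k) \<omega>) - (G [] (S k \<omega>) + jdir G (increment k \<omega>) 1 [] (S k \<omega>) + jdir G (increment k \<omega>) 2 [] (S k \<omega>) / 2 + ?H \<omega> / 6)\<bar> \<le> R ^ 4 * b / 24"
        unfolding sum_lessThan_4 f S_Suc by simp
      then show "\<bar>?D \<omega>\<bar> \<le> R ^ 4 * b / 24" by (simp only: diff_diff_eq mult_1 times_divide_eq_left)
    qed
    have split: "(\<integral>\<omega>. ?D \<omega> \<partial>P) = (\<integral>\<omega>. G [] (S (Suc k) \<omega>) \<partial>P) - (\<integral>\<omega>. ?Q \<omega> \<partial>P) - (1 / 6) * (\<integral>\<omega>. ?H \<omega> \<partial>P)"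
    proof -
      have "(\<integral>\<omega>. ?D \<omega> \<partial>P) = (\<integral>\<omega>. G [] (S (Suc k) \<omega>) - ?Q \<omega> \<partial>P) - (\<integral>\<omega>. (1 / 6) * ?H \<omega> \<partial>P)"
        by (intro Bochner_Integration.integral_diff P.bdd_meas_integrable bdd_meas_diff bdd_meas_mult bdd_meas_const bS bQ bH)
      moreover have "(\<integral>\<omega>. G [] (S (Suc k) \<omega>) - ?Q \<omega> \<partial>P) = (\<integral>\<omega>. G [] (S (Suc k) \<omega>) \<partial>P) - (\<integral>\<omega>. ?Q \<omega> \<partial>P)"
        by (intro Bochner_Integration.integral_diff P.bdd_meas_integrable bS bQ)
      ultimately show ?thesis by (simp only: integral_mult_right_zero)
    qed
    have third: "\<bar>\<integral>\<omega>. ?H \<omega> \<partial>P\<bar> \<le> d ^ 3 * (a2 * (b + m k))"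
    proof -
      have I: "\<bar>\<integral>\<omega>. ?I3 i j p \<omega> \<partial>P\<bar> \<le> a2 * (b + m k)" for i j p
      proof -
        have "\<bar>\<integral>\<omega>. ?I3 i j p \<omega> \<partial>P\<bar> \<le> (2 * C) ^ length [i, j, p] * 1 * (m k + 2 * R * b / \<alpha>)"
          by (rule increments_bound[OF G, of "[p, j, i]" b "\<lambda>_. 1" 1 k "m k" "[i, j, p]"]) (use b m in auto)
        also have "\<dots> = (2 * C) ^ 3 * (m k + 2 * R / \<alpha> * b)" by (simp add: eval_nat_numeral)
        also have "\<dots> \<le> (2 * C) ^ 3 * ((1 + 2 * R / \<alpha>) * m k + (1 + 2 * R / \<alpha>) * b)"
          using C_nonneg R_nonneg \<alpha> m0[of k] b(2) by (intro mult_left_mono add_mono) (auto simp: field_simps)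
        also have "\<dots> = a2 * (b + m k)"
          unfolding a2_def by (simp only: distrib_left[symmetric] add.commute[of b] mult.assoc)
        finally show ?thesis .
      qed
      have iI: "integrable P (?I3 i j p)" for i j p by (intro P.bdd_meas_integrable bI)
      have "(\<integral>\<omega>. ?H \<omega> \<partial>P) = (\<Sum>i\<in>UNIV. \<Sum>j\<in>UNIV. \<Sum>p\<in>UNIV. \<integral>\<omega>. ?I3 i j p \<omega> \<partial>P)"
        unfolding H
        by (subst Bochner_Integration.integral_sum, intro Bochner_Integration.integrable_sum iI,
            intro sum.cong refl,
            subst Bochner_Integration.integral_sum, intro Bochner_Integration.integrable_sum iI,
            intro sum.cong refl, intro Bochner_Integration.integral_sum iI)
      also have "\<bar>\<dots>\<bar> \<le> (\<Sum>i\<in>(UNIV::'d set). \<Sum>j\<in>(UNIV::'d set). \<Sum>p\<in>(UNIV::'d set). a2 * (b + m k))"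
        by (intro order_trans[OF sum_abs] sum_mono I)
      also have "\<dots> = d ^ 3 * (a2 * (b + m k))" by (simp add: d_def eval_nat_numeral)
      finally show ?thesis .
    qed
    have second: "\<bar>(\<integral>\<omega>. ?Q \<omega> \<partial>P) - (\<integral>\<omega>. G' (S k \<omega>) \<partial>P)\<bar> \<le> (real CARD('d))\<^sup>2 * (a1 * (b + ?s)) / 2 + c"
    proof (rule second_order_step[OF G])
      fix i j f assume f: "f \<in> borel_measurable M" "\<And>x. x \<in> space M \<Longrightarrow> \<bar>f x\<bar> \<le> 2 * (2 * C)\<^sup>2" "(\<integral>x. f x \<partial>M) = 0"
      have "\<bar>\<integral>\<omega>. (\<lambda>l. G (l @ [j, i])) [] (S k \<omega>) * f (\<omega> (int k)) \<partial>P\<bar> \<le> K0 * (2 * (2 * C)\<^sup>2) * (b + ?s)"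
        by (rule mix[OF jet_append[OF G]]) (use b f m in auto)
      then show "\<bar>\<integral>\<omega>. G [j, i] (S k \<omega>) * f (\<omega> (int k)) \<partial>P\<bar> \<le> a1 * (b + ?s)"
        by (simp add: a1_def)
    qed (use inv G' in auto)
    have "\<bar>(\<integral>\<omega>. G [] (S (Suc k) \<omega>) \<partial>P) - (\<integral>\<omega>. G' (S k \<omega>) \<partial>P)\<bar>
       \<le> R ^ 4 * b / 24 + d ^ 3 * (a2 * (b + m k)) / 6 + (d\<^sup>2 * (a1 * (b + ?s)) / 2 + c)"
      using D split third second unfolding d_def[symmetric] by linarith
    also have "\<dots> \<le> R ^ 4 / 24 * (b + m k + ?s) + d ^ 3 * a2 / 6 * (b + m k + ?s) + (d\<^sup>2 * a1 / 2 * (b + m k + ?s) + c)"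
    proof (intro add_mono order_refl)
      show "R ^ 4 * b / 24 \<le> R ^ 4 / 24 * (b + m k + ?s)"
        using R_nonneg m0[of k] s0 mult_left_mono[of b "b + m k + ?s" "R ^ 4 / 24"] by simp
      show "d ^ 3 * (a2 * (b + m k)) / 6 \<le> d ^ 3 * a2 / 6 * (b + m k + ?s)"
        using nn s0 mult_left_mono[of "b + m k" "b + m k + ?s" "d ^ 3 * a2 / 6"] by (simp add: mult.assoc)
      show "d\<^sup>2 * (a1 * (b + ?s)) / 2 \<le> d\<^sup>2 * a1 / 2 * (b + m k + ?s)"
        using nn m0[of k] mult_left_mono[of "b + ?s" "b + m k + ?s" "d\<^sup>2 * a1 / 2"] by (simp add: mult.assoc)
    qed
    also have "\<dots> = K * (b + m k + ?s) + c" by (simp add: K_def algebra_simps)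
    finally show "\<bar>(\<integral>\<omega>. G [] (S (Suc k) \<omega>) \<partial>P) - (\<integral>\<omega>. G' (S k \<omega>) \<partial>P)\<bar> \<le> K * (b + m k + ?s) + c" .
  qed
qed

end

section \<open>Gaussian approximation of the martingale\<close>

lemma bdd_lipschitz_nonneg:
  fixes \<psi> :: "real^'d::finite \<Rightarrow> real"
  assumes "bdd_lipschitz L \<psi>" shows "0 \<le> L"
proof -
  have "\<bar>\<psi> (axis undefined 1) - \<psi> 0\<bar> \<le> L * norm (axis undefined (1::real) - 0 :: real^'d)"
    using assms unfolding bdd_lipschitz_def by blast
  from order_trans[OF abs_ge_zero this] show ?thesis by (simp add: norm_axis_1)
qed

text \<open>Functions that do not depend on the coordinate \<open>i\<close>.\<close>

definition inv_dir :: "'d::finite \<Rightarrow> (real^'d \<Rightarrow> real) \<Rightarrow> bool" where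
  "inv_dir i f \<longleftrightarrow> (\<forall>x \<theta>. f (x + \<theta> *\<^sub>R axis i 1) = f x)"

lemma inv_dir_heat: "inv_dir i f \<Longrightarrow> inv_dir i (heat t f)"
proof -
  assume f: "inv_dir i f"
  have "f (x + \<theta> *\<^sub>R axis i 1 + v) = f (x + v)" for x \<theta> v
    using f[unfolded inv_dir_def, rule_format, of "x + v" \<theta>] by (simp add: add_ac)
  then show ?thesis by (simp add: inv_dir_def heat_def)
qed

lemma inv_dir_dheat: "inv_dir i f \<Longrightarrow> inv_dir i (dheat j t f)"
proof -
  assume f: "inv_dir i f"
  have "f (x + \<theta> *\<^sub>R axis i 1 + v) = f (x + v)" for x \<theta> v
    using f[unfolded inv_dir_def, rule_format, of "x + v" \<theta>] by (simp add: add_ac)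
  then show ?thesis by (simp add: inv_dir_def dheat_def)
qed

lemma inv_dir_heat_jet: "inv_dir i \<psi> \<Longrightarrow> inv_dir i (heat_jet \<psi> l s)"
  by (induction l arbitrary: s) (auto intro: inv_dir_heat inv_dir_dheat)

lemma heat_jet_inv_dir_zero:
  assumes \<psi>: "bdd_lipschitz L \<psi>" and s: "0 < s" and inv: "inv_dir i \<psi>"
  shows "heat_jet \<psi> (i # l) s x = 0"
proof -
  have "((\<lambda>\<theta>. heat_jet \<psi> l s (x + \<theta> *\<^sub>R axis i 1)) has_real_derivative (\<Sum>j\<in>UNIV. axis i 1 $ j * heat_jet \<psi> (j # l) s x)) (at 0)"
    using jet_heat_jet[OF \<psi> s] by (simp add: jet_def)
  moreover have "(\<Sum>j\<in>UNIV. axis i 1 $ j * heat_jet \<psi> (j # l) s x) = heat_jet \<psi> (i # l) s x"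
    by (simp add: axis_def if_distrib[of "\<lambda>c. c * _"] cong: if_cong)
  moreover have "(\<lambda>\<theta>. heat_jet \<psi> l s (x + \<theta> *\<^sub>R axis i 1)) = (\<lambda>\<theta>. heat_jet \<psi> l s x)"
    using inv_dir_heat_jet[OF inv] by (simp add: inv_dir_def)
  ultimately show ?thesis
    using DERIV_unique[OF _ DERIV_const] by fastforce
qed

lemma heat_jet_step:
  fixes \<psi> :: "real^'d::finite \<Rightarrow> real"
  assumes \<psi>: "bdd_lipschitz L \<psi>" and s: "0 < s"
    and b: "\<And>l' x. length l' = length l + 4 \<Longrightarrow> \<bar>heat_jet \<psi> l' s x\<bar> \<le> b" "0 \<le> b"
  shows "\<bar>heat_jet \<psi> l (s + 1) x - heat_jet \<psi> l s x - (\<Sum>i\<in>UNIV. heat_jet \<psi> (i # i # l) s x) / 2\<bar> \<le> gauss_moment TYPE('d) 4 * b / 24"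
proof -
  have "\<bar>heat 1 ((\<lambda>l'. heat_jet \<psi> (l' @ l) s) []) x - (\<lambda>l'. heat_jet \<psi> (l' @ l) s) [] x
      - (\<Sum>i\<in>UNIV. (\<lambda>l'. heat_jet \<psi> (l' @ l) s) (i # i # []) x) / 2\<bar> \<le> gauss_moment TYPE('d) 4 * b / 24"
    by (rule heat_step[OF jet_append[OF jet_heat_jet[OF \<psi> s]]]) (use b in auto)
  then show ?thesis using heat_jet_semigroup_derivative[OF \<psi> s, of 1 l] by simp
qed

lemma heat_displacement:
  fixes \<psi> :: "real^'d::finite \<Rightarrow> real"
  assumes \<psi>: "bdd_lipschitz L \<psi>"
  shows "\<bar>heat 1 \<psi> x - \<psi> x\<bar> \<le> L * gauss_moment TYPE('d) 1"
proof -
  obtain B where B: "\<psi> \<in> borel_measurable borel" "\<And>x. \<bar>\<psi> x\<bar> \<le> B"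
    using bdd_lipschitz_bdd_borel[OF \<psi>] by (auto simp: bdd_meas_def)
  have i: "integrable std_gauss (\<lambda>w. \<psi> (x + w))"
    using heat_integrable[OF B, of x 1] by simp
  have "heat 1 \<psi> x - \<psi> x = (\<integral>w. \<psi> (x + w) - \<psi> x \<partial>std_gauss)"
    using i std_gauss.prob_space[where 'd='d] by (simp add: heat_def)
  also have "\<bar>\<dots>\<bar> \<le> (\<integral>w. \<bar>\<psi> (x + w) - \<psi> x\<bar> \<partial>std_gauss)" by (rule integral_abs_bound)
  also have "\<dots> \<le> (\<integral>w. L * (\<Sum>i\<in>UNIV. \<bar>(w::real^'d) $ i\<bar>) ^ 1 \<partial>std_gauss)"
  proof (rule integral_mono)
    show "integrable std_gauss (\<lambda>w. \<bar>\<psi> (x + w) - \<psi> x\<bar>)" using i by auto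
    show "integrable std_gauss (\<lambda>w. L * (\<Sum>i\<in>UNIV. \<bar>(w::real^'d) $ i\<bar>) ^ 1)"
      by (rule integrable_mult_right[OF std_gauss_integrable_sum_power])
    fix w :: "real^'d"
    have "\<bar>\<psi> (x + w) - \<psi> x\<bar> \<le> L * norm w" using \<psi> by (metis add_diff_cancel_left' bdd_lipschitz_def)
    also have "\<dots> \<le> L * (\<Sum>i\<in>UNIV. \<bar>w $ i\<bar>)"
      using norm_le_l1_cart bdd_lipschitz_nonneg[OF \<psi>] by (intro mult_left_mono)
    finally show "\<bar>\<psi> (x + w) - \<psi> x\<bar> \<le> L * (\<Sum>i\<in>UNIV. \<bar>w $ i\<bar>) ^ 1" by simp
  qed
  also have "\<dots> = L * gauss_moment TYPE('d) 1" by (simp add: gauss_moment_def)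
  finally show ?thesis .
qed

lemma bdd_lipschitz_heat:
  assumes "bdd_lipschitz L \<psi>" shows "bdd_lipschitz L (heat t \<psi>)"
proof -
  have "\<bar>heat t \<psi> x - heat t \<psi> y\<bar> \<le> L * norm (x - y)" for x y
    by (rule heat_lipschitz[OF bdd_lipschitz_bdd_borel[OF assms]]) (use assms in \<open>auto simp: bdd_lipschitz_def\<close>)
  then show ?thesis
    using bdd_borel_heat[OF bdd_lipschitz_bdd_borel[OF assms]] by (auto simp: bdd_lipschitz_def bdd_meas_def)
qed

lemma sum_tails:
  fixes f :: "nat \<Rightarrow> real"
  shows "(\<Sum>j<n. \<Sum>t\<in>{Suc j..<n}. f t) = (\<Sum>t<n. real t * f t)"
proof (induction n)
  case (Suc n)
  have "(\<Sum>j<Suc n. \<Sum>t\<in>{Suc j..<Suc n}. f t) = (\<Sum>j<n. \<Sum>t\<in>{Suc j..<Suc n}. f t)"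
    by simp
  also have "\<dots> = (\<Sum>j<n. (\<Sum>t\<in>{Suc j..<n}. f t) + f n)"
    by (intro sum.cong refl) (simp add: sum.atLeastLessThan_Suc)
  also have "\<dots> = (\<Sum>t<n. real t * f t) + real n * f n"
    by (simp add: sum.distrib Suc.IH)
  finally show ?case by simp
qed simp

context observed_chain
begin

text \<open>Comparing \<open>E D\<^sup>3 u s (S j)\<close> with \<open>D\<^sup>3 u (s + j) 0\<close> by \<open>j\<close> crude steps, whose errors
are of the size of sixth derivatives.\<close>

lemma third_derivative_bound:
  "\<exists>K\<ge>0. \<forall>L \<psi> l s j. bdd_lipschitz L \<psi> \<longrightarrow> (\<forall>i. i \<notin> J \<longrightarrow> inv_dir i \<psi>) \<longrightarrow> length l = 3 \<longrightarrow> 1 \<le> s \<longrightarrow>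
     \<bar>\<integral>\<omega>. heat_jet \<psi> l (real s) (S j \<omega>) \<partial>P\<bar> \<le> K * L * (1 / real (s + j) + (\<Sum>t\<in>{s..<s + j}. real t powr (- 5 / 2)))"
proof -
  obtain K0 where K0: "0 \<le> K0" and step_all: "\<forall>G G' b c k. jet G \<longrightarrow> (\<forall>i x. i \<notin> J \<longrightarrow> G [i, i] x = 0) \<longrightarrow>
     (\<forall>l x. length l = 3 \<longrightarrow> \<bar>G l x\<bar> \<le> b) \<longrightarrow> 0 \<le> b \<longrightarrow> bdd_borel G' \<longrightarrow>
     (\<forall>x. \<bar>G' x - G [] x - (\<Sum>i\<in>UNIV. G [i, i] x) / 2\<bar> \<le> c) \<longrightarrow>
     \<bar>(\<integral>\<omega>. G [] (S (Suc k) \<omega>) \<partial>P) - (\<integral>\<omega>. G' (S k \<omega>) \<partial>P)\<bar> \<le> K0 * b + c"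
    using third_order_crude_step by (elim exE conjE) (rule that)
  note step = step_all[rule_format]
  obtain C3 where C3: "0 \<le> C3" "\<And>L \<psi> l s x. bdd_lipschitz L \<psi> \<Longrightarrow> length l = Suc 2 \<Longrightarrow> 0 < s \<Longrightarrow>
     \<bar>heat_jet (\<psi> :: real^'d \<Rightarrow> real) l s x\<bar> \<le> C3 * L * s powr (- real 2 / 2)" using heat_jet_bound[of 2] by blast
  obtain C6 where C6: "0 \<le> C6" "\<And>L \<psi> l s x. bdd_lipschitz L \<psi> \<Longrightarrow> length l = Suc 5 \<Longrightarrow> 0 < s \<Longrightarrow>
     \<bar>heat_jet (\<psi> :: real^'d \<Rightarrow> real) l s x\<bar> \<le> C6 * L * s powr (- real 5 / 2)" using heat_jet_bound[of 5] by blast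
  obtain C7 where C7: "0 \<le> C7" "\<And>L \<psi> l s x. bdd_lipschitz L \<psi> \<Longrightarrow> length l = Suc 6 \<Longrightarrow> 0 < s \<Longrightarrow>
     \<bar>heat_jet (\<psi> :: real^'d \<Rightarrow> real) l s x\<bar> \<le> C7 * L * s powr (- real 6 / 2)" using heat_jet_bound[of 6] by blast
  define K1 where "K1 = K0 * C6 + gauss_moment TYPE('d) 4 * C7 / 24"
  have K1: "0 \<le> K1" using K0 C6(1) C7(1) gauss_moment_nonneg[where 'd='d] by (simp add: K1_def)
  show ?thesis
  proof (intro exI[of _ "C3 + K1"] conjI allI impI)
    show "0 \<le> C3 + K1" using C3(1) K1 by simp
    fix L and \<psi> :: "real^'d \<Rightarrow> real" and l :: "'d list" and s j :: nat
    assume \<psi>: "bdd_lipschitz L \<psi>" and inv: "\<forall>i. i \<notin> J \<longrightarrow> inv_dir i \<psi>" and l: "length l = 3" and s: "1 \<le> s"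
    have L: "0 \<le> L" by (rule bdd_lipschitz_nonneg[OF \<psi>])
    let ?U = "\<lambda>s. heat_jet \<psi> l (real s)"
    have one: "\<bar>(\<integral>\<omega>. ?U s (S (Suc k) \<omega>) \<partial>P) - (\<integral>\<omega>. ?U (Suc s) (S k \<omega>) \<partial>P)\<bar> \<le> K1 * L * real s powr (- 5 / 2)"
      if s: "1 \<le> s" for s k
    proof -
      have s0: "0 < real s" using s by simp
      let ?G = "\<lambda>l'. heat_jet \<psi> (l' @ l) (real s)"
      let ?b = "C6 * L * real s powr (- 5 / 2)" and ?b' = "C7 * L * real s powr (- 3)"
      have "\<bar>(\<integral>\<omega>. ?G [] (S (Suc k) \<omega>) \<partial>P) - (\<integral>\<omega>. ?U (Suc s) (S k \<omega>) \<partial>P)\<bar> \<le> K0 * ?b + gauss_moment TYPE('d) 4 * ?b' / 24"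
      proof (rule step[OF jet_append[OF jet_heat_jet[OF \<psi> s0]]])
        show "heat_jet \<psi> ([i, i] @ l) (real s) x = 0" if "i \<notin> J" for i x
          using heat_jet_inv_dir_zero[OF \<psi> s0, of i "[i] @ l" x] inv that by (auto simp del: heat_jet.simps)
        show "\<bar>heat_jet \<psi> (l' @ l) (real s) x\<bar> \<le> ?b" if "length l' = 3" for l' x
          using C6(2)[OF \<psi> _ s0, of "l' @ l" x] that l by simp
        show "0 \<le> ?b" using C6(1) L by simp
        show "bdd_borel (heat_jet \<psi> l (real (Suc s)))" by (rule heat_jet_bdd_borel[OF \<psi>]) simp
        show "\<bar>heat_jet \<psi> l (real (Suc s)) x - heat_jet \<psi> ([] @ l) (real s) x - (\<Sum>i\<in>UNIV. heat_jet \<psi> ([i, i] @ l) (real s) x) / 2\<bar>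
           \<le> gauss_moment TYPE('d) 4 * ?b' / 24" for x
          using heat_jet_step[OF \<psi> s0, of l ?b' x] C7(2)[OF \<psi> _ s0] l C7(1) L by (simp add: add.commute)
      qed
      also have "\<dots> \<le> K0 * ?b + gauss_moment TYPE('d) 4 * (C7 * L * real s powr (- 5 / 2)) / 24"
        using C7(1) L gauss_moment_nonneg[where 'd='d] s
        by (intro add_left_mono divide_right_mono mult_left_mono powr_mono) auto
      also have "\<dots> = K1 * L * real s powr (- 5 / 2)" by (simp add: K1_def algebra_simps)
      finally show ?thesis by simp
    qed
    have "\<bar>\<integral>\<omega>. ?U s (S j \<omega>) \<partial>P\<bar> \<le> C3 * L * (1 / real (s + j)) + K1 * L * (\<Sum>t\<in>{s..<s + j}. real t powr (- 5 / 2))"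
      using s
    proof (induction j arbitrary: s)
      case 0
      then show ?case
        using C3(2)[OF \<psi>, of l "real s" 0] l P.prob_space by (simp add: powr_minus_divide)
    next
      case (Suc j)
      have "\<bar>\<integral>\<omega>. ?U s (S (Suc j) \<omega>) \<partial>P\<bar> \<le> K1 * L * real s powr (- 5 / 2)
         + (C3 * L * (1 / real (Suc s + j)) + K1 * L * (\<Sum>t\<in>{Suc s..<Suc s + j}. real t powr (- 5 / 2)))"
        using one[OF Suc.prems, of j] Suc.IH[of "Suc s"] by linarith
      also have "\<dots> = C3 * L * (1 / real (s + Suc j)) + K1 * L * (real s powr (- 5 / 2) + (\<Sum>t\<in>{Suc s..<s + Suc j}. real t powr (- 5 / 2)))"
        by (simp add: algebra_simps)
      also have "real s powr (- 5 / 2) + (\<Sum>t\<in>{Suc s..<s + Suc j}. real t powr (- 5 / 2)) = (\<Sum>t\<in>{s..<s + Suc j}. real t powr (- 5 / 2))"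
        by (rule sum.atLeast_Suc_lessThan[symmetric]) simp
      finally show ?case .
    qed
    also have "\<dots> \<le> (C3 + K1) * L * (1 / real (s + j)) + (C3 + K1) * L * (\<Sum>t\<in>{s..<s + j}. real t powr (- 5 / 2))"
      using C3(1) K1 L by (intro add_mono mult_right_mono sum_nonneg) auto
    also have "\<dots> = (C3 + K1) * L * (1 / real (s + j) + (\<Sum>t\<in>{s..<s + j}. real t powr (- 5 / 2)))"
      by (simp only: distrib_left)
    finally show "\<bar>\<integral>\<omega>. ?U s (S j \<omega>) \<partial>P\<bar> \<le> (C3 + K1) * L * (1 / real (s + j) + (\<Sum>t\<in>{s..<s + j}. real t powr (- 5 / 2)))" .
  qed
qed

lemma summable_weights: "summable (\<lambda>i. real (i + 2) * (1 - \<alpha>) ^ i)"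
proof -
  have "summable (\<lambda>n. real (Suc n) * (1 - \<alpha>) ^ n)"
    using \<alpha> sums_summable[OF geometric_deriv_sums[of "1 - \<alpha>"]] by simp
  moreover have "summable (\<lambda>n. (1 - \<alpha>) ^ n)" using \<alpha> by (intro summable_geometric) auto
  ultimately have "summable (\<lambda>n. real (Suc n) * (1 - \<alpha>) ^ n + (1 - \<alpha>) ^ n)" by (rule summable_add)
  then show ?thesis by (simp add: algebra_simps)
qed

text \<open>The weights \<open>(1 - \<alpha>) ^ i\<close> decay fast enough for the sum of the \<open>1 / (N - 1 - i)\<close> to be of order
\<open>1 / N\<close>.\<close>

lemma weighted_reciprocals:
  assumes "k < N"
  shows "(\<Sum>i<k. (1 - \<alpha>) ^ i * (1 / real (N - 1 - i))) \<le> (\<Sum>i. real (i + 2) * (1 - \<alpha>) ^ i) / real N"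
proof -
  have "(\<Sum>i<k. (1 - \<alpha>) ^ i * (1 / real (N - 1 - i))) \<le> (\<Sum>i<k. (1 - \<alpha>) ^ i * (real (i + 2) / real N))"
  proof (intro sum_mono mult_left_mono)
    fix i assume "i \<in> {..<k}"
    then have i: "i + 2 \<le> N" using assms by simp
    then obtain p where p: "N = i + 2 + p" using le_Suc_ex by blast
    \<comment> \<open>The difference of the two sides is \<open>(i + 1) p\<close> when \<open>N = i + 2 + p\<close>.\<close>
    have "real N \<le> real (i + 2) * real (N - 1 - i)"
      unfolding p by (simp add: algebra_simps)
    then show "1 / real (N - 1 - i) \<le> real (i + 2) / real N"
      using p by (simp add: field_simps)
  qed (use \<alpha> in auto)
  also have "\<dots> = (\<Sum>i<k. real (i + 2) * (1 - \<alpha>) ^ i) / real N"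
    by (simp add: sum_divide_distrib mult_ac)
  also have "\<dots> \<le> (\<Sum>i. real (i + 2) * (1 - \<alpha>) ^ i) / real N"
    using \<alpha> by (intro divide_right_mono sum_le_suminf summable_weights) auto
  finally show ?thesis .
qed

text \<open>The martingale is tested against \<open>heat 1 \<psi>\<close> rather than \<open>\<psi>\<close>, so that every step of the
telescoping sum takes place at a time \<open>s \<ge> 1\<close> of the heat flow.\<close>

lemma smoothed_chain_bound:
  "\<exists>K\<ge>0. \<forall>L \<psi> N. bdd_lipschitz L \<psi> \<longrightarrow> (\<forall>i. i \<notin> J \<longrightarrow> inv_dir i \<psi>) \<longrightarrow> 1 \<le> N \<longrightarrow>
     \<bar>(\<integral>\<omega>. heat 1 \<psi> (S N \<omega>) \<partial>P) - heat (real (Suc N)) \<psi> 0\<bar> \<le> K * L"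
proof -
  obtain K3 where K3: "0 \<le> K3" and third_all: "\<forall>L \<psi> l s j. bdd_lipschitz L \<psi> \<longrightarrow> (\<forall>i. i \<notin> J \<longrightarrow> inv_dir i \<psi>) \<longrightarrow> length l = 3 \<longrightarrow> 1 \<le> s \<longrightarrow>
     \<bar>\<integral>\<omega>. heat_jet \<psi> l (real s) (S j \<omega>) \<partial>P\<bar> \<le> K3 * L * (1 / real (s + j) + (\<Sum>t\<in>{s..<s + j}. real t powr (- 5 / 2)))"
    using third_derivative_bound by (elim exE conjE) (rule that)
  note third = third_all[rule_format]
  obtain K4 where K4: "0 \<le> K4" and step_all: "\<forall>G G' b c m k. jet G \<longrightarrow> (\<forall>i x. i \<notin> J \<longrightarrow> G [i, i] x = 0) \<longrightarrow>
     (\<forall>l x. length l = 4 \<longrightarrow> \<bar>G l x\<bar> \<le> b) \<longrightarrow> 0 \<le> b \<longrightarrow> bdd_borel G' \<longrightarrow>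
     (\<forall>x. \<bar>G' x - G [] x - (\<Sum>i\<in>UNIV. G [i, i] x) / 2\<bar> \<le> c) \<longrightarrow>
     (\<forall>j l. length l = 3 \<longrightarrow> \<bar>\<integral>\<omega>. G l (S j \<omega>) \<partial>P\<bar> \<le> m j) \<longrightarrow>
     \<bar>(\<integral>\<omega>. G [] (S (Suc k) \<omega>) \<partial>P) - (\<integral>\<omega>. G' (S k \<omega>) \<partial>P)\<bar>
       \<le> K4 * (b + m k + (\<Sum>i<k. (1 - \<alpha>) ^ i * m (k - 1 - i))) + c"
    using fourth_order_step by (elim exE conjE) (rule that)
  note step = step_all[rule_format]
  obtain C4 where C4: "0 \<le> C4" "\<And>L \<psi> l s x. bdd_lipschitz L \<psi> \<Longrightarrow> length l = Suc 3 \<Longrightarrow> 0 < s \<Longrightarrow>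
     \<bar>heat_jet (\<psi> :: real^'d \<Rightarrow> real) l s x\<bar> \<le> C4 * L * s powr (- real 3 / 2)" using heat_jet_bound[of 3] by blast
  define g4 where "g4 = gauss_moment TYPE('d) 4 / 24"
  define Z where "Z = (\<Sum>t. real t powr (- 3 / 2))"
  define cr where "cr = (\<Sum>i. real (i + 2) * (1 - \<alpha>) ^ i)"
  have g40: "0 \<le> g4" using gauss_moment_nonneg by (simp add: g4_def)
  have sumZ: "summable (\<lambda>t. real t powr (- 3 / 2))" by (simp add: summable_real_powr_iff)
  have Z0: "0 \<le> Z" unfolding Z_def by (rule suminf_nonneg[OF sumZ]) simp
  have cr0: "0 \<le> cr" unfolding cr_def using \<alpha> by (intro suminf_nonneg summable_weights) auto
  define Kb where "Kb = (K4 + g4) * C4"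
  define Km where "Km = K4 * K3"
  have Kb0: "0 \<le> Kb" and Km0: "0 \<le> Km" using K4 g40 C4(1) K3 by (auto simp: Kb_def Km_def)
  define K where "K = Kb * Z + Km * (1 + cr) + Km * (1 + 1 / \<alpha>) * Z"
  show ?thesis
  proof (intro exI[of _ K] conjI allI impI)
    show "0 \<le> K" using Kb0 Km0 Z0 cr0 \<alpha> by (simp add: K_def)
    fix L and \<psi> :: "real^'d \<Rightarrow> real" and N :: nat
    assume \<psi>: "bdd_lipschitz L \<psi>" and inv: "\<forall>i. i \<notin> J \<longrightarrow> inv_dir i \<psi>" and N: "1 \<le> N"
    have L: "0 \<le> L" by (rule bdd_lipschitz_nonneg[OF \<psi>])
    define a where "a k = (\<integral>\<omega>. heat (real (Suc N - k)) \<psi> (S k \<omega>) \<partial>P)" for k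
    define W where "W s = (\<Sum>t\<in>{s..<N}. real t powr (- 5 / 2))" for s
    have W0: "0 \<le> W s" for s by (simp add: W_def sum_nonneg)
    let ?e = "\<lambda>s. Kb * L * real s powr (- 3 / 2) + (Km * (1 + cr) * L / real N + Km * (1 + 1 / \<alpha>) * L * W s)"
    have one: "\<bar>a (Suc k) - a k\<bar> \<le> ?e (N - k)" if k: "k < N" for k
    proof -
      define s where "s = N - k"
      have s: "1 \<le> s" "s + k = N" using k by (auto simp: s_def)
      have s0: "0 < real s" using s by simp
      let ?b = "C4 * L * real s powr (- 3 / 2)"
      let ?m = "\<lambda>j. K3 * L * (1 / real (s + j) + (\<Sum>t\<in>{s..<s + j}. real t powr (- 5 / 2)))"
      let ?G = "\<lambda>l'. heat_jet \<psi> l' (real s)"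
      have "\<bar>(\<integral>\<omega>. ?G [] (S (Suc k) \<omega>) \<partial>P) - (\<integral>\<omega>. heat_jet \<psi> [] (real s + 1) (S k \<omega>) \<partial>P)\<bar>
          \<le> K4 * (?b + ?m k + (\<Sum>i<k. (1 - \<alpha>) ^ i * ?m (k - 1 - i))) + g4 * ?b"
      proof (rule step[OF jet_heat_jet[OF \<psi> s0]])
        show "heat_jet \<psi> [i, i] (real s) x = 0" if "i \<notin> J" for i x
          using heat_jet_inv_dir_zero[OF \<psi> s0, of i "[i]" x] inv that by (auto simp del: heat_jet.simps)
        show B: "\<bar>heat_jet \<psi> l (real s) x\<bar> \<le> ?b" if "length l = 4" for l x
          using C4(2)[OF \<psi> _ s0, of l x] that by simp
        show b0: "0 \<le> ?b" using C4(1) L by simp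
        show "bdd_borel (heat_jet \<psi> [] (real s + 1))" by (rule heat_jet_bdd_borel[OF \<psi>]) simp
        show "\<bar>heat_jet \<psi> [] (real s + 1) x - heat_jet \<psi> [] (real s) x - (\<Sum>i\<in>UNIV. heat_jet \<psi> [i, i] (real s) x) / 2\<bar> \<le> g4 * ?b" for x
          using heat_jet_step[OF \<psi> s0, of "[]" ?b x] B b0 by (simp add: g4_def)
        show "\<bar>\<integral>\<omega>. heat_jet \<psi> l (real s) (S j \<omega>) \<partial>P\<bar> \<le> ?m j" if "length l = 3" for j l
          by (rule third) (use \<psi> inv that s in auto)
      qed
      also have "\<dots> \<le> K4 * (?b + K3 * L * (1 / real N + W s) + K3 * L * (cr / real N + W s / \<alpha>)) + g4 * ?b"
      proof -
        have A: "?m k \<le> K3 * L * (1 / real N + W s)" using s by (simp add: W_def)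
        have "(\<Sum>i<k. (1 - \<alpha>) ^ i * ?m (k - 1 - i)) \<le> (\<Sum>i<k. (1 - \<alpha>) ^ i * (K3 * L * (1 / real (N - 1 - i) + W s)))"
        proof (intro sum_mono mult_left_mono)
          fix i assume i: "i \<in> {..<k}"
          then have e: "s + (k - 1 - i) = N - 1 - i" using s by auto
          have "(\<Sum>t\<in>{s..<N - 1 - i}. real t powr (- 5 / 2)) \<le> W s"
            unfolding W_def by (rule sum_mono2) auto
          then show "1 / real (s + (k - 1 - i)) + (\<Sum>t\<in>{s..<s + (k - 1 - i)}. real t powr (- 5 / 2)) \<le> 1 / real (N - 1 - i) + W s"
            unfolding e by simp
        qed (use \<alpha> K3 L in auto)
        also have "\<dots> = K3 * L * ((\<Sum>i<k. (1 - \<alpha>) ^ i * (1 / real (N - 1 - i))) + W s * (\<Sum>i<k. (1 - \<alpha>) ^ i))"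
          by (simp add: sum_distrib_left sum.distrib algebra_simps)
        also have "\<dots> \<le> K3 * L * (cr / real N + W s * (1 / \<alpha>))"
        proof (intro mult_left_mono add_mono)
          show "(\<Sum>i<k. (1 - \<alpha>) ^ i * (1 / real (N - 1 - i))) \<le> cr / real N"
            unfolding cr_def by (rule weighted_reciprocals[OF k])
          have "(\<Sum>i<k. (1 - \<alpha>) ^ i) \<le> (\<Sum>i. (1 - \<alpha>) ^ i)"
            using \<alpha> by (intro sum_le_suminf summable_geometric) auto
          also have "\<dots> = 1 / \<alpha>" using \<alpha> by (subst suminf_geometric) auto
          finally show "(\<Sum>i<k. (1 - \<alpha>) ^ i) \<le> 1 / \<alpha>" .
        qed (use K3 L W0 in auto)
        finally have B: "(\<Sum>i<k. (1 - \<alpha>) ^ i * ?m (k - 1 - i)) \<le> K3 * L * (cr / real N + W s / \<alpha>)" by simp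
        have "?b + ?m k + (\<Sum>i<k. (1 - \<alpha>) ^ i * ?m (k - 1 - i))
            \<le> ?b + K3 * L * (1 / real N + W s) + K3 * L * (cr / real N + W s / \<alpha>)"
          by (rule add_mono[OF add_left_mono[OF A] B])
        from mult_left_mono[OF this K4] show ?thesis by (rule add_right_mono)
      qed
      also have "\<dots> = ?e s"
      proof -
        have "K4 * (?b + K3 * L * (x + w) + K3 * L * (cr * x + w * y)) + g4 * ?b
          = Kb * L * real s powr (- 3 / 2) + (Km * (1 + cr) * L * x + Km * (1 + y) * L * w)" for x w y
          unfolding Kb_def Km_def by algebra
        from this[of "1 / real N" "W s" "1 / \<alpha>"] show ?thesis by (simp only: times_divide_eq_right mult_1_right)
      qed
      finally have "\<bar>(\<integral>\<omega>. ?G [] (S (Suc k) \<omega>) \<partial>P) - (\<integral>\<omega>. heat_jet \<psi> [] (real s + 1) (S k \<omega>) \<partial>P)\<bar> \<le> ?e s" .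
      moreover have "real (Suc N - Suc k) = real s" "real (Suc N - k) = real s + 1"
        using k by (auto simp: s_def)
      ultimately show ?thesis unfolding a_def s_def[symmetric] by (simp only: heat_jet.simps)
    qed
    have "a N - a 0 = (\<Sum>k<N. a (Suc k) - a k)" by (simp add: sum_lessThan_telescope)
    also have "\<bar>\<dots>\<bar> \<le> (\<Sum>k<N. ?e (N - k))"
      by (rule order_trans[OF sum_abs sum_mono]) (use one in auto)
    also have "\<dots> = (\<Sum>k<N. ?e (Suc (N - Suc k)))"
      by (intro sum.cong refl) (simp add: Suc_diff_Suc)
    also have "\<dots> = (\<Sum>j<N. ?e (Suc j))"
      by (rule sum.nat_diff_reindex[of "\<lambda>j. ?e (Suc j)"])
    also have "\<dots> = Kb * L * (\<Sum>j<N. real (Suc j) powr (- 3 / 2)) + (\<Sum>j<N. Km * (1 + cr) * L / real N)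
        + Km * (1 + 1 / \<alpha>) * L * (\<Sum>j<N. W (Suc j))"
      by (simp only: sum.distrib sum_distrib_left add.assoc)
    also have "\<dots> \<le> Kb * L * Z + Km * (1 + cr) * L + Km * (1 + 1 / \<alpha>) * L * Z"
    proof (intro add_mono mult_left_mono)
      have "(\<Sum>j<N. real (Suc j) powr (- 3 / 2)) \<le> (\<Sum>t<Suc N. real t powr (- 3 / 2))"
        by (subst sum.lessThan_Suc_shift) simp
      also have "\<dots> \<le> Z" unfolding Z_def by (intro sum_le_suminf sumZ) auto
      finally show "(\<Sum>j<N. real (Suc j) powr (- 3 / 2)) \<le> Z" .
      have "(\<Sum>j<N. W (Suc j)) = (\<Sum>t<N. real t * real t powr (- 5 / 2))"
        unfolding W_def by (rule sum_tails)
      also have "\<dots> = (\<Sum>t<N. real t powr (- 3 / 2))"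
      proof (intro sum.cong refl)
        fix t :: nat
        show "real t * real t powr (- 5 / 2) = real t powr (- 3 / 2)"
          using powr_mult_base[of "real t" "- 5 / 2"] by simp
      qed
      also have "\<dots> \<le> Z" unfolding Z_def by (intro sum_le_suminf sumZ) auto
      finally show "(\<Sum>j<N. W (Suc j)) \<le> Z" .
    qed (use N Kb0 Km0 L cr0 \<alpha> in auto)
    also have "\<dots> = K * L" by (simp add: K_def algebra_simps)
    finally have "\<bar>a N - a 0\<bar> \<le> K * L" .
    moreover have "a N = (\<integral>\<omega>. heat 1 \<psi> (S N \<omega>) \<partial>P)" by (simp add: a_def)
    moreover have "a 0 = heat (real (Suc N)) \<psi> 0" using P.prob_space by (simp add: a_def)
    ultimately show "\<bar>(\<integral>\<omega>. heat 1 \<psi> (S N \<omega>) \<partial>P) - heat (real (Suc N)) \<psi> 0\<bar> \<le> K * L" by simp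
  qed
qed

lemma martingale_bound:
  "\<exists>K\<ge>0. \<forall>L \<psi> N. bdd_lipschitz L \<psi> \<longrightarrow> (\<forall>i. i \<notin> J \<longrightarrow> inv_dir i \<psi>) \<longrightarrow> 1 \<le> N \<longrightarrow>
     \<bar>(\<integral>\<omega>. \<psi> (S N \<omega>) \<partial>P) - heat (real N) \<psi> 0\<bar> \<le> K * L"
proof -
  obtain K where K: "0 \<le> K" and all: "\<forall>L \<psi> N. bdd_lipschitz L \<psi> \<longrightarrow> (\<forall>i. i \<notin> J \<longrightarrow> inv_dir i \<psi>) \<longrightarrow> 1 \<le> N \<longrightarrow>
     \<bar>(\<integral>\<omega>. heat 1 \<psi> (S N \<omega>) \<partial>P) - heat (real (Suc N)) \<psi> 0\<bar> \<le> K * L"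
    using smoothed_chain_bound by (elim exE conjE) (rule that)
  let ?g = "gauss_moment TYPE('d) 1"
  show ?thesis
  proof (intro exI[of _ "K + 2 * ?g"] conjI allI impI)
    show "0 \<le> K + 2 * ?g" using K gauss_moment_nonneg[where 'd='d] by simp
    fix L and \<psi> :: "real^'d \<Rightarrow> real" and N :: nat
    assume \<psi>: "bdd_lipschitz L \<psi>" and inv: "\<forall>i. i \<notin> J \<longrightarrow> inv_dir i \<psi>" and N: "1 \<le> N"
    have 1: "\<bar>(\<integral>\<omega>. heat 1 \<psi> (S N \<omega>) \<partial>P) - heat (real (Suc N)) \<psi> 0\<bar> \<le> K * L"
      using all \<psi> inv N by blast
    have b: "bdd_meas P (\<lambda>\<omega>. heat 1 \<psi> (S N \<omega>))" "bdd_meas P (\<lambda>\<omega>. \<psi> (S N \<omega>))"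
      by (intro bdd_meas_S bdd_borel_heat bdd_lipschitz_bdd_borel[OF \<psi>])+
    have "\<bar>\<integral>\<omega>. heat 1 \<psi> (S N \<omega>) - \<psi> (S N \<omega>) \<partial>P\<bar> \<le> L * ?g"
      using bdd_meas_diff[OF b] heat_displacement[OF \<psi>]
      by (intro expectation_bound_P) (auto simp: bdd_meas_def)
    then have 2: "\<bar>(\<integral>\<omega>. heat 1 \<psi> (S N \<omega>) \<partial>P) - (\<integral>\<omega>. \<psi> (S N \<omega>) \<partial>P)\<bar> \<le> L * ?g"
      using P.bdd_meas_integrable[OF b(1)] P.bdd_meas_integrable[OF b(2)] by simp
    have "heat 1 (heat (real N) \<psi>) 0 = heat (real (Suc N)) \<psi> 0"
      using heat_heat[OF \<psi>, of 1 "real N"] by simp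
    then have 3: "\<bar>heat (real (Suc N)) \<psi> 0 - heat (real N) \<psi> 0\<bar> \<le> L * ?g"
      using heat_displacement[OF bdd_lipschitz_heat[OF \<psi>], of "real N" 0] by simp
    have "(K + 2 * ?g) * L = K * L + L * ?g + L * ?g" by (simp add: algebra_simps)
    with 1 2 3 show "\<bar>(\<integral>\<omega>. \<psi> (S N \<omega>) \<partial>P) - heat (real N) \<psi> 0\<bar> \<le> (K + 2 * ?g) * L"
      by linarith
  qed
qed

end

section \<open>Orthonormal coordinates and the corrector\<close>

text \<open>Gram--Schmidt in \<open>L\<^sup>2\<close> without an independence assumption: where a coordinate depends on the
previous ones, the new vector is zero.\<close>

lemma (in prob_space) gram_schmidt:
  fixes h :: "'d::finite \<Rightarrow> 'a \<Rightarrow> real"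
  assumes h: "\<And>i. bdd_meas M (h i)" "\<And>i. (\<integral>x. h i x \<partial>M) = 0"
  obtains e :: "'d \<Rightarrow> 'a \<Rightarrow> real" and J :: "'d set" where "\<And>i. bdd_meas M (e i)" "\<And>i. (\<integral>x. e i x \<partial>M) = 0"
    "\<And>i j. (\<integral>x. e i x * e j x \<partial>M) = (if i = j \<and> i \<in> J then 1 else 0)"
    "\<And>i. i \<notin> J \<Longrightarrow> e i = (\<lambda>_. 0)"
    "\<And>i. AE x in M. h i x = (\<Sum>j\<in>UNIV. (\<integral>y. h i y * e j y \<partial>M) * e j x)"
proof -
  let ?ip = "\<lambda>f g. \<integral>x. f x * g x \<partial>M"
  have int: "integrable M (\<lambda>x. f x * g x)" if "bdd_meas M f" "bdd_meas M g" for f g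
    by (intro bdd_meas_integrable bdd_meas_mult that)
  have ip_comb: "?ip (\<lambda>x. \<Sum>j\<in>UNIV. c j * e j x) g = (\<Sum>j\<in>UNIV. c j * ?ip (e j) g)"
    if "\<And>j. bdd_meas M (e j)" "bdd_meas M g" for c and e :: "'d \<Rightarrow> 'a \<Rightarrow> real" and g
    using int[OF that] by (simp add: sum_distrib_right mult.assoc Bochner_Integration.integral_sum)
  have "\<exists>e J. (\<forall>i. bdd_meas M (e i)) \<and> (\<forall>i. (\<integral>x. e i x \<partial>M) = 0) \<and> J \<subseteq> I
     \<and> (\<forall>i j. ?ip (e i) (e j) = (if i = j \<and> i \<in> J then 1 else 0)) \<and> (\<forall>i. i \<notin> J \<longrightarrow> e i = (\<lambda>_. 0))
     \<and> (\<forall>i\<in>I. AE x in M. h i x = (\<Sum>j\<in>UNIV. ?ip (h i) (e j) * e j x))" if "finite I" for I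
    using that
  proof induction
    case empty
    show ?case by (rule exI[of _ "\<lambda>_ _. 0"], rule exI[of _ "{}"]) (auto simp: bdd_meas_const)
  next
    case (insert k I)
    from insert.IH obtain e J where IH: "(\<forall>i. bdd_meas M (e i)) \<and> (\<forall>i. (\<integral>x. e i x \<partial>M) = 0) \<and> J \<subseteq> I
     \<and> (\<forall>i j. ?ip (e i) (e j) = (if i = j \<and> i \<in> J then 1 else 0)) \<and> (\<forall>i. i \<notin> J \<longrightarrow> e i = (\<lambda>_. 0))
     \<and> (\<forall>i\<in>I. AE x in M. h i x = (\<Sum>j\<in>UNIV. ?ip (h i) (e j) * e j x))"
      by (elim exE) (rule that)
    have e: "\<And>i. bdd_meas M (e i)" "\<And>i. (\<integral>x. e i x \<partial>M) = 0" "J \<subseteq> I"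
      and on: "\<And>i j. ?ip (e i) (e j) = (if i = j \<and> i \<in> J then 1 else 0)"
      and z: "\<And>i. i \<notin> J \<Longrightarrow> e i = (\<lambda>_. 0)"
      and ex: "\<And>i. i \<in> I \<Longrightarrow> AE x in M. h i x = (\<Sum>j\<in>UNIV. ?ip (h i) (e j) * e j x)"
      using IH by blast+
    define q where "q x = (\<Sum>j\<in>UNIV. ?ip (h k) (e j) * e j x)" for x
    define p where "p x = h k x - q x" for x
    have bq: "bdd_meas M q" unfolding q_def[abs_def] by (intro bdd_meas_sum bdd_meas_mult bdd_meas_const e)
    have bp: "bdd_meas M p" unfolding p_def[abs_def] by (intro bdd_meas_diff h bq)
    have [measurable]: "p \<in> borel_measurable M" "h i \<in> borel_measurable M" "e i \<in> borel_measurable M" for i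
      using bp h(1) e(1) by (simp_all add: bdd_meas_def)
    have pe: "?ip p (e j) = 0" for j
    proof -
      have "?ip p (e j) = ?ip (h k) (e j) - ?ip q (e j)"
        using int[OF h(1)[of k] e(1)[of j]] int[OF bq e(1)[of j]] by (simp add: p_def left_diff_distrib)
      also have "?ip q (e j) = (\<Sum>l\<in>UNIV. ?ip (h k) (e l) * ?ip (e l) (e j))"
        unfolding q_def by (rule ip_comb[OF e(1) e(1)])
      also have "\<dots> = (\<Sum>l\<in>UNIV. if l = j then ?ip (h k) (e j) * ?ip (e j) (e j) else 0)"
        by (rule sum.cong) (auto simp: on)
      also have "\<dots> = ?ip (h k) (e j)" using z[of j] by (cases "j \<in> J") (auto simp: on)
      finally show ?thesis by simp
    qed
    have qp: "?ip q p = 0"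
    proof -
      have "?ip q p = (\<Sum>l\<in>UNIV. ?ip (h k) (e l) * ?ip (e l) p)"
        unfolding q_def by (rule ip_comb[OF e(1) bp])
      then show ?thesis using pe by (simp add: mult.commute[of "e _ _"])
    qed
    have hip: "?ip (h i) p = 0" if "i \<in> I" for i
    proof -
      have "?ip (h i) p = ?ip (\<lambda>x. \<Sum>j\<in>UNIV. ?ip (h i) (e j) * e j x) p"
        using ex[OF that] h(1) e(1) by (intro integral_cong_AE) (auto simp: bdd_meas_def)
      also have "\<dots> = (\<Sum>j\<in>UNIV. ?ip (h i) (e j) * ?ip (e j) p)" by (rule ip_comb[OF e(1) bp])
      finally show ?thesis using pe by (simp add: mult.commute[of "e _ _"])
    qed
    have hkp: "?ip (h k) p = ?ip p p"
    proof -
      have "?ip (h k) p = ?ip p p + ?ip q p"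
        using int[OF bp bp] int[OF bq bp] by (subst Bochner_Integration.integral_add[symmetric]) (auto simp: p_def algebra_simps)
      then show ?thesis using qp by simp
    qed
    have mp: "(\<integral>x. p x \<partial>M) = 0"
    proof -
      have "(\<integral>x. q x \<partial>M) = 0" unfolding q_def
        using bdd_meas_integrable[OF e(1)] e(2) by (subst Bochner_Integration.integral_sum) auto
      then show ?thesis unfolding p_def using bdd_meas_integrable[OF h(1)] bdd_meas_integrable[OF bq] h(2)
        by (subst Bochner_Integration.integral_diff) auto
    qed
    show ?case
    proof (cases "?ip p p = 0")
      case True
      have "AE x in M. p x * p x = 0"
        using True int[OF bp bp] by (subst integral_nonneg_eq_0_iff_AE[symmetric]) auto
      then have "AE x in M. h k x = (\<Sum>j\<in>UNIV. ?ip (h k) (e j) * e j x)"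
        by eventually_elim (simp add: p_def q_def)
      then show ?thesis using e on z ex
        by (intro exI[of _ e] exI[of _ J]) auto
    next
      case False
      have nn: "0 \<le> ?ip p p" by (rule Bochner_Integration.integral_nonneg) simp
      have pos: "0 < ?ip p p" using nn False by (simp only: less_le) metis
      define v where "v = sqrt (?ip p p)"
      have v: "0 < v" "v * v = ?ip p p" using pos by (auto simp: v_def)
      have kJ: "k \<notin> J" using insert e(3) by auto
      let ?e = "e(k := \<lambda>x. p x / v)"
      have be: "bdd_meas M (?e i)" for i
        using e(1) bdd_meas_mult[OF bp bdd_meas_const, of "1 / v"] by simp
      have ipk: "?ip f (?e k) = ?ip f p / v" for f by simp
      have ex': "AE x in M. h i x = (\<Sum>j\<in>UNIV. ?ip (h i) (?e j) * ?e j x)" if "i \<in> insert k I" for i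
      proof -
        have split: "(\<Sum>j\<in>UNIV. ?ip (h i) (?e j) * ?e j x) = (\<Sum>j\<in>UNIV. ?ip (h i) (e j) * e j x) + ?ip (h i) p / v * (p x / v)" for x
        proof -
          have "(\<Sum>j\<in>UNIV. ?ip (h i) (?e j) * ?e j x) = ?ip (h i) (?e k) * ?e k x + (\<Sum>j\<in>UNIV - {k}. ?ip (h i) (?e j) * ?e j x)"
            by (rule sum.remove) auto
          also have "(\<Sum>j\<in>UNIV - {k}. ?ip (h i) (?e j) * ?e j x) = (\<Sum>j\<in>UNIV - {k}. ?ip (h i) (e j) * e j x)"
            by (rule sum.cong) auto
          also have "\<dots> = (\<Sum>j\<in>UNIV. ?ip (h i) (e j) * e j x)"
            using sum.remove[of UNIV k "\<lambda>j. ?ip (h i) (e j) * e j x"] z[OF kJ] by simp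
          finally show ?thesis by simp
        qed
        show ?thesis
        proof (cases "i = k")
          case True
          have hk: "h k x = (\<Sum>j\<in>UNIV. ?ip (h k) (e j) * e j x) + ?ip (h k) p / v * (p x / v)" for x
          proof -
            have "?ip (h k) p / v * (p x / v) = p x" using v False unfolding hkp by (simp add: v(2)[symmetric])
            then show ?thesis by (simp add: p_def q_def)
          qed
          show ?thesis unfolding split unfolding True by (rule AE_I2) (rule hk)
        next
          case False
          then have "i \<in> I" using that by simp
          then show ?thesis using ex[of i] hip[of i] by (simp only: split) simp
        qed
      qed
      have on': "?ip (?e i) (?e j) = (if i = j \<and> i \<in> insert k J then 1 else 0)" for i j
      proof (cases "i = k"; cases "j = k")
        assume "i = k" "j = k"
        moreover have "?ip (\<lambda>x. p x / v) (\<lambda>x. p x / v) = ?ip p p / (v * v)"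
          by simp
        ultimately show ?thesis using v False by simp
      next
        assume "i = k" "j \<noteq> k" then show ?thesis using pe[of j] by simp
      next
        assume "i \<noteq> k" "j = k" then show ?thesis using pe[of i] by (simp add: mult.commute[of "e _ _"])
      next
        assume "i \<noteq> k" "j \<noteq> k" then show ?thesis using on[of i j] by auto
      qed
      show ?thesis
      proof (intro exI[of _ ?e] exI[of _ "insert k J"] conjI allI impI ballI)
        show "(\<integral>x. ?e i x \<partial>M) = 0" for i using e(2) mp by (cases "i = k") auto
        show "insert k J \<subseteq> insert k I" using e(3) by auto
        show "?e i = (\<lambda>_. 0)" if "i \<notin> insert k J" for i using that z by auto
      qed (use be on' ex' in blast)+
    qed
  qed
  from this[OF finite_class.finite_UNIV]
  obtain e :: "'d \<Rightarrow> 'a \<Rightarrow> real" and J :: "'d set" where E: "(\<forall>i. bdd_meas M (e i)) \<and> (\<forall>i. (\<integral>x. e i x \<partial>M) = 0) \<and> J \<subseteq> UNIV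
     \<and> (\<forall>i j. ?ip (e i) (e j) = (if i = j \<and> i \<in> J then 1 else 0)) \<and> (\<forall>i. i \<notin> J \<longrightarrow> e i = (\<lambda>_. 0))
     \<and> (\<forall>i\<in>UNIV. AE x in M. h i x = (\<Sum>j\<in>UNIV. ?ip (h i) (e j) * e j x))"
    by (elim exE) (rule that)
  show thesis by (rule that[of e J]) (use E in blast)+
qed

context resampling_chain
begin

lemma funpow_T_measurable [measurable]: "T ^^ n \<in> M \<rightarrow>\<^sub>M M"
  by (induction n) (auto intro: measurable_compose[OF _ measurable_T] simp: o_def)

lemma inv_funpow_T_measurable: "inv_into (space M) T ^^ n \<in> M \<rightarrow>\<^sub>M M"
  by (induction n) (auto intro: measurable_compose[OF _ measurable_inv_T] simp: o_def)

lemma int_iterate_measurable [measurable]: "int_iterate M T k \<in> M \<rightarrow>\<^sub>M M"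
  unfolding int_iterate_def using inv_funpow_T_measurable by auto

lemma integral_funpow_T:
  fixes f :: "'a \<Rightarrow> real"
  assumes "f \<in> borel_measurable M" shows "(\<integral>x. f ((T ^^ n) x) \<partial>M) = (\<integral>x. f x \<partial>M)"
proof (induction n)
  case (Suc n)
  have [measurable]: "f \<in> borel_measurable M" by fact
  have "(\<integral>x. f ((T ^^ Suc n) x) \<partial>M) = (\<integral>x. f ((T ^^ n) (T x)) \<partial>M)" by (simp only: funpow_Suc_right o_apply)
  also have "\<dots> = (\<integral>x. f ((T ^^ n) x) \<partial>M)"
    by (rule integral_T[of "\<lambda>x. f ((T ^^ n) x)"]) measurable
  finally show ?case using Suc.IH by simp
qed simp

lemma AE_funpow_T: "AE x in M. Q x \<Longrightarrow> AE x in M. Q ((T ^^ n) x)"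
proof (induction n)
  case (Suc n)
  then have "AE x in M. Q ((T ^^ n) x)" by simp
  from AE_T[OF this] show ?case by (simp only: funpow_Suc_right o_apply)
qed simp

lemma inv_funpow_T:
  assumes "x \<in> space M" shows "(inv_into (space M) T ^^ n) ((T ^^ n) x) = x"
  using assms
proof (induction n arbitrary: x)
  case (Suc n)
  have m: "(T ^^ n) x \<in> space M" using measurable_space[OF funpow_T_measurable Suc.prems] .
  have "inv_into (space M) T (T ((T ^^ n) x)) = (T ^^ n) x"
    using bij_T m by (intro inv_into_f_f) (auto simp: bij_betw_def)
  then show ?case using Suc.IH[OF Suc.prems]
    by (simp only: funpow_Suc_right[of n "inv_into (space M) T"] o_apply funpow.simps(2)[of n T])
qed simp

text \<open>The solution of the Poisson equation of \<open>f\<close>.\<close>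

definition corrector :: "('a \<Rightarrow> real) \<Rightarrow> 'a \<Rightarrow> real" where
  "corrector f x = (\<Sum>k. (1 - \<alpha>) ^ k * f ((T ^^ k) x))"

lemma corrector_props:
  assumes fm [measurable]: "f \<in> borel_measurable M" and C: "\<And>x. \<bar>f x\<bar> \<le> C"
  shows corrector_measurable: "corrector f \<in> borel_measurable M"
    and corrector_bound: "\<bar>corrector f x\<bar> \<le> C / \<alpha>"
    and corrector_eq: "corrector f x - (1 - \<alpha>) * corrector f (T x) = f x"
    and corrector_iter: "corrector f x = (\<Sum>k<n. (1 - \<alpha>) ^ k * f ((T ^^ k) x)) + (1 - \<alpha>) ^ n * corrector f ((T ^^ n) x)"
proof -
  have C0: "0 \<le> C" using C[of undefined] by linarith
  have gs: "summable (\<lambda>k. (1 - \<alpha>) ^ k * C)" using \<alpha> by (intro summable_mult2 summable_geometric) auto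
  have tb: "norm ((1 - \<alpha>) ^ k * f ((T ^^ k) x)) \<le> (1 - \<alpha>) ^ k * C" for k x
    using C \<alpha> by (simp add: abs_mult mult_left_mono)
  have s: "summable (\<lambda>k. (1 - \<alpha>) ^ k * f ((T ^^ k) x))" for x
    by (rule summable_comparison_test'[OF gs tb])
  show "corrector f \<in> borel_measurable M" unfolding corrector_def[abs_def] by measurable
  show "\<bar>corrector f x\<bar> \<le> C / \<alpha>"
  proof -
    have "norm (corrector f x) \<le> (\<Sum>k. (1 - \<alpha>) ^ k * C)"
      unfolding corrector_def by (rule norm_suminf_le[OF tb gs])
    also have "\<dots> = C / \<alpha>"
      using \<alpha> suminf_mult2[of "\<lambda>k. (1 - \<alpha>) ^ k" C] suminf_geometric[of "1 - \<alpha>"] summable_geometric[of "1 - \<alpha>"]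
      by simp
    finally show ?thesis by simp
  qed
  show eq: "corrector f x - (1 - \<alpha>) * corrector f (T x) = f x" for x
  proof -
    have "corrector f x = (1 - \<alpha>) ^ 0 * f ((T ^^ 0) x) + (\<Sum>k. (1 - \<alpha>) ^ Suc k * f ((T ^^ Suc k) x))"
      unfolding corrector_def using suminf_split_head[OF s] by simp
    also have "(\<Sum>k. (1 - \<alpha>) ^ Suc k * f ((T ^^ Suc k) x)) = (\<Sum>k. (1 - \<alpha>) * ((1 - \<alpha>) ^ k * f ((T ^^ k) (T x))))"
      by (simp only: funpow_Suc_right o_apply power_Suc mult.assoc)
    also have "\<dots> = (1 - \<alpha>) * corrector f (T x)"
      unfolding corrector_def by (rule suminf_mult[OF s])
    finally show ?thesis by simp
  qed
  show "corrector f x = (\<Sum>k<n. (1 - \<alpha>) ^ k * f ((T ^^ k) x)) + (1 - \<alpha>) ^ n * corrector f ((T ^^ n) x)"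
  proof (induction n)
    case (Suc n)
    have "corrector f ((T ^^ n) x) = f ((T ^^ n) x) + (1 - \<alpha>) * corrector f ((T ^^ Suc n) x)"
      using eq[of "(T ^^ n) x"] by simp
    with Suc have "corrector f x = (\<Sum>k<n. (1 - \<alpha>) ^ k * f ((T ^^ k) x))
        + (1 - \<alpha>) ^ n * (f ((T ^^ n) x) + (1 - \<alpha>) * corrector f ((T ^^ Suc n) x))"
      by (simp only:)
    then show ?case by (simp add: distrib_left mult_ac)
  qed simp
qed

lemma corrector_bdd:
  "f \<in> borel_measurable M \<Longrightarrow> (\<And>x. \<bar>f x\<bar> \<le> C) \<Longrightarrow> bdd_meas M (corrector f)"
  using corrector_measurable[of f C] corrector_bound[of f C] by (auto simp: bdd_meas_def)

lemma corrector_centred: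
  assumes f: "f \<in> borel_measurable M" "\<And>x. \<bar>f x\<bar> \<le> C" and c: "(\<integral>x. f x \<partial>M) = 0"
  shows "(\<integral>x. corrector f x \<partial>M) = 0"
proof -
  have b: "bdd_meas M (corrector f)" by (rule corrector_bdd[OF f])
  have "(\<integral>x. corrector f x - (1 - \<alpha>) * corrector f (T x) \<partial>M) = 0"
    using c by (simp only: corrector_eq[OF f])
  moreover have "(\<integral>x. corrector f x - (1 - \<alpha>) * corrector f (T x) \<partial>M)
      = (\<integral>x. corrector f x \<partial>M) - (1 - \<alpha>) * (\<integral>x. corrector f (T x) \<partial>M)"
    using bdd_meas_integrable[OF b] bdd_meas_integrable[OF bdd_meas_T[OF b]] by simp
  moreover have "(\<integral>x. corrector f (T x) \<partial>M) = (\<integral>x. corrector f x \<partial>M)"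
    by (rule integral_T[OF corrector_measurable[OF f]])
  ultimately show ?thesis using \<alpha> by (simp add: algebra_simps)
qed

lemma correlation_sums:
  assumes f: "f \<in> borel_measurable M" "\<And>x. \<bar>f x\<bar> \<le> C" and g: "bdd_meas M g"
  shows "(\<lambda>k. (1 - \<alpha>) ^ k * (\<integral>x. g x * f ((T ^^ k) x) \<partial>M)) sums (\<integral>x. g x * corrector f x \<partial>M)"
    and "summable (\<lambda>k. \<bar>(1 - \<alpha>) ^ k * (\<integral>x. g x * f ((T ^^ k) x) \<partial>M)\<bar>)"
proof -
  note b = corrector_bdd[OF f]
  have fb: "bdd_meas M f" using f by (auto simp: bdd_meas_def)
  have bn: "bdd_meas M (\<lambda>x. u ((T ^^ n) x))" if "bdd_meas M u" for u n
    by (rule bdd_meas_compose[OF that funpow_T_measurable])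
  obtain B where B: "\<And>x. x \<in> space M \<Longrightarrow> \<bar>g x\<bar> \<le> B" using g by (auto simp: bdd_meas_def)
  obtain x0 where x0: "x0 \<in> space M" using not_empty by auto
  have B0: "0 \<le> B" using B[OF x0] by linarith
  have C0: "0 \<le> C" using f(2)[of x0] by linarith
  have bound: "\<bar>\<integral>x. g x * u ((T ^^ n) x) \<partial>M\<bar> \<le> B * D" if u: "bdd_meas M u" "\<And>x. \<bar>u x\<bar> \<le> D" for u D n
  proof -
    have "\<bar>\<integral>x. g x * u ((T ^^ n) x) \<partial>M\<bar> \<le> (\<integral>x. \<bar>g x * u ((T ^^ n) x)\<bar> \<partial>M)"
      by (rule integral_abs_bound)
    also have "\<dots> \<le> B * D"
    proof (intro integral_le_const AE_I2)
      show "integrable M (\<lambda>x. \<bar>g x * u ((T ^^ n) x)\<bar>)"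
        by (rule integrable_abs[OF bdd_meas_integrable[OF bdd_meas_mult[OF g bn[OF u(1)]]]])
      show "\<bar>g x * u ((T ^^ n) x)\<bar> \<le> B * D" if "x \<in> space M" for x
        unfolding abs_mult using B[OF that] u(2) B0 by (intro mult_mono) auto
    qed
    finally show ?thesis .
  qed
  show "(\<lambda>k. (1 - \<alpha>) ^ k * (\<integral>x. g x * f ((T ^^ k) x) \<partial>M)) sums (\<integral>x. g x * corrector f x \<partial>M)"
    unfolding sums_def
  proof (rule LIM_zero_cancel, rule Lim_null_comparison)
    show "(\<lambda>n. (1 - \<alpha>) ^ n * (B * (C / \<alpha>))) \<longlonglongrightarrow> 0"
      using \<alpha> by (intro tendsto_mult_left_zero LIMSEQ_realpow_zero) auto
    show "eventually (\<lambda>n. norm ((\<Sum>k<n. (1 - \<alpha>) ^ k * (\<integral>x. g x * f ((T ^^ k) x) \<partial>M)) - (\<integral>x. g x * corrector f x \<partial>M))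
        \<le> (1 - \<alpha>) ^ n * (B * (C / \<alpha>))) sequentially"
    proof (rule always_eventually, rule allI)
      fix n
      have "(\<integral>x. g x * corrector f x \<partial>M)
         = (\<integral>x. (\<Sum>k<n. (1 - \<alpha>) ^ k * (g x * f ((T ^^ k) x))) + (1 - \<alpha>) ^ n * (g x * corrector f ((T ^^ n) x)) \<partial>M)"
        by (subst corrector_iter[OF f, of _ n]) (simp add: distrib_left sum_distrib_left mult_ac)
      also have "\<dots> = (\<Sum>k<n. (1 - \<alpha>) ^ k * (\<integral>x. g x * f ((T ^^ k) x) \<partial>M)) + (1 - \<alpha>) ^ n * (\<integral>x. g x * corrector f ((T ^^ n) x) \<partial>M)"
        using bdd_meas_integrable[OF bdd_meas_mult[OF g bn[OF fb]]] bdd_meas_integrable[OF bdd_meas_mult[OF g bn[OF b]]]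
        by (simp add: Bochner_Integration.integral_sum Bochner_Integration.integrable_sum)
      finally have "norm ((\<Sum>k<n. (1 - \<alpha>) ^ k * (\<integral>x. g x * f ((T ^^ k) x) \<partial>M)) - (\<integral>x. g x * corrector f x \<partial>M))
          = (1 - \<alpha>) ^ n * \<bar>\<integral>x. g x * corrector f ((T ^^ n) x) \<partial>M\<bar>"
        using \<alpha> by (simp add: abs_mult)
      also have "\<dots> \<le> (1 - \<alpha>) ^ n * (B * (C / \<alpha>))"
        using bound[OF b corrector_bound[OF f]] \<alpha> by (intro mult_left_mono) auto
      finally show "norm ((\<Sum>k<n. (1 - \<alpha>) ^ k * (\<integral>x. g x * f ((T ^^ k) x) \<partial>M)) - (\<integral>x. g x * corrector f x \<partial>M))
        \<le> (1 - \<alpha>) ^ n * (B * (C / \<alpha>))" .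
    qed
  qed
  show "summable (\<lambda>k. \<bar>(1 - \<alpha>) ^ k * (\<integral>x. g x * f ((T ^^ k) x) \<partial>M)\<bar>)"
  proof (rule summable_comparison_test')
    show "summable (\<lambda>k. (1 - \<alpha>) ^ k * (B * C))" using \<alpha> by (intro summable_mult2 summable_geometric) auto
    show "norm \<bar>(1 - \<alpha>) ^ n * (\<integral>x. g x * f ((T ^^ n) x) \<partial>M)\<bar> \<le> (1 - \<alpha>) ^ n * (B * C)" if "0 \<le> n" for n
      using bound[OF fb f(2), of n] \<alpha> by (simp add: abs_mult mult_left_mono)
  qed
qed

text \<open>The two-sided correlation series of \<open>f\<close> and \<open>g\<close> is a multiple of the inner product of their
correctors.\<close>

lemma correlation_has_sum:
  assumes f: "f \<in> borel_measurable M" "\<And>x. \<bar>f x\<bar> \<le> C" and g: "g \<in> borel_measurable M" "\<And>x. \<bar>g x\<bar> \<le> C"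
  shows "((\<lambda>k. (1 - \<alpha>) ^ nat \<bar>k\<bar> * (\<integral>x. f x * g (int_iterate M T k x) \<partial>M))
    has_sum ((1 - (1 - \<alpha>)\<^sup>2) * (\<integral>x. corrector f x * corrector g x \<partial>M))) UNIV"
proof -
  let ?c = "\<lambda>k. (1 - \<alpha>) ^ nat \<bar>k\<bar> * (\<integral>x. f x * g (int_iterate M T k x) \<partial>M)"
  note [measurable] = f(1) g(1) measurable_inv_T
  have fb: "bdd_meas M f" and gb: "bdd_meas M g" using f g by (auto simp: bdd_meas_def)
  have hf: "bdd_meas M (corrector f)" and hg: "bdd_meas M (corrector g)"
    by (rule corrector_bdd[OF f], rule corrector_bdd[OF g])
  have 1: "(?c has_sum (\<integral>x. f x * corrector g x \<partial>M)) (range int)"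
  proof (subst has_sum_reindex)
    have "(\<lambda>n. (1 - \<alpha>) ^ n * (\<integral>x. f x * g ((T ^^ n) x) \<partial>M)) = ?c \<circ> int"
      by (auto simp: fun_eq_iff int_iterate_def)
    then show "((?c \<circ> int) has_sum (\<integral>x. f x * corrector g x \<partial>M)) UNIV"
      using norm_summable_imp_has_sum[OF _ correlation_sums(1)[OF g fb]] correlation_sums(2)[OF g fb] by simp
  qed (auto simp: inj_on_def)
  have 2: "(?c has_sum ((\<integral>x. g x * corrector f x \<partial>M) - (\<integral>x. g x * f x \<partial>M))) (range (\<lambda>n. - int (Suc n)))"
  proof (subst has_sum_reindex)
    have backward: "(\<integral>x. f x * g ((inv_into (space M) T ^^ n) x) \<partial>M) = (\<integral>x. g x * f ((T ^^ n) x) \<partial>M)" for n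
    proof -
      have [measurable]: "(\<lambda>x. g ((inv_into (space M) T ^^ n) x)) \<in> borel_measurable M"
        by (rule measurable_compose[OF inv_funpow_T_measurable g(1)])
      have "(\<integral>x. f x * g ((inv_into (space M) T ^^ n) x) \<partial>M)
         = (\<integral>x. f ((T ^^ n) x) * g ((inv_into (space M) T ^^ n) ((T ^^ n) x)) \<partial>M)"
        by (rule integral_funpow_T[symmetric, of "\<lambda>x. f x * g ((inv_into (space M) T ^^ n) x)"]) measurable
      also have "\<dots> = (\<integral>x. g x * f ((T ^^ n) x) \<partial>M)"
        by (intro Bochner_Integration.integral_cong refl) (simp add: inv_funpow_T)
      finally show ?thesis .
    qed
    have e: "(\<lambda>n. (1 - \<alpha>) ^ Suc n * (\<integral>x. g x * f ((T ^^ Suc n) x) \<partial>M)) = ?c \<circ> (\<lambda>n. - int (Suc n))"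
    proof (rule ext)
      fix n
      have "int_iterate M T (- int (Suc n)) = inv_into (space M) T ^^ Suc n"
        unfolding int_iterate_def by (subst if_not_P) (simp, simp only: minus_minus nat_int)
      moreover have "nat \<bar>- int (Suc n)\<bar> = Suc n" by (simp only: abs_minus_cancel abs_of_nat nat_int)
      ultimately show "(1 - \<alpha>) ^ Suc n * (\<integral>x. g x * f ((T ^^ Suc n) x) \<partial>M) = (?c \<circ> (\<lambda>n. - int (Suc n))) n"
        by (simp only: o_apply backward)
    qed
    have "(\<lambda>n. (1 - \<alpha>) ^ Suc n * (\<integral>x. g x * f ((T ^^ Suc n) x) \<partial>M)) sums ((\<integral>x. g x * corrector f x \<partial>M) - (\<integral>x. g x * f x \<partial>M))"
      using correlation_sums(1)[OF f gb] by (subst sums_Suc_iff) simp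
    moreover have "summable (\<lambda>n. norm ((1 - \<alpha>) ^ Suc n * (\<integral>x. g x * f ((T ^^ Suc n) x) \<partial>M)))"
      using correlation_sums(2)[OF f gb] unfolding real_norm_def by (subst summable_Suc_iff)
    ultimately show "((?c \<circ> (\<lambda>n. - int (Suc n))) has_sum ((\<integral>x. g x * corrector f x \<partial>M) - (\<integral>x. g x * f x \<partial>M))) UNIV"
      unfolding e[symmetric] by (rule norm_summable_imp_has_sum[rotated])
  qed (auto simp: inj_on_def)
  have U: "range int \<union> range (\<lambda>n. - int (Suc n)) = UNIV"
  proof -
    have "k \<in> range int \<union> range (\<lambda>n. - int (Suc n))" for k :: int
      by (cases k) auto
    then show ?thesis by auto
  qed
  have "(?c has_sum ((\<integral>x. f x * corrector g x \<partial>M) + ((\<integral>x. g x * corrector f x \<partial>M) - (\<integral>x. g x * f x \<partial>M)))) UNIV"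
    unfolding U[symmetric] by (rule has_sum_Un_disjoint[OF 1 2]) auto
  moreover have "(\<integral>x. f x * corrector g x \<partial>M) + ((\<integral>x. g x * corrector f x \<partial>M) - (\<integral>x. g x * f x \<partial>M))
      = (1 - (1 - \<alpha>)\<^sup>2) * (\<integral>x. corrector f x * corrector g x \<partial>M)"
  proof -
    let ?F = "corrector f" and ?G = "corrector g"
    have i: "integrable M (\<lambda>x. f x * ?G x)" "integrable M (\<lambda>x. g x * ?F x)" "integrable M (\<lambda>x. g x * f x)"
      "integrable M (\<lambda>x. ?F x * ?G x)" "integrable M (\<lambda>x. ?F (T x) * ?G (T x))"
      by (intro bdd_meas_integrable bdd_meas_mult bdd_meas_T fb gb hf hg)+
    have "(\<integral>x. f x * ?G x \<partial>M) + ((\<integral>x. g x * ?F x \<partial>M) - (\<integral>x. g x * f x \<partial>M))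
       = (\<integral>x. f x * ?G x + (g x * ?F x - g x * f x) \<partial>M)"
      using i by simp
    also have "\<dots> = (\<integral>x. ?F x * ?G x - (1 - \<alpha>)\<^sup>2 * (?F (T x) * ?G (T x)) \<partial>M)"
    proof (intro Bochner_Integration.integral_cong refl)
      fix x
      have "f x = ?F x - (1 - \<alpha>) * ?F (T x)" "g x = ?G x - (1 - \<alpha>) * ?G (T x)"
        using corrector_eq[OF f] corrector_eq[OF g] by simp_all
      then show "f x * ?G x + (g x * ?F x - g x * f x) = ?F x * ?G x - (1 - \<alpha>)\<^sup>2 * (?F (T x) * ?G (T x))"
        by (simp only:) (simp add: algebra_simps power2_eq_square)
    qed
    also have "\<dots> = (\<integral>x. ?F x * ?G x \<partial>M) - (1 - \<alpha>)\<^sup>2 * (\<integral>x. ?F (T x) * ?G (T x) \<partial>M)"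
      using i by simp
    also have "(\<integral>x. ?F (T x) * ?G (T x) \<partial>M) = (\<integral>x. ?F x * ?G x \<partial>M)"
      using hf hg by (intro integral_T[of "\<lambda>x. ?F x * ?G x"]) (auto simp: bdd_meas_def)
    finally show ?thesis by (simp add: algebra_simps)
  qed
  ultimately show ?thesis by (simp only:)
qed

end

section \<open>Gaussian vectors and Lipschitz functions\<close>

lemma normal_law_mean:
  assumes "0 \<le> \<sigma>"
  shows "integrable (normal_law \<mu> \<sigma>) (\<lambda>x. x)" "(\<integral>x. x \<partial>normal_law \<mu> \<sigma>) = \<mu>"
proof -
  have "integrable (normal_law \<mu> \<sigma>) (\<lambda>x. x) \<and> (\<integral>x. x \<partial>normal_law \<mu> \<sigma>) = \<mu>"
  proof (cases "\<sigma> = 0")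
    case True
    interpret prob_space "return borel \<mu>" by (rule prob_space_return) simp
    have "integrable (return borel \<mu>) (\<lambda>x. x)"
      by (rule integrable_const_bound[where B="\<bar>\<mu>\<bar>"]) (auto simp: AE_return)
    moreover have "(\<integral>x. x \<partial>return borel \<mu>) = \<mu>" by (rule integral_return) auto
    ultimately show ?thesis unfolding normal_law_def if_P[OF True] by (rule conjI)
  next
    case False
    then have s: "0 < \<sigma>" using assms by simp
    have "integrable (density lborel (normal_density \<mu> \<sigma>)) (\<lambda>x. x)"
      using integrable_normal_moment_nz_1[OF s, of \<mu>] by (subst integrable_density) auto
    moreover have "(\<integral>x. x \<partial>density lborel (normal_density \<mu> \<sigma>)) = \<mu>"
      using integral_normal_moment_nz_1[OF s, of \<mu>] by (subst integral_density) auto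
    ultimately show ?thesis unfolding normal_law_def if_not_P[OF False] by (rule conjI)
  qed
  then show "integrable (normal_law \<mu> \<sigma>) (\<lambda>x. x)" "(\<integral>x. x \<partial>normal_law \<mu> \<sigma>) = \<mu>" by auto
qed

lemma centred_normal_law:
  assumes "0 \<le> \<sigma>"
  shows "integrable (normal_law 0 \<sigma>) (\<lambda>x. x\<^sup>2)" "(\<integral>x. x\<^sup>2 \<partial>normal_law 0 \<sigma>) = \<sigma>\<^sup>2"
    "(\<integral>x. iexp x \<partial>normal_law 0 \<sigma>) = exp (- \<sigma>\<^sup>2 / 2)"
proof -
  have "integrable (normal_law 0 \<sigma>) (\<lambda>x. x\<^sup>2) \<and> (\<integral>x. x\<^sup>2 \<partial>normal_law 0 \<sigma>) = \<sigma>\<^sup>2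
    \<and> (\<integral>x. iexp x \<partial>normal_law 0 \<sigma>) = exp (- \<sigma>\<^sup>2 / 2)"
  proof (cases "\<sigma> = 0")
    case True
    interpret prob_space "return borel (0::real)" by (rule prob_space_return) simp
    have "integrable (return borel 0) (\<lambda>x::real. x\<^sup>2)"
      by (rule integrable_const_bound[where B=0]) (auto simp: AE_return)
    then show ?thesis using True by (simp add: normal_law_def integral_return)
  next
    case False
    then have s: "0 < \<sigma>" using assms by simp
    have 1: "integrable lborel (\<lambda>x. normal_density 0 \<sigma> x * x\<^sup>2)"
      using integrable_normal_moment[OF s, of 0 2] by simp
    have 2: "(\<integral>x. normal_density 0 \<sigma> x * x\<^sup>2 \<partial>lborel) = \<sigma>\<^sup>2"
      using integral_normal_moment_even[OF s, of 0 1] s by simp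
    have dens: "\<bar>\<sigma>\<bar> * normal_density 0 \<sigma> (\<sigma> * x) = std_normal_density x" for x
      using s by (simp add: normal_density_def std_normal_density_def real_sqrt_mult power_mult_distrib field_simps)
    have "(\<integral>x. normal_density 0 \<sigma> x *\<^sub>R iexp x \<partial>lborel) = \<bar>\<sigma>\<bar> *\<^sub>R (\<integral>x. normal_density 0 \<sigma> (0 + \<sigma> * x) *\<^sub>R iexp (0 + \<sigma> * x) \<partial>lborel)"
      by (rule lborel_integral_real_affine[OF False])
    also have "\<dots> = (\<integral>x. (\<bar>\<sigma>\<bar> * normal_density 0 \<sigma> (\<sigma> * x)) *\<^sub>R iexp (\<sigma> * x) \<partial>lborel)"
      by (subst integral_scaleR_right[symmetric]) simp
    also have "\<dots> = (\<integral>x. std_normal_density x *\<^sub>R iexp (\<sigma> * x) \<partial>lborel)"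
      by (simp only: dens)
    also have "\<dots> = (\<integral>x. iexp (\<sigma> * x) \<partial>std_normal_distribution)"
      by (subst integral_density) auto
    also have "\<dots> = exp (- \<sigma>\<^sup>2 / 2)"
      using fun_cong[OF char_std_normal_distribution, of \<sigma>] by (simp only: char_def)
    finally have 3: "(\<integral>x. normal_density 0 \<sigma> x *\<^sub>R iexp x \<partial>lborel) = exp (- \<sigma>\<^sup>2 / 2)" .
    show ?thesis
    proof (intro conjI)
      show "integrable (normal_law 0 \<sigma>) (\<lambda>x. x\<^sup>2)"
        using False 1 by (simp add: normal_law_def integrable_density)
      show "(\<integral>x. x\<^sup>2 \<partial>normal_law 0 \<sigma>) = \<sigma>\<^sup>2"
        using False 2 by (simp add: normal_law_def integral_density)
      show "(\<integral>x. iexp x \<partial>normal_law 0 \<sigma>) = exp (- \<sigma>\<^sup>2 / 2)"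
        unfolding normal_law_def 3[symmetric] using False by (simp only: if_False) (subst integral_density, auto)
    qed
  qed
  then show "integrable (normal_law 0 \<sigma>) (\<lambda>x. x\<^sup>2)" "(\<integral>x. x\<^sup>2 \<partial>normal_law 0 \<sigma>) = \<sigma>\<^sup>2"
    "(\<integral>x. iexp x \<partial>normal_law 0 \<sigma>) = exp (- \<sigma>\<^sup>2 / 2)" by auto
qed

lemma gaussian_vector_integrable:
  fixes N :: "'q \<Rightarrow> real^'d::finite"
  assumes N: "gaussian_vector Q N"
  shows "integrable Q N"
proof -
  have [measurable]: "N \<in> borel_measurable Q" using N by (simp add: gaussian_vector_def)
  have "integrable Q (\<lambda>q. axis i 1 \<bullet> N q)" for i
  proof -
    obtain \<mu> \<sigma> where "0 \<le> \<sigma>" and d: "distr Q borel (\<lambda>q. axis i 1 \<bullet> N q) = normal_law \<mu> \<sigma>"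
      using N unfolding gaussian_vector_def by blast
    then have "integrable (distr Q borel (\<lambda>q. axis i 1 \<bullet> N q)) (\<lambda>x. x)" using normal_law_mean by simp
    then show ?thesis by (subst (asm) integrable_distr_eq) auto
  qed
  then have "integrable Q (\<lambda>q. \<Sum>i\<in>UNIV. (axis i 1 \<bullet> N q) *\<^sub>R (axis i 1 :: real^'d))"
    by (intro Bochner_Integration.integrable_sum integrable_scaleR_left)
  moreover have "(\<Sum>i\<in>UNIV. (axis i 1 \<bullet> x) *\<^sub>R (axis i 1 :: real^'d)) = x" for x
    by (simp add: inner_axis' scalar_mult_eq_scaleR[symmetric] basis_expansion)
  ultimately show ?thesis by simp
qed

lemma gaussian_vector_char:
  fixes N :: "'q \<Rightarrow> real^'d::finite"
  assumes Q: "prob_space Q" and N: "gaussian_vector Q N" "(\<integral>q. N q \<partial>Q) = 0"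
  shows "(\<integral>q. iexp (u \<bullet> N q) \<partial>Q) = exp (- (\<Sum>i\<in>UNIV. \<Sum>j\<in>UNIV. u $ i * u $ j * covariance_matrix Q N $ i $ j) / 2)"
proof -
  have [measurable]: "N \<in> borel_measurable Q" using N by (simp add: gaussian_vector_def)
  note iN = gaussian_vector_integrable[OF N(1)]
  have law: "\<exists>\<sigma>\<ge>0. distr Q borel (\<lambda>q. u \<bullet> N q) = normal_law 0 \<sigma>" for u
  proof -
    obtain \<mu> \<sigma> where s: "0 \<le> \<sigma>" and d: "distr Q borel (\<lambda>q. u \<bullet> N q) = normal_law \<mu> \<sigma>"
      using N(1) unfolding gaussian_vector_def by blast
    have "\<mu> = (\<integral>x. x \<partial>distr Q borel (\<lambda>q. u \<bullet> N q))" using normal_law_mean[OF s] d by simp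
    also have "\<dots> = (\<integral>q. u \<bullet> N q \<partial>Q)" by (subst integral_distr) auto
    also have "\<dots> = u \<bullet> (\<integral>q. N q \<partial>Q)" using iN by simp
    also have "\<dots> = 0" using N(2) by simp
    finally show ?thesis using s d by auto
  qed
  have sq: "integrable Q (\<lambda>q. (u \<bullet> N q)\<^sup>2)" for u
  proof -
    obtain \<sigma> where "0 \<le> \<sigma>" and d: "distr Q borel (\<lambda>q. u \<bullet> N q) = normal_law 0 \<sigma>" using law by blast
    then have "integrable (distr Q borel (\<lambda>q. u \<bullet> N q)) (\<lambda>x. x\<^sup>2)" using centred_normal_law by simp
    then show ?thesis by (subst (asm) integrable_distr_eq) auto
  qed
  have coord: "axis i 1 \<bullet> x = x $ i" for i and x :: "real^'d" by (simp add: inner_axis')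
  have prod: "integrable Q (\<lambda>q. N q $ i * N q $ j)" for i j
  proof (rule Bochner_Integration.integrable_bound)
    show "integrable Q (\<lambda>q. (N q $ i)\<^sup>2 + (N q $ j)\<^sup>2)"
      using sq[of "axis i 1"] sq[of "axis j 1"] by (simp add: coord)
    have "\<bar>a * b\<bar> \<le> a\<^sup>2 + b\<^sup>2" for a b :: real
    proof -
      have "2 * (\<bar>a\<bar> * \<bar>b\<bar>) \<le> a\<^sup>2 + b\<^sup>2"
        using sum_squares_bound[of "\<bar>a\<bar>" "\<bar>b\<bar>"] by (simp add: mult.assoc)
      moreover have "0 \<le> \<bar>a\<bar> * \<bar>b\<bar>" by simp
      ultimately show ?thesis unfolding abs_mult by linarith
    qed
    then show "AE q in Q. norm (N q $ i * N q $ j) \<le> norm ((N q $ i)\<^sup>2 + (N q $ j)\<^sup>2)"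
      by (intro AE_I2) (auto simp: abs_of_nonneg)
  qed measurable
  have cov: "covariance_matrix Q N $ i $ j = (\<integral>q. N q $ i * N q $ j \<partial>Q)" for i j
    by (simp add: covariance_matrix_def matrix_expectation_def tensor_vec_def N(2))
  obtain \<sigma> where s: "0 \<le> \<sigma>" and d: "distr Q borel (\<lambda>q. u \<bullet> N q) = normal_law 0 \<sigma>" using law by blast
  have "\<sigma>\<^sup>2 = (\<integral>x. x\<^sup>2 \<partial>distr Q borel (\<lambda>q. u \<bullet> N q))" using centred_normal_law[OF s] d by simp
  also have "\<dots> = (\<integral>q. (u \<bullet> N q)\<^sup>2 \<partial>Q)" by (subst integral_distr) auto
  also have "\<dots> = (\<integral>q. (\<Sum>i\<in>UNIV. \<Sum>j\<in>UNIV. u $ i * u $ j * (N q $ i * N q $ j)) \<partial>Q)"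
    by (simp add: inner_vec_def power2_eq_square sum_product mult_ac)
  also have "\<dots> = (\<Sum>i\<in>UNIV. \<Sum>j\<in>UNIV. u $ i * u $ j * covariance_matrix Q N $ i $ j)"
    unfolding cov using prod by (simp add: Bochner_Integration.integral_sum Bochner_Integration.integrable_sum)
  finally have var: "\<sigma>\<^sup>2 = (\<Sum>i\<in>UNIV. \<Sum>j\<in>UNIV. u $ i * u $ j * covariance_matrix Q N $ i $ j)" .
  have "(\<integral>q. iexp (u \<bullet> N q) \<partial>Q) = (\<integral>x. iexp x \<partial>distr Q borel (\<lambda>q. u \<bullet> N q))"
    by (subst integral_distr) auto
  also have "\<dots> = exp (- \<sigma>\<^sup>2 / 2)" unfolding d by (rule centred_normal_law(3)[OF s])
  finally show ?thesis unfolding var .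
qed

lemma borel_measurable_matrix_vector_mult [measurable]:
  "(*v) A \<in> borel_measurable borel" for A :: "real^'m::finite^'n::finite"
  by (intro borel_measurable_continuous_onI linear_continuous_on matrix_vector_mul_bounded_linear)

text \<open>A centred Gaussian vector with covariance \<open>A A\<^sup>T\<close> has the same expectations as \<open>A W\<close>, with \<open>W\<close>
standard Gaussian.\<close>

lemma gaussian_vector_expectation:
  fixes N :: "'q \<Rightarrow> real^'d::finite" and A :: "real^'d^'d"
  assumes Q: "prob_space Q" and N: "gaussian_vector Q N" "(\<integral>q. N q \<partial>Q) = 0"
    and cov: "\<And>i j. covariance_matrix Q N $ i $ j = (\<Sum>k\<in>UNIV. A $ i $ k * A $ j $ k)"
    and \<phi>: "bdd_lipschitz L \<phi>"
  shows "(\<integral>q. \<phi> (N q) \<partial>Q) = (\<integral>w. \<phi> (A *v w) \<partial>std_gauss)"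
proof -
  interpret Q: prob_space Q by fact
  have [measurable]: "N \<in> borel_measurable Q" using N by (simp add: gaussian_vector_def)
  have [measurable]: "\<phi> \<in> borel_measurable borel" by (rule bdd_lipschitz_measurable[OF \<phi>])
  let ?\<mu> = "distr Q borel N" and ?\<nu> = "distr std_gauss borel ((*v) A)"
  have char: "(\<integral>x. iexp (u \<bullet> x) \<partial>?\<mu>) = (\<integral>x. iexp (u \<bullet> x) \<partial>?\<nu>)" for u
  proof -
    have "(\<Sum>i\<in>UNIV. \<Sum>j\<in>UNIV. u $ i * u $ j * covariance_matrix Q N $ i $ j)
       = (\<Sum>i\<in>UNIV. \<Sum>j\<in>UNIV. \<Sum>k\<in>UNIV. (u $ i * A $ i $ k) * (u $ j * A $ j $ k))"
      by (simp add: cov sum_distrib_left mult_ac)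
    also have "\<dots> = (\<Sum>i\<in>UNIV. \<Sum>k\<in>UNIV. \<Sum>j\<in>UNIV. (u $ i * A $ i $ k) * (u $ j * A $ j $ k))"
      by (intro sum.cong refl sum.swap)
    also have "\<dots> = (\<Sum>k\<in>UNIV. \<Sum>i\<in>UNIV. \<Sum>j\<in>UNIV. (u $ i * A $ i $ k) * (u $ j * A $ j $ k))"
      by (rule sum.swap)
    also have "\<dots> = (\<Sum>k\<in>UNIV. ((u v* A) $ k)\<^sup>2)"
      by (simp add: vector_matrix_mult_def power2_eq_square sum_product)
    also have "\<dots> = (norm (u v* A))\<^sup>2" by (simp add: norm_power2_cart)
    finally have q: "(\<Sum>i\<in>UNIV. \<Sum>j\<in>UNIV. u $ i * u $ j * covariance_matrix Q N $ i $ j) = (norm (u v* A))\<^sup>2" .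
    have "(\<integral>x. iexp (u \<bullet> x) \<partial>?\<mu>) = (\<integral>q. iexp (u \<bullet> N q) \<partial>Q)" by (subst integral_distr) auto
    also have "\<dots> = exp (- (norm (u v* A))\<^sup>2 / 2)" using gaussian_vector_char[OF Q N, of u] by (simp only: q)
    also have "\<dots> = (\<integral>w. iexp ((u v* A) \<bullet> w) \<partial>std_gauss)" by (simp only: integral_exp_std_gauss)
    also have "\<dots> = (\<integral>x. iexp (u \<bullet> x) \<partial>?\<nu>)" by (subst integral_distr) (auto simp: dot_lmul_matrix)
    finally show ?thesis .
  qed
  have "(\<integral>q. \<phi> (N q) \<partial>Q) = (\<integral>x. \<phi> x \<partial>?\<mu>)" by (subst integral_distr) auto
  also have "\<dots> = (\<integral>x. \<phi> x \<partial>?\<nu>)"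
    by (rule char_eq_imp_integral_eq[OF _ _ _ _ char \<phi>]) (auto intro!: Q.prob_space_distr std_gauss.prob_space_distr)
  also have "\<dots> = (\<integral>w. \<phi> (A *v w) \<partial>std_gauss)" by (subst integral_distr) auto
  finally show ?thesis .
qed

lemma lipschitz_const_bound:
  fixes \<phi> :: "real^'d::finite \<Rightarrow> real"
  assumes "L-lipschitz_on UNIV \<phi>"
  shows "\<bar>\<phi> x - \<phi> y\<bar> \<le> lipschitz_const \<phi> * norm (x - y)" "0 \<le> lipschitz_const \<phi>"
proof -
  let ?S = "{\<bar>\<phi> x - \<phi> y\<bar> / infnorm (x - y) | x y. x \<noteq> y}"
  have L0: "0 \<le> L" using lipschitz_on_nonneg[OF assms] .
  have le: "\<bar>\<phi> x - \<phi> y\<bar> / infnorm (x - y) \<le> L * sqrt DIM(real^'d)" if "x \<noteq> y" for x y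
  proof -
    have pos: "0 < infnorm (x - y)" using that by (simp add: infnorm_pos_lt)
    have "\<bar>\<phi> x - \<phi> y\<bar> \<le> L * norm (x - y)"
      using lipschitz_onD[OF assms, of x y] by (simp add: dist_norm)
    also have "\<dots> \<le> L * (sqrt DIM(real^'d) * infnorm (x - y))"
      by (intro mult_left_mono norm_le_infnorm L0)
    finally show ?thesis using pos by (simp add: divide_le_eq mult.assoc)
  qed
  have bdd: "bdd_above ?S" using le by (auto simp: bdd_above_def)
  have up: "\<bar>\<phi> x - \<phi> y\<bar> / infnorm (x - y) \<le> lipschitz_const \<phi>" if "x \<noteq> y" for x y
    unfolding lipschitz_const_def by (rule cSup_upper[OF _ bdd]) (use that in auto)
  show nn: "0 \<le> lipschitz_const \<phi>"
  proof -
    have "(axis undefined (1::real) :: real^'d) \<noteq> 0" by (simp add: axis_eq_0_iff)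
    from up[OF this] show ?thesis using infnorm_pos_le[of "axis undefined (1::real) - (0::real^'d)"]
      by (meson abs_ge_zero divide_nonneg_nonneg order_trans)
  qed
  show "\<bar>\<phi> x - \<phi> y\<bar> \<le> lipschitz_const \<phi> * norm (x - y)"
  proof (cases "x = y")
    case False
    then have "\<bar>\<phi> x - \<phi> y\<bar> \<le> lipschitz_const \<phi> * infnorm (x - y)"
      using up[OF False] by (simp add: divide_le_eq infnorm_pos_lt)
    also have "\<dots> \<le> lipschitz_const \<phi> * norm (x - y)"
      by (intro mult_left_mono infnorm_le_norm nn)
    finally show ?thesis .
  qed (use nn in simp)
qed

text \<open>Clipping to \<open>[- n, n]\<close>.\<close>

definition truncate :: "nat \<Rightarrow> real \<Rightarrow> real" where
  "truncate n t = max (- real n) (min (real n) t)"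

lemma bdd_lipschitz_truncate:
  assumes "\<And>x y. \<bar>\<phi> x - \<phi> y\<bar> \<le> L * norm (x - y)"
  shows "bdd_lipschitz L (\<lambda>x. truncate n (\<phi> x))"
  unfolding bdd_lipschitz_def
proof (intro conjI allI exI[of _ "real n"])
  fix x y
  show "\<bar>truncate n (\<phi> x)\<bar> \<le> real n" by (auto simp: truncate_def)
  have "\<bar>truncate n (\<phi> x) - truncate n (\<phi> y)\<bar> \<le> \<bar>\<phi> x - \<phi> y\<bar>" by (auto simp: truncate_def)
  then show "\<bar>truncate n (\<phi> x) - truncate n (\<phi> y)\<bar> \<le> L * norm (x - y)"
    using assms order_trans by blast
qed

lemma truncate_expectation:
  fixes X :: "'q \<Rightarrow> real^'d::finite"
  assumes Q: "prob_space Q" and X: "integrable Q X" and \<phi>: "\<And>x y. \<bar>\<phi> x - \<phi> y\<bar> \<le> L * norm (x - y)"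
    and \<phi>_meas: "\<phi> \<in> borel_measurable borel"
  shows "(\<lambda>n. \<integral>q. truncate n (\<phi> (X q)) \<partial>Q) \<longlonglongrightarrow> (\<integral>q. \<phi> (X q) \<partial>Q)"
proof -
  interpret Q: prob_space Q by fact
  have [measurable]: "X \<in> borel_measurable Q" "\<phi> \<in> borel_measurable borel" using X \<phi>_meas by auto
  show ?thesis
  proof (rule integral_dominated_convergence)
    show "integrable Q (\<lambda>q. \<bar>\<phi> 0\<bar> + L * norm (X q))" using X by simp
    show "(\<lambda>q. truncate n (\<phi> (X q))) \<in> borel_measurable Q" for n unfolding truncate_def by measurable
    show "AE q in Q. norm (truncate n (\<phi> (X q))) \<le> \<bar>\<phi> 0\<bar> + L * norm (X q)" for n
    proof (rule AE_I2)
      fix q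
      have "\<bar>truncate n (\<phi> (X q))\<bar> \<le> \<bar>\<phi> (X q)\<bar>" by (auto simp: truncate_def)
      also have "\<dots> \<le> \<bar>\<phi> 0\<bar> + L * norm (X q)" using \<phi>[of "X q" 0] by simp
      finally show "norm (truncate n (\<phi> (X q))) \<le> \<bar>\<phi> 0\<bar> + L * norm (X q)" by simp
    qed
    show "AE q in Q. (\<lambda>n. truncate n (\<phi> (X q))) \<longlonglongrightarrow> \<phi> (X q)"
    proof (rule AE_I2, rule tendsto_eventually)
      fix q
      obtain m where m: "\<bar>\<phi> (X q)\<bar> \<le> real m" using real_arch_simple by blast
      show "eventually (\<lambda>n. truncate n (\<phi> (X q)) = \<phi> (X q)) sequentially"
        unfolding eventually_sequentially
      proof (intro exI[of _ m] allI impI)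
        fix n assume "m \<le> n"
        then have "\<bar>\<phi> (X q)\<bar> \<le> real n" using m by linarith
        then show "truncate n (\<phi> (X q)) = \<phi> (X q)" by (auto simp: truncate_def)
      qed
    qed
  qed measurable
qed

section \<open>The rate of convergence\<close>

lemma vec_component_integral:
  fixes f :: "'a \<Rightarrow> real^'d::finite"
  assumes "integrable M f"
  shows "(\<integral>x. f x $ i \<partial>M) = (\<integral>x. f x \<partial>M) $ i"
proof -
  have "(\<integral>x. f x \<bullet> axis i 1 \<partial>M) = (\<integral>x. f x \<partial>M) \<bullet> axis i 1"
    using assms by (rule integral_inner_left)
  then show ?thesis by (simp add: inner_axis)
qed

lemma has_sum_finite_sum:
  fixes f :: "'i \<Rightarrow> 'k \<Rightarrow> 'b::real_normed_vector"
  assumes "finite F" "\<And>i. i \<in> F \<Longrightarrow> (f i has_sum s i) I"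
  shows "((\<lambda>k. \<Sum>i\<in>F. f i k) has_sum (\<Sum>i\<in>F. s i)) I"
  using assms by (induction F) (auto intro: has_sum_add)

lemma has_sum_matrix:
  fixes F :: "'k \<Rightarrow> real^'d::finite^'d"
  assumes "\<And>i j. ((\<lambda>k. F k $ i $ j) has_sum S i j) I"
  shows "infsum F I $ i $ j = S i j"
proof -
  have entry: "(\<Sum>i\<in>UNIV. \<Sum>j\<in>UNIV. c i j *\<^sub>R (axis i (axis j 1) :: real^'d^'d)) $ p $ q = c p q" for c p q
  proof -
    have "(\<Sum>i\<in>UNIV. \<Sum>j\<in>UNIV. c i j *\<^sub>R (axis i (axis j 1) :: real^'d^'d)) $ p $ q
        = (\<Sum>i\<in>UNIV. \<Sum>j\<in>UNIV. if i = p then (if j = q then c i j else 0) else 0)"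
      unfolding sum_component by (intro sum.cong refl) (auto simp: axis_def)
    also have "\<dots> = (\<Sum>i\<in>UNIV. if i = p then (\<Sum>j\<in>UNIV. if j = q then c i j else 0) else 0)"
      by (intro sum.cong refl) auto
    finally show ?thesis by simp
  qed
  have expand: "(\<Sum>i\<in>UNIV. \<Sum>j\<in>UNIV. (X $ i $ j) *\<^sub>R axis i (axis j 1)) = X" for X :: "real^'d^'d"
    by (simp only: vec_eq_iff entry) simp
  let ?X = "\<Sum>i\<in>UNIV. \<Sum>j\<in>UNIV. S i j *\<^sub>R (axis i (axis j 1) :: real^'d^'d)"
  have "((\<lambda>k. \<Sum>i\<in>UNIV. \<Sum>j\<in>UNIV. (F k $ i $ j) *\<^sub>R (axis i (axis j 1) :: real^'d^'d)) has_sum ?X) I"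
    by (intro has_sum_finite_sum finite_class.finite_UNIV has_sum_bounded_linear[OF bounded_linear_scaleR_left] assms)
  then have "(F has_sum ?X) I" by (simp only: expand)
  then have "infsum F I = ?X" by (rule infsumI)
  moreover have "?X $ i $ j = S i j" by (rule entry)
  ultimately show ?thesis by simp
qed

context resampling_chain
begin

lemma AE_int_iterate:
  assumes Q: "{x \<in> space M. Q x} \<in> sets M" and ae: "AE x in M. Q x"
  shows "AE x in M. Q (int_iterate M T k x)"
proof (cases "0 \<le> k")
  case True
  then show ?thesis using AE_funpow_T[OF ae] by (simp add: int_iterate_def)
next
  case False
  let ?n = "nat (- k)"
  let ?I = "inv_into (space M) T ^^ ?n"
  have D: "distr M M (T ^^ n) = M" for n
  proof (rule measure_eqI)
    fix A assume "A \<in> sets (distr M M (T ^^ n))"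
    then have A [measurable]: "A \<in> sets M" by simp
    interpret D: prob_space "distr M M (T ^^ n)" by (rule prob_space_distr) (rule funpow_T_measurable)
    have "measure (distr M M (T ^^ n)) A = (\<integral>x. indicator A x \<partial>distr M M (T ^^ n))" by simp
    also have "\<dots> = (\<integral>x. indicator A ((T ^^ n) x) \<partial>M)"
      by (rule integral_distr[OF funpow_T_measurable]) simp
    also have "\<dots> = (\<integral>x. indicator A x \<partial>M)" by (rule integral_funpow_T) simp
    also have "\<dots> = measure M A" by simp
    finally show "emeasure (distr M M (T ^^ n)) A = emeasure M A"
      by (simp add: D.emeasure_eq_measure emeasure_eq_measure)
  qed simp
  have set: "{x \<in> space M. Q (?I x)} \<in> sets M"
  proof -
    have "{x \<in> space M. Q (?I x)} = ?I -` {x \<in> space M. Q x} \<inter> space M"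
      using measurable_space[OF inv_funpow_T_measurable] by auto
    also have "\<dots> \<in> sets M" by (rule measurable_sets[OF inv_funpow_T_measurable Q])
    finally show ?thesis .
  qed
  have "AE x in M. Q (?I ((T ^^ ?n) x))"
    using ae AE_space by eventually_elim (simp add: inv_funpow_T)
  then have "AE x in distr M M (T ^^ ?n). Q (?I x)"
    by (subst AE_distr_iff[OF funpow_T_measurable set])
  from this[unfolded D] show ?thesis using False by (simp add: int_iterate_def)
qed

end

theorem theorem2p2p5:
  fixes M :: "'a measure" and T :: "'a \<Rightarrow> 'a" and \<alpha> :: real
    and a :: "'a \<Rightarrow> real ^ 'd::finite"
    and P :: "(int \<Rightarrow> 'a) measure"
    and Q :: "'q measure" and N :: "'q \<Rightarrow> real ^ 'd"
  assumes "invertible_pds M T"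
    and "0 < \<alpha>" and "\<alpha> < 1"
    and "a \<in> L_infinity M" and "(\<integral>x. a x \<partial>M) = 0"
    and "is_chain_measure M T \<alpha> P"
    and "prob_space Q" and "gaussian_vector Q N" and "(\<integral>q. N q \<partial>Q) = 0"
    and "covariance_matrix Q N = asymptotic_covariance M T \<alpha> a"
  shows "\<exists>B>0. \<forall>\<phi> :: real ^ 'd \<Rightarrow> real. \<forall>n::nat. (\<exists>L. L-lipschitz_on UNIV \<phi>) \<longrightarrow> n \<ge> 1 \<longrightarrow>
    \<bar>(\<integral>\<omega>. \<phi> ((1 / sqrt (real n)) *\<^sub>R (\<Sum>k = 0..n - 1. a (chain_coord (int k) \<omega>))) \<partial>P)
       - (\<integral>q. \<phi> (N q) \<partial>Q)\<bar> \<le> B / sqrt (real n) * lipschitz_const \<phi>"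
proof -
  interpret resampling_chain M T \<alpha> P
    using assms by (simp add: resampling_chain_def resampling_chain_axioms_def)
  interpret Q: prob_space Q by fact
  have am [measurable]: "a \<in> borel_measurable M" using assms(4) by (simp add: L_infinity_def)
  obtain C0 where C0: "AE x in M. infnorm (a x) \<le> C0" using assms(4) by (auto simp: L_infinity_def)
  define C1 where "C1 = max C0 0"
  \<comment> \<open>A version of \<open>a\<close> that is bounded everywhere.\<close>
  define b where "b i x = (if \<bar>a x $ i\<bar> \<le> C1 then a x $ i else 0)" for i x
  have b_meas [measurable]: "b i \<in> borel_measurable M" for i unfolding b_def[abs_def] by measurable
  have b_bound: "\<bar>b i x\<bar> \<le> C1" for i x by (simp add: b_def C1_def)
  have ab: "AE x in M. \<forall>i. a x $ i = b i x"
    using C0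
  proof eventually_elim
    case (elim x)
    have "\<bar>a x $ i\<bar> \<le> C1" for i
      using elim component_le_infnorm_cart[of "a x" i] by (simp add: C1_def)
    then show ?case by (simp add: b_def)
  qed
  have a_int: "integrable M a"
  proof (rule integrable_const_bound[where B="sqrt DIM(real^'d) * C0"])
    show "AE x in M. norm (a x) \<le> sqrt DIM(real^'d) * C0"
      using C0
    proof eventually_elim
      case (elim x)
      show ?case by (rule order_trans[OF norm_le_infnorm mult_left_mono[OF elim]]) simp
    qed
  qed measurable
  have b_centred: "(\<integral>x. b i x \<partial>M) = 0" for i
  proof -
    have "(\<integral>x. b i x \<partial>M) = (\<integral>x. a x $ i \<partial>M)"
      by (intro integral_cong_AE) (use ab in \<open>auto elim!: eventually_mono\<close>)
    then show ?thesis using assms(5) by (simp add: vec_component_integral[OF a_int])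
  qed
  define h where "h i = corrector (b i)" for i
  define H where "H = C1 / \<alpha>"
  have h_bdd: "bdd_meas M (h i)" for i unfolding h_def by (rule corrector_bdd[OF b_meas b_bound])
  have h_bound: "\<bar>h i x\<bar> \<le> H" for i x unfolding h_def H_def by (rule corrector_bound[OF b_meas b_bound])
  have h_centred: "(\<integral>x. h i x \<partial>M) = 0" for i
    unfolding h_def by (rule corrector_centred[OF b_meas b_bound b_centred])
  have h_eq: "h i x - (1 - \<alpha>) * h i (T x) = b i x" for i x
    unfolding h_def by (rule corrector_eq[OF b_meas b_bound])
  obtain e :: "'d \<Rightarrow> 'a \<Rightarrow> real" and J :: "'d set" where basis_bdd: "\<And>i. bdd_meas M (e i)" and basis_centred: "\<And>i. (\<integral>x. e i x \<partial>M) = 0"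
    and basis_orthonormal: "\<And>i j. (\<integral>x. e i x * e j x \<partial>M) = (if i = j \<and> i \<in> J then 1 else 0)"
    and basis_zero: "\<And>i. i \<notin> J \<Longrightarrow> e i = (\<lambda>_. 0)"
    and h_exp: "\<And>i. AE x in M. h i x = (\<Sum>j\<in>UNIV. (\<integral>y. h i y * e j y \<partial>M) * e j x)"
    by (rule gram_schmidt[of h, OF h_bdd h_centred]) (rule that)
  have [measurable]: "h i \<in> borel_measurable M" "e i \<in> borel_measurable M" for i
    using h_bdd[of i] basis_bdd[of i] by (simp_all add: bdd_meas_def)
  define \<sigma> where "\<sigma> = sqrt (1 - (1 - \<alpha>)\<^sup>2)"
  have s1: "(1 - \<alpha>)\<^sup>2 < 1" using \<alpha> by (simp add: power_less_one_iff abs_square_less_1)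
  have \<sigma>: "0 < \<sigma>" "\<sigma> * \<sigma> = 1 - (1 - \<alpha>)\<^sup>2" using s1 by (auto simp: \<sigma>_def)
  \<comment> \<open>With this scaling the martingale increments of the nonzero coordinates of \<open>e'\<close> are orthonormal.\<close>
  define e' where "e' i x = e i x / \<sigma>" for i x
  define A :: "real^'d^'d" where "A = (\<chi> i j. \<sigma> * (\<integral>y. h i y * e j y \<partial>M))"
  have h_exp': "AE x in M. \<forall>i. h i x = (A *v (\<chi> j. e' j x)) $ i"
  proof -
    have "AE x in M. \<forall>i\<in>UNIV. h i x = (\<Sum>j\<in>UNIV. (\<integral>y. h i y * e j y \<partial>M) * e j x)"
      by (intro AE_finite_allI h_exp) simp
    then show ?thesis
    proof eventually_elim
      case (elim x)
      then show ?case using \<sigma>(1) by (simp add: matrix_vector_mult_def A_def e'_def)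
    qed
  qed
  have "\<exists>Ce. \<forall>i. \<forall>x\<in>space M. \<bar>e' i x\<bar> \<le> Ce"
  proof -
    have "\<forall>i. \<exists>c. \<forall>x\<in>space M. \<bar>e i x\<bar> \<le> c" using basis_bdd by (simp add: bdd_meas_def)
    then obtain c where c: "\<And>i x. x \<in> space M \<Longrightarrow> \<bar>e i x\<bar> \<le> c i" by metis
    have "\<bar>e' i x\<bar> \<le> (\<Sum>i\<in>UNIV. \<bar>c i\<bar>) / \<sigma>" if "x \<in> space M" for i x
    proof -
      have "\<bar>e i x\<bar> \<le> \<bar>c i\<bar>" using c[OF that, of i] by linarith
      also have "\<dots> \<le> (\<Sum>i\<in>UNIV. \<bar>c i\<bar>)" by (rule member_le_sum) auto
      finally show ?thesis using \<sigma>(1) by (simp add: e'_def abs_divide divide_right_mono)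
    qed
    then show ?thesis by blast
  qed
  then obtain Ce where Ce: "\<And>i x. x \<in> space M \<Longrightarrow> \<bar>e' i x\<bar> \<le> Ce" by blast
  interpret observed_chain M T \<alpha> P e' J Ce
  proof
    show "e' i \<in> borel_measurable M" for i
      using basis_bdd[of i] unfolding e'_def[abs_def] bdd_meas_def by (intro borel_measurable_divide) auto
    show "\<bar>e' i x\<bar> \<le> Ce" if "x \<in> space M" for i x by (rule Ce[OF that])
    show "(\<integral>x. e' i x \<partial>M) = 0" for i unfolding e'_def using basis_centred[of i] by simp
    show "(1 - (1 - \<alpha>)\<^sup>2) * (\<integral>x. e' i x * e' j x \<partial>M) = (if i = j \<and> i \<in> J then 1 else 0)" for i j
    proof -
      have "(\<integral>x. e' i x * e' j x \<partial>M) = (\<integral>x. e i x * e j x \<partial>M) / (\<sigma> * \<sigma>)"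
        by (simp add: e'_def)
      then show ?thesis using \<sigma> s1 by (simp add: basis_orthonormal)
    qed
  qed
  have cov: "covariance_matrix Q N $ i $ j = (\<Sum>k\<in>UNIV. A $ i $ k * A $ j $ k)" for i j
  proof -
    have entry: "((\<lambda>k. ((1 - \<alpha>) ^ nat \<bar>k\<bar> *\<^sub>R matrix_expectation M (\<lambda>x. tensor_vec (a x) (a (int_iterate M T k x)))) $ i $ j)
        has_sum ((1 - (1 - \<alpha>)\<^sup>2) * (\<integral>x. h i x * h j x \<partial>M))) UNIV" for i j
    proof -
      have "(\<integral>x. a x $ i * a (int_iterate M T k x) $ j \<partial>M) = (\<integral>x. b i x * b j (int_iterate M T k x) \<partial>M)" for k
      proof (rule integral_cong_AE)
        show "(\<lambda>x. a x $ i * a (int_iterate M T k x) $ j) \<in> borel_measurable M"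
          "(\<lambda>x. b i x * b j (int_iterate M T k x)) \<in> borel_measurable M" by measurable
        have "AE x in M. a x $ j = b j x" using ab by (auto elim!: eventually_mono)
        then have "AE x in M. a (int_iterate M T k x) $ j = b j (int_iterate M T k x)"
          by (intro AE_int_iterate[of "\<lambda>x. a x $ j = b j x"]) measurable
        then show "AE x in M. a x $ i * a (int_iterate M T k x) $ j = b i x * b j (int_iterate M T k x)"
          using ab by eventually_elim simp
      qed
      then show ?thesis
        using correlation_has_sum[OF b_meas b_bound b_meas b_bound, of i j]
        by (simp add: matrix_expectation_def tensor_vec_def h_def)
    qed
    have "covariance_matrix Q N $ i $ j = (1 - (1 - \<alpha>)\<^sup>2) * (\<integral>x. h i x * h j x \<partial>M)"
      unfolding assms(10) asymptotic_covariance_def by (rule has_sum_matrix) (rule entry)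
    also have "(\<integral>x. h i x * h j x \<partial>M) = (\<integral>x. (\<Sum>k\<in>UNIV. (\<integral>y. h i y * e k y \<partial>M) * (h j x * e k x)) \<partial>M)"
    proof (rule integral_cong_AE)
      show "AE x in M. h i x * h j x = (\<Sum>k\<in>UNIV. (\<integral>y. h i y * e k y \<partial>M) * (h j x * e k x))"
        using h_exp[of i]
      proof eventually_elim
        case (elim x)
        have "(\<Sum>k\<in>UNIV. c k * e k x) * h j x = (\<Sum>k\<in>UNIV. c k * (h j x * e k x))" for c :: "'d \<Rightarrow> real"
          by (simp only: sum_distrib_right mult.assoc mult.commute[of "h j x"])
        from this[of "\<lambda>k. \<integral>y. h i y * e k y \<partial>M"] show ?case by (simp only: elim[symmetric])
      qed
    qed measurable
    also have "\<dots> = (\<Sum>k\<in>UNIV. (\<integral>y. h i y * e k y \<partial>M) * (\<integral>x. h j x * e k x \<partial>M))"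
      using bdd_meas_integrable[OF bdd_meas_mult[OF h_bdd basis_bdd]]
      by (simp add: Bochner_Integration.integral_sum)
    finally show ?thesis
      by (simp add: A_def sum_distrib_left \<sigma>(2)[symmetric] mult_ac)
  qed
  define nA where "nA = onorm ((*v) A)"
  have nA: "norm (A *v x) \<le> nA * norm x" "0 \<le> nA" for x
    unfolding nA_def by (rule onorm[OF matrix_vector_mul_bounded_linear], rule onorm_pos_le[OF matrix_vector_mul_bounded_linear])
  obtain K where K: "0 \<le> K" and mart: "\<forall>L \<psi> n. bdd_lipschitz L \<psi> \<longrightarrow> (\<forall>i. i \<notin> J \<longrightarrow> inv_dir i \<psi>) \<longrightarrow> 1 \<le> n \<longrightarrow>
     \<bar>(\<integral>\<omega>. \<psi> (S n \<omega>) \<partial>P) - heat (real n) \<psi> 0\<bar> \<le> K * L"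
    using martingale_bound by (elim exE conjE) (rule that)
  let ?d = "real CARD('d)"
  let ?S = "\<lambda>n \<omega>. \<Sum>k = 0..n - 1. a (chain_coord (int k) \<omega>)"
  define B where "B = K * nA + ?d * (2 * H) + 1"
  have H0: "0 \<le> H" using \<alpha> by (simp add: H_def C1_def)
  have B0: "0 < B" using K nA(2) H0 by (simp add: B_def add_nonneg_pos)
  have decomposition: "AE \<omega> in P. ?S n \<omega> = A *v S n \<omega> + (\<chi> i. h i (\<omega> 0) - h i (\<omega> (int n)))" if n: "1 \<le> n" for n
  proof -
    have 1: "AE \<omega> in P. \<forall>k::int. \<forall>i. a (\<omega> k) $ i = b i (\<omega> k)"
      by (subst AE_all_countable) (intro allI AE_coord ab)
    have 2: "AE \<omega> in P. \<forall>k::int. \<forall>i. h i (\<omega> k) = (A *v (\<chi> j. e' j (\<omega> k))) $ i"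
      by (subst AE_all_countable) (intro allI AE_coord h_exp')
    have 3: "AE \<omega> in P. \<forall>k::int. \<forall>i. h i (T (\<omega> k)) = (A *v (\<chi> j. e' j (T (\<omega> k)))) $ i"
      by (subst AE_all_countable) (intro allI AE_coord[of "\<lambda>x. \<forall>i. h i (T x) = (A *v (\<chi> j. e' j (T x))) $ i"]
          AE_T[of "\<lambda>x. \<forall>i. h i x = (A *v (\<chi> j. e' j x)) $ i"] h_exp')
    from 1 2 3 show ?thesis
    proof eventually_elim
      case (elim \<omega>)
      have "?S n \<omega> $ i = (A *v S n \<omega> + (\<chi> i. h i (\<omega> 0) - h i (\<omega> (int n)))) $ i" for i
      proof -
        have "(A *v S n \<omega>) $ i = (\<Sum>j\<in>UNIV. \<Sum>k<n. A $ i $ j * xi k j \<omega>)"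
          by (simp add: matrix_vector_mult_def S_def sum_distrib_left)
        also have "\<dots> = (\<Sum>k<n. \<Sum>j\<in>UNIV. A $ i $ j * xi k j \<omega>)" by (rule sum.swap)
        also have "\<dots> = (\<Sum>k<n. h i (\<omega> (int k + 1)) - (1 - \<alpha>) * h i (T (\<omega> (int k))))"
        proof (intro sum.cong refl)
          fix k
          show "(\<Sum>j\<in>UNIV. A $ i $ j * xi k j \<omega>) = h i (\<omega> (int k + 1)) - (1 - \<alpha>) * h i (T (\<omega> (int k)))"
            using elim(2,3) by (simp add: matrix_vector_mult_def xi_def right_diff_distrib sum_subtractf sum_distrib_left mult_ac)
        qed
        finally have m: "(A *v S n \<omega>) $ i = (\<Sum>k<n. h i (\<omega> (int k + 1)) - (1 - \<alpha>) * h i (T (\<omega> (int k))))" .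
        have "?S n \<omega> $ i = (\<Sum>k\<in>{0..n - 1}. b i (\<omega> (int k)))"
          using elim(1) by (simp add: sum_component chain_coord_def)
        also have "\<dots> = (\<Sum>k<n. b i (\<omega> (int k)))"
          by (rule sum.cong) (use n in auto)
        also have "(\<Sum>k<n. b i (\<omega> (int k))) = (\<Sum>k<n. (h i (\<omega> (int k + 1)) - (1 - \<alpha>) * h i (T (\<omega> (int k))))
            + (h i (\<omega> (int k)) - h i (\<omega> (int (Suc k)))))"
          by (intro sum.cong refl) (simp add: h_eq[symmetric] add.commute)
        also have "\<dots> = (A *v S n \<omega>) $ i + (\<Sum>k<n. h i (\<omega> (int k)) - h i (\<omega> (int (Suc k))))"
          by (simp only: sum.distrib m)
        also have "(\<Sum>k<n. h i (\<omega> (int k)) - h i (\<omega> (int (Suc k)))) = h i (\<omega> (int 0)) - h i (\<omega> (int n))"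
          by (rule sum_lessThan_telescope')
        finally show ?thesis by simp
      qed
      then show ?case by (simp only: vec_eq_iff) simp
    qed
  qed
  have S_meas [measurable]: "(\<lambda>\<omega>. ?S n \<omega>) \<in> borel_measurable P" for n
    unfolding chain_coord_def by measurable
  have bounded_case: "\<bar>(\<integral>\<omega>. f ((1 / sqrt (real n)) *\<^sub>R ?S n \<omega>) \<partial>P) - (\<integral>q. f (N q) \<partial>Q)\<bar> \<le> B / sqrt (real n) * L"
    if f: "bdd_lipschitz L f" and n: "1 \<le> n" for f L n
  proof -
    let ?s = "1 / sqrt (real n)"
    have s0: "0 < ?s" using n by simp
    have L0: "0 \<le> L" by (rule bdd_lipschitz_nonneg[OF f])
    have fL: "\<bar>f x - f y\<bar> \<le> L * norm (x - y)" for x y using f by (simp add: bdd_lipschitz_def)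
    have [measurable]: "f \<in> borel_measurable borel" by (rule bdd_lipschitz_measurable[OF f])
    obtain D where D: "\<And>x. \<bar>f x\<bar> \<le> D" using f by (auto simp: bdd_lipschitz_def)
    \<comment> \<open>The rescaled test function in the coordinates of \<open>e'\<close>.\<close>
    define \<psi> where "\<psi> w = f (?s *\<^sub>R (A *v w))" for w
    have \<psi>: "bdd_lipschitz (L * nA * ?s) \<psi>"
      unfolding bdd_lipschitz_def
    proof (intro conjI allI exI[of _ D])
      fix x y
      show "\<bar>\<psi> x\<bar> \<le> D" by (simp add: \<psi>_def D)
      have "\<bar>\<psi> x - \<psi> y\<bar> \<le> L * norm (?s *\<^sub>R (A *v x) - ?s *\<^sub>R (A *v y))"
        unfolding \<psi>_def by (rule fL)
      also have "?s *\<^sub>R (A *v x) - ?s *\<^sub>R (A *v y) = ?s *\<^sub>R (A *v (x - y))"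
        by (simp only: matrix_vector_mult_diff_distrib scaleR_diff_right)
      also have "norm (?s *\<^sub>R (A *v (x - y))) = ?s * norm (A *v (x - y))" using s0 by simp
      also have "L * (?s * norm (A *v (x - y))) \<le> L * (?s * (nA * norm (x - y)))"
        using L0 s0 nA(1) by (intro mult_left_mono) auto
      finally show "\<bar>\<psi> x - \<psi> y\<bar> \<le> L * nA * ?s * norm (x - y)" by (simp add: mult_ac)
    qed
    have inv: "inv_dir i \<psi>" if "i \<notin> J" for i
    proof -
      have "A *v (\<theta> *\<^sub>R axis i 1) = 0" for \<theta>
        using basis_zero[OF that] by (simp add: vec_eq_iff matrix_vector_mult_def A_def axis_def if_distrib[of "\<lambda>c. _ * c"] cong: if_cong)
      then show ?thesis by (simp add: inv_dir_def \<psi>_def matrix_vector_right_distrib)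
    qed
    have 1: "\<bar>(\<integral>\<omega>. \<psi> (S n \<omega>) \<partial>P) - heat (real n) \<psi> 0\<bar> \<le> K * (L * nA * ?s)"
      using mart \<psi> inv n by blast
    have 2: "heat (real n) \<psi> 0 = (\<integral>q. f (N q) \<partial>Q)"
    proof -
      have "\<psi> (0 + sqrt (real n) *\<^sub>R w) = f (A *v w)" for w
        using n by (simp add: \<psi>_def matrix_vector_mult_scaleR)
      then have "heat (real n) \<psi> 0 = (\<integral>w. f (A *v w) \<partial>std_gauss)" by (simp only: heat_def)
      then show ?thesis using gaussian_vector_expectation[OF assms(7,8,9) cov f] by simp
    qed
    have 3: "\<bar>(\<integral>\<omega>. f (?s *\<^sub>R ?S n \<omega>) \<partial>P) - (\<integral>\<omega>. \<psi> (S n \<omega>) \<partial>P)\<bar> \<le> L * (?s * (?d * (2 * H)))"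
    proof -
      let ?u = "\<lambda>\<omega>. \<chi> i. h i (\<omega> 0) - h i (\<omega> (int n))"
      have [measurable]: "?u \<in> borel_measurable P" by measurable
      have eq: "(\<integral>\<omega>. f (?s *\<^sub>R ?S n \<omega>) \<partial>P) = (\<integral>\<omega>. f (?s *\<^sub>R (A *v S n \<omega> + ?u \<omega>)) \<partial>P)"
      proof (rule integral_cong_AE)
        show "AE \<omega> in P. f (?s *\<^sub>R ?S n \<omega>) = f (?s *\<^sub>R (A *v S n \<omega> + ?u \<omega>))"
          using decomposition[OF n] by eventually_elim (simp only:)
      qed measurable
      have i1: "integrable P (\<lambda>\<omega>. f (?s *\<^sub>R (A *v S n \<omega> + ?u \<omega>)))"
        using D by (intro integrable_bounded_P[where B=D]) auto
      have i2: "integrable P (\<lambda>\<omega>. \<psi> (S n \<omega>))"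
        by (intro P.bdd_meas_integrable bdd_meas_S bdd_lipschitz_bdd_borel[OF \<psi>])
      have "\<bar>\<integral>\<omega>. f (?s *\<^sub>R (A *v S n \<omega> + ?u \<omega>)) - \<psi> (S n \<omega>) \<partial>P\<bar> \<le> L * (?s * (?d * (2 * H)))"
      proof (rule expectation_bound_P)
        show "(\<lambda>\<omega>. f (?s *\<^sub>R (A *v S n \<omega> + ?u \<omega>)) - \<psi> (S n \<omega>)) \<in> borel_measurable P"
          using i1 i2 by simp
        fix \<omega>
        have "\<bar>f (?s *\<^sub>R (A *v S n \<omega> + ?u \<omega>)) - \<psi> (S n \<omega>)\<bar> \<le> L * norm (?s *\<^sub>R (A *v S n \<omega> + ?u \<omega>) - ?s *\<^sub>R (A *v S n \<omega>))"
          unfolding \<psi>_def by (rule fL)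
        also have "?s *\<^sub>R (A *v S n \<omega> + ?u \<omega>) - ?s *\<^sub>R (A *v S n \<omega>) = ?s *\<^sub>R ?u \<omega>"
          by (simp add: scaleR_add_right)
        also have "norm (?s *\<^sub>R ?u \<omega>) = ?s * norm (?u \<omega>)" using s0 by simp
        also have "L * (?s * norm (?u \<omega>)) \<le> L * (?s * (?d * (2 * H)))"
        proof (intro mult_left_mono L0)
          have "norm (?u \<omega>) \<le> (\<Sum>i\<in>UNIV. \<bar>?u \<omega> $ i\<bar>)" by (rule norm_le_l1_cart)
          also have "\<dots> \<le> (\<Sum>i\<in>(UNIV::'d set). 2 * H)"
          proof (rule sum_mono)
            fix i
            show "\<bar>?u \<omega> $ i\<bar> \<le> 2 * H" using h_bound[of i "\<omega> 0"] h_bound[of i "\<omega> (int n)"] by simp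
          qed
          finally show "norm (?u \<omega>) \<le> ?d * (2 * H)" by simp
        qed (use s0 in simp)
        finally show "\<bar>f (?s *\<^sub>R (A *v S n \<omega> + ?u \<omega>)) - \<psi> (S n \<omega>)\<bar> \<le> L * (?s * (?d * (2 * H)))" .
      qed
      then show ?thesis unfolding eq by (simp only: Bochner_Integration.integral_diff[OF i1 i2])
    qed
    have "\<bar>(\<integral>\<omega>. f (?s *\<^sub>R ?S n \<omega>) \<partial>P) - (\<integral>q. f (N q) \<partial>Q)\<bar> \<le> K * (L * nA * ?s) + L * (?s * (?d * (2 * H)))"
      using 1 2 3 by linarith
    also have "\<dots> = (K * nA + ?d * (2 * H)) * (?s * L)" by algebra
    also have "\<dots> \<le> B * (?s * L)" using s0 L0 by (intro mult_right_mono) (auto simp: B_def)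
    also have "\<dots> = B / sqrt (real n) * L" by simp
    finally show ?thesis .
  qed
  show ?thesis
  proof (intro exI[of _ B] conjI allI impI B0)
    fix \<phi> :: "real^'d \<Rightarrow> real" and n :: nat
    assume "\<exists>L. L-lipschitz_on UNIV \<phi>" and n: "n \<ge> 1"
    then obtain L where L: "L-lipschitz_on UNIV \<phi>" by blast
    let ?L = "lipschitz_const \<phi>"
    note lip = lipschitz_const_bound(1)[OF L]
    have \<phi>_meas: "\<phi> \<in> borel_measurable borel"
      using lipschitz_on_continuous_on[OF L] by (rule borel_measurable_continuous_onI)
    have iS: "integrable P (\<lambda>\<omega>. (1 / sqrt (real n)) *\<^sub>R ?S n \<omega>)"
    proof -
      have "integrable P (\<lambda>\<omega>. a (\<omega> k))" for k
        using a_int distr_coord[of k] integrable_distr[OF coord_measurable, of k a] by simp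
      then show ?thesis unfolding chain_coord_def
        by (intro integrable_scaleR_right Bochner_Integration.integrable_sum)
    qed
    \<comment> \<open>The bound for clipped test functions does not depend on the clipping level.\<close>
    have "(\<lambda>m. \<bar>(\<integral>\<omega>. truncate m (\<phi> ((1 / sqrt (real n)) *\<^sub>R ?S n \<omega>)) \<partial>P) - (\<integral>q. truncate m (\<phi> (N q)) \<partial>Q)\<bar>)
        \<longlonglongrightarrow> \<bar>(\<integral>\<omega>. \<phi> ((1 / sqrt (real n)) *\<^sub>R ?S n \<omega>) \<partial>P) - (\<integral>q. \<phi> (N q) \<partial>Q)\<bar>"
      by (intro tendsto_rabs tendsto_diff truncate_expectation[OF P.prob_space_axioms iS lip \<phi>_meas]
          truncate_expectation[OF Q.prob_space_axioms gaussian_vector_integrable[OF assms(8)] lip \<phi>_meas])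
    then show "\<bar>(\<integral>\<omega>. \<phi> ((1 / sqrt (real n)) *\<^sub>R ?S n \<omega>) \<partial>P) - (\<integral>q. \<phi> (N q) \<partial>Q)\<bar> \<le> B / sqrt (real n) * ?L"
    proof (rule LIMSEQ_le_const2)
      show "\<exists>m0. \<forall>m\<ge>m0. \<bar>(\<integral>\<omega>. truncate m (\<phi> ((1 / sqrt (real n)) *\<^sub>R ?S n \<omega>)) \<partial>P) - (\<integral>q. truncate m (\<phi> (N q)) \<partial>Q)\<bar> \<le> B / sqrt (real n) * ?L"
        using bounded_case[OF bdd_lipschitz_truncate[OF lip] n] by blast
    qed
  qed
qed

end
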